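(* Let $K_1,\dots,K_n\subset\mathbb{C}$ be compact and non-polar, $K=K_1\times\dots\times K_n\subset\mathbb{C}^n$, and let $S\subset\mathbb{R}^n_+$ be compact convex and contain $0$. Let $\hat S_\ell$ denote the lower hull of $S$. Then, for all $z=(z_1,\dots,z_n)\in\mathbb{C}^n$, $$V^{\hat S_\ell}_K(z)=\varphi_S\big(V_{K_1}(z_1),\dots,V_{K_n}(z_n)\big).$$
   Context: $\mathbb{R}_+=[0,\infty)$, $\mathbb{C}^{*n}=(\mathbb{C}\setminus\{0\})^n$. For compact convex $S\subset\mathbb{R}^n$, $\varphi_S(\xi)=\sup_{x\in S}\langle x,\xi\rangle$ is its supporting function. A compact convex set $S\subset\mathbb{R}^n_+$ with $0\in S$ is a lower set if for all $s\in S$ the box $[0,s_1]\times\dots\times[0,s_n]$ is contained in $S$. The lower hull $\hat S_\ell$ of $S$ is the smallest lower set containing $S$ (the subscript $\ell$ is just notation). For $S\subset\mathbb{R}^n_+$ compact convex containing $0$, the logarithmic supporting function is $H_S(z)=\varphi_S(\log|z_1|,\dots,\log|z_n|)$ for $z\in\mathbb{C}^{*n}$, extended to $\mathbb{C}^n$ by $H_S(z)=\varlimsup_{\mathbb{C}^{*n}\ni w\to z}H_S(w)$. The Lelong class $\mathcal{L}^S(\mathbb{C}^n)$ consists of all plurisubharmonic $u$ on $\mathbb{C}^n$ such that $u\le H_S+c_u$ for some constant $c_u$. For compact $K\subset\mathbb{C}^n$, $V^S_K(z)=\sup\{u(z)\,;\,u\in\mathcal{L}^S(\mathbb{C}^n),\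 u|_K\le 0\}$. When the superscript is omitted, $S$ is the standard simplex; thus for compact $L\subset\mathbb{C}$, $V_L=V_L^{[0,1]}$ is the supremum of all subharmonic $u$ on $\mathbb{C}$ with $u(\zeta)\le\log^+|\zeta|+c_u$ for some constant $c_u$ and $u|_L\le 0$. *)

theory Defs
  imports "HOL-Analysis.Analysis"
begin

definition upper_semicontinuous :: "('a::topological_space \<Rightarrow> ereal) \<Rightarrow> bool" where
  "upper_semicontinuous u \<longleftrightarrow> (\<forall>c::ereal. open {z. u z < c})"

text \<open>
  Mean value of an extended real function over a circle, as the integral of the positive part
  minus the integral of the negative part (the coercion \<^const>\<open>e2ennreal\<close> sends negative
  numbers to 0). For \<open>u\<close> upper semicontinuous and \<open>u < \<infinity>\<close>, the function is measurable and
  bounded above on the circle, so the first integral is finite and the difference is a well-defined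
  element of \<open>[-\<infinity>, \<infinity>)\<close>.
\<close>
definition circle_mean :: "(complex \<Rightarrow> ereal) \<Rightarrow> complex \<Rightarrow> real \<Rightarrow> ereal" where
  "circle_mean u z r =
     (enn2ereal (\<integral>\<^sup>+t\<in>{0..2*pi}. e2ennreal (u (z + of_real r * cis t)) \<partial>lborel)
      - enn2ereal (\<integral>\<^sup>+t\<in>{0..2*pi}. e2ennreal (- u (z + of_real r * cis t)) \<partial>lborel))
     / ereal (2 * pi)"

text \<open>
  Subharmonic functions on the whole plane, with values in \<open>[-\<infinity>, \<infinity>)\<close>. The constant function
  \<open>-\<infinity>\<close> is allowed; hence the restriction of a plurisubharmonic function to a complex line is
  always subharmonic below.
\<close>
definition subharmonic :: "(complex \<Rightarrow> ereal) \<Rightarrow> bool" where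
  "subharmonic u \<longleftrightarrow> upper_semicontinuous u \<and> (\<forall>z. u z < \<infinity>) \<and>
     (\<forall>z. \<forall>r>0. u z \<le> circle_mean u z r)"

definition plurisubharmonic :: "(complex^'n \<Rightarrow> ereal) \<Rightarrow> bool" where
  "plurisubharmonic u \<longleftrightarrow> upper_semicontinuous u \<and> (\<forall>z. u z < \<infinity>) \<and>
     (\<forall>a b. subharmonic (\<lambda>\<zeta>. u (a + \<zeta> *s b)))"

definition polar :: "complex set \<Rightarrow> bool" where
  "polar E \<longleftrightarrow> (\<exists>u. subharmonic u \<and> (\<exists>z. u z \<noteq> -\<infinity>) \<and> (\<forall>z\<in>E. u z = -\<infinity>))"

definition nonneg_orthant :: "(real^'n) set" where
  "nonneg_orthant = {x. \<forall>i. 0 \<le> x $ i}"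

text \<open>The lower hull of \<open>S\<close> is \<open>lower_set hull S\<close>.\<close>
definition lower_set :: "(real^'n) set \<Rightarrow> bool" where
  "lower_set S \<longleftrightarrow> compact S \<and> convex S \<and> S \<subseteq> nonneg_orthant \<and> 0 \<in> S \<and>
     (\<forall>s\<in>S. cbox 0 s \<subseteq> S)"

text \<open>
  The supremum is taken in the reals; it is meaningful for bounded nonempty \<open>S\<close>.
\<close>
definition supporting_fun :: "(real^'n) set \<Rightarrow> real^'n \<Rightarrow> real" where
  "supporting_fun S \<xi> = (SUP x\<in>S. x \<bullet> \<xi>)"

definition punctured_space :: "(complex^'n) set" where
  "punctured_space = {z. \<forall>i. z $ i \<noteq> 0}"

definition log_supporting_fun :: "(real^'n) set \<Rightarrow> complex^'n \<Rightarrow> ereal" where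
  "log_supporting_fun S z =
     (let h = (\<lambda>w. ereal (supporting_fun S (\<chi> i. ln (cmod (w $ i)))))
      in if z \<in> punctured_space then h z else Limsup (at z within punctured_space) h)"

definition lelong_class :: "(real^'n) set \<Rightarrow> (complex^'n \<Rightarrow> ereal) set" where
  "lelong_class S =
     {u. plurisubharmonic u \<and> (\<exists>c::real. \<forall>z. u z \<le> log_supporting_fun S z + ereal c)}"

definition extremal_fun :: "(real^'n) set \<Rightarrow> (complex^'n) set \<Rightarrow> complex^'n \<Rightarrow> ereal" where
  "extremal_fun S K z = (SUP u \<in> {u \<in> lelong_class S. \<forall>w\<in>K. u w \<le> 0}. u z)"

text \<open>
  The one-dimensional case \<open>S = [0, 1]\<close>, on \<^typ>\<open>complex\<close> itself: then the logarithmic supporting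
  function is \<open>log\<^sup>+ \<bar>\<zeta>\<bar>\<close>. At \<open>\<zeta> = 0\<close> the formula below is 0 because \<open>ln 0 = 0\<close>.
  For \<open>L\<close> compact and not polar the extremal function below takes values in \<open>[0, \<infinity>)\<close>, so that
  passing to its real value with \<^const>\<open>real_of_ereal\<close> loses nothing.
\<close>
definition lelong_class1 :: "(complex \<Rightarrow> ereal) set" where
  "lelong_class1 =
     {u. subharmonic u \<and> (\<exists>c::real. \<forall>\<zeta>. u \<zeta> \<le> ereal (max 0 (ln (cmod \<zeta>)) + c))}"

definition extremal_fun1 :: "complex set \<Rightarrow> complex \<Rightarrow> ereal" where
  "extremal_fun1 L z = (SUP u \<in> {u \<in> lelong_class1. \<forall>w\<in>L. u w \<le> 0}. u z)"

end

theory Submission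
  imports Defs "HOL-Complex_Analysis.Conformal_Mappings"
begin

text \<open>
  Write \<open>V i\<close> for the one-variable extremal function of \<open>K i\<close> and \<open>T\<close> for the lower hull of \<open>S\<close>, which
  consists of the points of the orthant lying below a point of \<open>S\<close> (\<open>lower_hull_eq\<close>). On vectors with
  nonnegative entries \<open>S\<close> and \<open>T\<close> have the same supporting function \<open>\<phi>\<close>, and since \<open>T\<close> is a lower
  set its logarithmic supporting function is \<open>\<phi>\<close> of the vector with entries \<open>log\<^sup>+ |z i|\<close>, on the
  coordinate hyperplanes too.

  The inequality \<open>\<ge>\<close> is direct: for \<open>s\<close> in \<open>T\<close> and competitors \<open>v i\<close> for \<open>V i\<close>, the sum of the
  \<open>s i * max 0 (v i (z i))\<close> is a competitor for the left-hand side.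

  For \<open>\<le>\<close>, let \<open>u\<close> be a competitor for the left-hand side. By the maximum principle \<open>u\<close> stays
  nonpositive when the holes of the \<open>K i\<close> are filled in, so \<open>u < \<epsilon>\<close> near the product of the filled
  sets. Hilbert's lemniscate theorem, proved with Fekete points, gives polynomials \<open>P i\<close> with
  \<open>|P i| \<le> 1\<close> on \<open>K i\<close> such that \<open>u < \<epsilon>\<close> still holds on the product of the sets \<open>|P i| \<le> 1\<close>. With \<open>d i\<close>
  the degree of \<open>P i\<close>, the function \<open>g i = log\<^sup>+ |P i| / d i\<close> is a competitor for \<open>V i\<close>, hence
  \<open>g i \<le> V i\<close>, and \<open>\<phi>\<close> is monotone; so it is enough to bound \<open>u\<close> by \<open>\<epsilon> + \<phi>\<close> applied to the \<open>g i\<close>.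

  Fix a point \<open>a\<close> and consider the set where all \<open>g i (z i) = h * g i (a i)\<close> with a common parameter
  \<open>h \<ge> 0\<close>. It is filled by analytic discs on which \<open>h\<close> is harmonic (\<open>level_torus_disc\<close>): locally
  \<open>log (P i)\<close> is a power of a coordinate, so the curve \<open>log (P i (z i)) = const + c i * \<zeta> ^ K\<close> can
  be solved for \<open>z i\<close> even at critical points of \<open>P i\<close>. Hence \<open>u - A * h\<close> obeys the maximum
  principle on the part \<open>0 \<le> h \<le> R\<close> of this set (\<open>level_torus_max_principle\<close>). At \<open>h = 0\<close> the
  function \<open>u\<close> is below \<open>\<epsilon>\<close>; at \<open>h = R\<close> the growth condition bounds it by \<open>R\<close> times \<open>\<phi>\<close> of the \<open>g i (a i)\<close>
  plus a constant. Evaluating at \<open>h = 1\<close> and letting \<open>R\<close> tend to infinity gives the bound.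
  Plurisubharmonicity is given on complex lines only and \<open>u\<close> need not be continuous; a doubling of
  variables replaces the usual smoothing.

  Non-polarity enters through the finiteness of \<open>V i\<close>. If it failed, monic polynomials with roots in
  \<open>K i\<close> would have arbitrarily small normalised sup norms on \<open>K i\<close>, and a series of their logarithms would
  be a subharmonic function equal to \<open>-\<infinity>\<close> on \<open>K i\<close> (\<open>polar_if_small_polynomials\<close>). Otherwise the
  bound by lemniscates, used in dimension one, bounds all competitors for \<open>V i\<close> at once.
\<close>

section \<open>Circle means\<close>

lemma enn2ereal_leI: "x \<le> y \<Longrightarrow> enn2ereal x \<le> enn2ereal y"
  by (simp add: less_eq_ennreal.rep_eq)

lemma upper_semicontinuous_borel:
  assumes "upper_semicontinuous (U :: complex \<Rightarrow> ereal)"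
  shows "U \<in> borel_measurable borel"
  using assms unfolding upper_semicontinuous_def
  by (intro borel_measurableI_less) simp

lemma enn2ereal_minus_finite:
  assumes "x \<noteq> top" "y \<noteq> top"
  shows "enn2ereal x - enn2ereal y = ereal (enn2real x - enn2real y)"
  using assms by (cases x; cases y) (auto simp: enn2ereal_ennreal)

lemma circle_mean_mono:
  assumes "\<And>w. cmod (w - z) = r \<Longrightarrow> U w \<le> W w" and "0 < r"
  shows "circle_mean U z r \<le> circle_mean W z r"
proof -
  have le: "U (z + of_real r * cis t) \<le> W (z + of_real r * cis t)" for t
    using assms by (auto simp: norm_mult)
  have "enn2ereal (\<integral>\<^sup>+t\<in>{0..2*pi}. e2ennreal (U (z + of_real r * cis t)) \<partial>lborel)
     \<le> enn2ereal (\<integral>\<^sup>+t\<in>{0..2*pi}. e2ennreal (W (z + of_real r * cis t)) \<partial>lborel)"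
    by (intro enn2ereal_leI nn_integral_mono mult_right_mono e2ennreal_mono le) auto
  moreover have "enn2ereal (\<integral>\<^sup>+t\<in>{0..2*pi}. e2ennreal (- W (z + of_real r * cis t)) \<partial>lborel)
     \<le> enn2ereal (\<integral>\<^sup>+t\<in>{0..2*pi}. e2ennreal (- U (z + of_real r * cis t)) \<partial>lborel)"
    by (intro enn2ereal_leI nn_integral_mono mult_right_mono e2ennreal_mono) (auto simp: le)
  ultimately show ?thesis
    unfolding circle_mean_def
    by (intro ereal_divide_right_mono ereal_minus_mono) auto
qed

lemma circle_mean_nonneg:
  assumes "\<And>w. 0 \<le> U w"
  shows "circle_mean U z r =
    enn2ereal (\<integral>\<^sup>+t\<in>{0..2*pi}. e2ennreal (U (z + of_real r * cis t)) \<partial>lborel) / ereal (2 * pi)"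
proof -
  have "e2ennreal (- U w) = 0" for w
    using assms by (intro e2ennreal_neg) simp
  then show ?thesis
    by (simp add: circle_mean_def zero_ennreal.rep_eq)
qed

lemma circle_mean_real:
  fixes g :: "complex \<Rightarrow> real"
  assumes "continuous_on (sphere z r) g" and "0 < r"
  shows "circle_mean (\<lambda>w. ereal (g w)) z r =
         ereal (integral {0..2*pi} (\<lambda>t. g (z + of_real r * cis t)) / (2*pi))"
proof -
  define h where "h t = g (z + of_real r * cis t)" for t
  have cont: "continuous_on {0..2*pi} h"
    unfolding h_def
    by (rule continuous_on_compose2[OF assms(1)])
       (use assms(2) in \<open>auto intro!: continuous_intros simp: dist_norm norm_mult\<close>)
  have si: "set_integrable lborel {0..2*pi} h"
    using cont by (rule borel_integrable_atLeastAtMost')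
  then have int: "integrable lborel (\<lambda>t. indicator {0..2*pi} t * h t)"
    by (simp add: set_integrable_def)
  have eq1: "(\<integral>\<^sup>+t\<in>{0..2*pi}. e2ennreal (ereal (h t)) \<partial>lborel)
       = (\<integral>\<^sup>+t. ennreal (indicator {0..2*pi} t * h t) \<partial>lborel)"
    by (intro nn_integral_cong) (auto split: split_indicator)
  have eq2: "(\<integral>\<^sup>+t\<in>{0..2*pi}. e2ennreal (- ereal (h t)) \<partial>lborel)
       = (\<integral>\<^sup>+t. ennreal (- (indicator {0..2*pi} t * h t)) \<partial>lborel)"
    by (intro nn_integral_cong) (auto split: split_indicator)
  have f1: "(\<integral>\<^sup>+t. ennreal (indicator {0..2*pi} t * h t) \<partial>lborel) \<noteq> \<infinity>"
   and f2: "(\<integral>\<^sup>+t. ennreal (- (indicator {0..2*pi} t * h t)) \<partial>lborel) \<noteq> \<infinity>"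
    using int by (auto simp: real_integrable_def)
  have "enn2ereal (\<integral>\<^sup>+t. ennreal (indicator {0..2*pi} t * h t) \<partial>lborel)
     - enn2ereal (\<integral>\<^sup>+t. ennreal (- (indicator {0..2*pi} t * h t)) \<partial>lborel)
     = ereal (\<integral>t. indicator {0..2*pi} t * h t \<partial>lborel)"
    unfolding real_lebesgue_integral_def[OF int] using f1 f2
    by (intro enn2ereal_minus_finite) simp_all
  also have "(\<integral>t. indicator {0..2*pi} t * h t \<partial>lborel) = integral {0..2*pi} h"
    using set_borel_integral_eq_integral(2)[OF si]
    by (simp add: set_lebesgue_integral_def)
  finally show ?thesis
    unfolding circle_mean_def h_def[symmetric] eq1 eq2 by simp
qed

lemma circle_mean_const: "circle_mean (\<lambda>_. c) z r = c"
proof (cases c)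
  case (real x)
  have *: "(\<integral>\<^sup>+t\<in>{0..2*pi}. ennreal y \<partial>lborel) = ennreal y * ennreal (2*pi)" for y
    by (simp add: nn_integral_cmult)
  have e: "enn2ereal (ennreal y * ennreal (2*pi)) = ereal (max 0 y * (2*pi))" for y
    by (cases "y \<ge> 0") (auto simp: ennreal_mult[symmetric] enn2ereal_ennreal ennreal_neg max_def zero_ennreal.rep_eq zero_ereal_def)
  show ?thesis
    unfolding circle_mean_def real uminus_ereal.simps e2ennreal_ereal * e
    by (auto simp: max_def field_simps)
next
  case PInf
  have "(\<integral>\<^sup>+t\<in>{0..2*pi}. (top::ennreal) \<partial>lborel) = top"
    by (subst nn_integral_cmult) (auto simp: ennreal_top_mult)
  with PInf show ?thesis
    by (simp add: circle_mean_def e2ennreal_neg top_ennreal.rep_eq zero_ennreal.rep_eq top_ereal_def del: nn_integral_indicator)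
next
  case MInf
  have "(\<integral>\<^sup>+t\<in>{0..2*pi}. (top::ennreal) \<partial>lborel) = top"
    by (subst nn_integral_cmult) (auto simp: ennreal_top_mult)
  with MInf show ?thesis
    by (simp add: circle_mean_def e2ennreal_neg top_ennreal.rep_eq zero_ennreal.rep_eq top_ereal_def)
qed

lemma integral_circle_holomorphic:
  fixes H :: "complex \<Rightarrow> complex"
  assumes "H holomorphic_on ball z R" and "0 < r" "r < R"
  shows "((\<lambda>t. Re (H (z + of_real r * cis t))) has_integral 2 * pi * Re (H z)) {0..2*pi}"
proof -
  have sub: "cball z r \<subseteq> ball z R" using assms by auto
  have hol: "H holomorphic_on cball z r" using assms(1) sub holomorphic_on_subset by blast
  have "((\<lambda>u. H u / (u - z)) has_contour_integral 2 * of_real pi * \<i> * H z) (circlepath z r)"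
    by (rule Cauchy_integral_circlepath)
       (use hol assms holomorphic_on_subset[OF hol ball_subset_cball] in \<open>auto intro: holomorphic_on_imp_continuous_on\<close>)
  then have "((\<lambda>t. H (z + of_real r * cis t) / (z + of_real r * cis t - z) * of_real r * \<i> * cis t)
      has_integral 2 * of_real pi * \<i> * H z) {0..2*pi}"
    unfolding circlepath_def
    by (subst (asm) has_contour_integral_part_circlepath_iff) simp_all
  moreover have eq: "H (z + of_real r * cis t) / (z + of_real r * cis t - z) * of_real r * \<i> * cis t
      = \<i> * H (z + of_real r * cis t)" for t
    using assms(2) by (simp add: field_simps)
  ultimately have "((\<lambda>t. \<i> * H (z + of_real r * cis t)) has_integral \<i> * (2 * of_real pi * H z)) {0..2*pi}"
    unfolding eq by (simp add: mult.assoc mult.left_commute[of \<i>])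
  then have "((\<lambda>t. (-\<i>) * (\<i> * H (z + of_real r * cis t))) has_integral (-\<i>) * (\<i> * (2 * of_real pi * H z))) {0..2*pi}"
    by (rule has_integral_mult_right)
  then have "((\<lambda>t. H (z + of_real r * cis t)) has_integral of_real (2 * pi) * H z) {0..2*pi}"
    by (simp add: mult.assoc[symmetric])
  from has_integral_Re[OF this] show ?thesis by simp
qed

text \<open>Rotations and power maps preserve circle means; both facts reduce to the shift invariance of the
  integral of a periodic function over a period. Moving the endpoint \<open>a\<close> into the first period uses
  integral shifts, and a window starting inside the first period is cut at \<open>p\<close>.\<close>
lemma nn_integral_periodic_shift:
  fixes g :: "real \<Rightarrow> ennreal"
  assumes [measurable]: "g \<in> borel_measurable borel" and per: "\<And>t. g (t + p) = g t" and "0 < p"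
  shows "(\<integral>\<^sup>+t\<in>{a..<a+p}. g t \<partial>lborel) = (\<integral>\<^sup>+t\<in>{0..<p}. g t \<partial>lborel)"
proof -
  have shift: "(\<integral>\<^sup>+t\<in>{b+p..<c+p}. g t \<partial>lborel) = (\<integral>\<^sup>+t\<in>{b..<c}. g t \<partial>lborel)" for b c
  proof -
    have "(\<integral>\<^sup>+t\<in>{b+p..<c+p}. g t \<partial>lborel) = (\<integral>\<^sup>+t. g (p + 1 * t) * indicator {b+p..<c+p} (p + 1 * t) \<partial>lborel)"
      by (subst nn_integral_real_affine[where c = 1 and t = p]) auto
    also have "\<dots> = (\<integral>\<^sup>+t\<in>{b..<c}. g t \<partial>lborel)"
      by (intro nn_integral_cong) (auto simp: per add.commute[of p] split: split_indicator)
    finally show ?thesis .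
  qed
  have split: "(\<integral>\<^sup>+t\<in>{b..<d}. g t \<partial>lborel) = (\<integral>\<^sup>+t\<in>{b..<c}. g t \<partial>lborel) + (\<integral>\<^sup>+t\<in>{c..<d}. g t \<partial>lborel)"
    if "b \<le> c" "c \<le> d" for b c d
    using that by (subst nn_integral_add[symmetric])
      (auto intro!: nn_integral_cong split: split_indicator)
  have base: "(\<integral>\<^sup>+t\<in>{b..<b+p}. g t \<partial>lborel) = (\<integral>\<^sup>+t\<in>{0..<p}. g t \<partial>lborel)" if "0 \<le> b" "b < p" for b
    using that split[of b p "b+p"] split[of 0 b p] shift[of 0 b] by (simp add: add.commute)
  have int: "(\<integral>\<^sup>+t\<in>{b + of_int n * p..<b + of_int n * p + p}. g t \<partial>lborel)
      = (\<integral>\<^sup>+t\<in>{b..<b+p}. g t \<partial>lborel)" for b and n :: int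
  proof (induction n rule: int_induct[where k = 0])
    case (step1 i)
    then show ?case using shift[of "b + of_int i * p" "b + of_int i * p + p"]
      by (simp add: algebra_simps)
  next
    case (step2 i)
    then show ?case using shift[of "b + of_int (i-1) * p" "b + of_int (i-1) * p + p"]
      by (simp add: algebra_simps)
  qed auto
  define n where "n = \<lfloor>a / p\<rfloor>"
  have "0 \<le> a - of_int n * p" "a - of_int n * p < p"
    unfolding n_def using \<open>0 < p\<close> floor_divide_lower[of p a] floor_divide_upper[of p a]
    by (auto simp: algebra_simps)
  from base[OF this] int[of "a - of_int n * p" n] show ?thesis by simp
qed

lemma nn_integral_periodic_affine:
  fixes g :: "real \<Rightarrow> ennreal"
  assumes [measurable]: "g \<in> borel_measurable borel" and per: "\<And>t. g (t + 2*pi) = g t" and "0 < k"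
  shows "(\<integral>\<^sup>+t\<in>{0..2*pi}. g (\<alpha> + of_nat k * t) \<partial>lborel) = (\<integral>\<^sup>+t\<in>{0..2*pi}. g t \<partial>lborel)"
proof -
  \<comment> \<open>Half-open intervals can be glued without overlaps.\<close>
  have ends: "(\<integral>\<^sup>+t\<in>{0..2*pi}. f t \<partial>lborel) = (\<integral>\<^sup>+t\<in>{0..<2*pi}. f t \<partial>lborel)" for f :: "real \<Rightarrow> ennreal"
    by (rule nn_integral_cong_AE, rule eventually_mono[OF AE_lborel_singleton[of "2*pi"]])
       (auto split: split_indicator)
  have many: "(\<integral>\<^sup>+t\<in>{\<alpha>..<\<alpha> + of_nat k * (2*pi)}. g t \<partial>lborel) = of_nat k * (\<integral>\<^sup>+t\<in>{0..<2*pi}. g t \<partial>lborel)" for k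
  proof (induction k)
    case (Suc k)
    have "(\<integral>\<^sup>+t\<in>{\<alpha>..<\<alpha> + of_nat (Suc k) * (2*pi)}. g t \<partial>lborel)
       = (\<integral>\<^sup>+t. g t * indicator {\<alpha>..<\<alpha> + of_nat k * (2*pi)} t
            + g t * indicator {\<alpha> + of_nat k * (2*pi)..<\<alpha> + of_nat k * (2*pi) + 2*pi} t \<partial>lborel)"
    proof (intro nn_integral_cong)
      fix t :: real
      define c where "c = of_nat k * (2*pi)"
      have "0 \<le> c" "of_nat (Suc k) * (2*pi) = c + 2*pi"
        by (simp_all add: c_def algebra_simps)
      then show "g t * indicator {\<alpha>..<\<alpha> + of_nat (Suc k) * (2*pi)} t =
          g t * indicator {\<alpha>..<\<alpha> + of_nat k * (2*pi)} t
            + g t * indicator {\<alpha> + of_nat k * (2*pi)..<\<alpha> + of_nat k * (2*pi) + 2*pi} t"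
        unfolding c_def[symmetric] using pi_gt_zero by (auto split: split_indicator simp del: pi_gt_zero)
    qed
    also have "\<dots> = of_nat k * (\<integral>\<^sup>+t\<in>{0..<2*pi}. g t \<partial>lborel) + (\<integral>\<^sup>+t\<in>{0..<2*pi}. g t \<partial>lborel)"
      by (subst nn_integral_add)
        (use Suc nn_integral_periodic_shift[of g "2*pi" "\<alpha> + of_nat k * (2*pi)"] per in auto)
    finally show ?case by (simp add: algebra_simps)
  qed simp
  have "of_nat k * (\<integral>\<^sup>+t\<in>{0..<2*pi}. g t \<partial>lborel)
      = ennreal (of_nat k) * (\<integral>\<^sup>+t. g (\<alpha> + of_nat k * t) * indicator {\<alpha>..<\<alpha> + of_nat k * (2*pi)} (\<alpha> + of_nat k * t) \<partial>lborel)"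
    unfolding many[symmetric]
    by (subst nn_integral_real_affine[where c = "of_nat k" and t = \<alpha>]) (use \<open>0 < k\<close> in auto)
  also have "(\<integral>\<^sup>+t. g (\<alpha> + of_nat k * t) * indicator {\<alpha>..<\<alpha> + of_nat k * (2*pi)} (\<alpha> + of_nat k * t) \<partial>lborel)
      = (\<integral>\<^sup>+t\<in>{0..<2*pi}. g (\<alpha> + of_nat k * t) \<partial>lborel)"
    by (intro nn_integral_cong) (use \<open>0 < k\<close> in \<open>auto simp: zero_le_mult_iff split: split_indicator\<close>)
  finally have "of_nat k * (\<integral>\<^sup>+t\<in>{0..<2*pi}. g t \<partial>lborel) = of_nat k * (\<integral>\<^sup>+t\<in>{0..<2*pi}. g (\<alpha> + of_nat k * t) \<partial>lborel)"
    by (simp add: ennreal_of_nat_eq_real_of_nat)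
  then show ?thesis
    unfolding ends using \<open>0 < k\<close> by (simp add: ennreal_mult_cancel_left)
qed

lemma circle_mean_power:
  assumes [measurable]: "U \<in> borel_measurable borel" and "0 < k"
  shows "circle_mean (\<lambda>w. U (a + b * w ^ k)) 0 r = circle_mean U a (cmod b * r ^ k)"
proof -
  \<comment> \<open>In polar coordinates the substitution is the affine map \<open>t \<mapsto> \<alpha> + k t\<close> of the angle.\<close>
  obtain \<alpha> where b: "b = of_real (cmod b) * cis \<alpha>"
    by (metis rcis_cmod_Arg rcis_def)
  have arg: "a + b * (0 + of_real r * cis t) ^ k = a + of_real (cmod b * r ^ k) * cis (\<alpha> + of_nat k * t)" for t
  proof -
    have "cis \<alpha> * cis t ^ k = cis (\<alpha> + of_nat k * t)"
      by (simp only: Complex.DeMoivre cis_mult)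
    moreover have "b * (0 + of_real r * cis t) ^ k = (of_real (cmod b) * cis \<alpha>) * (of_real r ^ k * cis t ^ k)"
      by (metis b add_0 power_mult_distrib)
    ultimately show ?thesis
      by (simp add: ac_simps)
  qed
  have per: "cis (t + 2 * pi) = cis t" for t
    by (simp add: cis_mult[symmetric])
  have *: "(\<integral>\<^sup>+t\<in>{0..2*pi}. e2ennreal (F (a + b * (0 + of_real r * cis t) ^ k)) \<partial>lborel)
      = (\<integral>\<^sup>+t\<in>{0..2*pi}. e2ennreal (F (a + of_real (cmod b * r ^ k) * cis t)) \<partial>lborel)"
    if [measurable]: "F \<in> borel_measurable borel" for F
  proof -
    have [measurable]: "(\<lambda>t. cis t) \<in> borel_measurable borel"
      by (intro borel_measurable_continuous_onI continuous_intros)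
    show ?thesis
      unfolding arg
      by (rule nn_integral_periodic_affine[OF _ _ \<open>0 < k\<close>, where g = "\<lambda>t. e2ennreal (F (a + of_real (cmod b * r ^ k) * cis t))"])
         (measurable, simp only: per)
  qed
  have "(\<lambda>w. - U w) \<in> borel_measurable borel" by measurable
  from *[OF assms(1)] *[OF this] show ?thesis
    unfolding circle_mean_def by (simp only:)
qed

section \<open>Semicontinuity\<close>

lemma usc_compose:
  assumes "upper_semicontinuous u" and "continuous_on UNIV f"
  shows "upper_semicontinuous (\<lambda>x. u (f x))"
  unfolding upper_semicontinuous_def
proof
  fix c
  have "open (f -` {z. u z < c})"
    using assms by (intro open_vimage) (auto simp: upper_semicontinuous_def)
  then show "open {x. u (f x) < c}" by (simp add: vimage_def)
qed

lemma usc_continuous: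
  fixes f :: "'a::topological_space \<Rightarrow> real"
  assumes "continuous_on UNIV f"
  shows "upper_semicontinuous (\<lambda>x. ereal (f x))"
  unfolding upper_semicontinuous_def
  by (auto intro!: open_Collect_less continuous_intros assms)

text \<open>The sum is below \<open>c\<close> exactly where the summands are below some \<open>a\<close> and \<open>b\<close> with \<open>a + b \<le> c\<close>.
  Finding these bounds needs care only where a summand is \<open>-\<infinity>\<close>.\<close>
lemma usc_add:
  fixes u v :: "'a::topological_space \<Rightarrow> ereal"
  assumes u: "upper_semicontinuous u" and v: "upper_semicontinuous v"
    and fin: "\<And>x. u x < \<infinity>" "\<And>x. v x < \<infinity>"
  shows "upper_semicontinuous (\<lambda>x. u x + v x)"
  unfolding upper_semicontinuous_def
proof
  fix c :: ereal
  have "\<exists>a b. u x < a \<and> v x < b \<and> a + b \<le> c" if lt: "u x + v x < c" for x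
  proof (cases "u x = -\<infinity> \<or> v x = -\<infinity>")
    case True
    then obtain m :: real where m: "ereal m < c"
      using lt ereal_dense2[of "-\<infinity>" c] by (cases c) auto
    from True show ?thesis
    proof
      assume "u x = -\<infinity>"
      obtain b :: real where "v x < ereal b" using ereal_dense2[OF fin(2)[of x]] by auto
      then show ?thesis using \<open>u x = -\<infinity>\<close> m
        by (intro exI[of _ "ereal (m - b)"] exI[of _ "ereal b"]) auto
    next
      assume "v x = -\<infinity>"
      obtain b :: real where "u x < ereal b" using ereal_dense2[OF fin(1)[of x]] by auto
      then show ?thesis using \<open>v x = -\<infinity>\<close> m
        by (intro exI[of _ "ereal b"] exI[of _ "ereal (m - b)"]) auto
    qed
  next
    case False
    then obtain p q where pq: "u x = ereal p" "v x = ereal q"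
      using fin[of x] by (cases "u x"; cases "v x") auto
    then obtain d where d: "ereal (p + q) < ereal d" "ereal d < c"
      using lt ereal_dense3[of "ereal (p+q)" c] by (auto intro: ereal_dense2)
    then show ?thesis using pq
      by (intro exI[of _ "ereal (p + (d - (p+q)) / 2)"] exI[of _ "ereal (q + (d - (p+q)) / 2)"])
         (auto simp: field_simps)
  qed
  moreover have "u x + v x < c" if "u x < a" "v x < b" "a + b \<le> c" for x a b
    using ereal_add_strict_mono2[OF that(1,2)] that(3) by simp
  ultimately have "{x. u x + v x < c} = (\<Union>(a,b)\<in>{(a,b). a + b \<le> c}. {x. u x < a} \<inter> {x. v x < b})"
    by fast
  also have "open \<dots>"
    using u v by (intro open_UN ballI) (auto simp: upper_semicontinuous_def)
  finally show "open {x. u x + v x < c}" .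
qed

lemma usc_attains_sup:
  assumes u: "upper_semicontinuous u" and K: "compact K" "K \<noteq> {}"
  obtains x where "x \<in> K" "\<And>y. y \<in> K \<Longrightarrow> u y \<le> u x"
proof (rule ccontr)
  assume "\<not> thesis"
  then have "\<forall>x\<in>K. \<exists>y\<in>K. u x < u y" using that by (meson not_le)
  then have "K \<subseteq> (\<Union>y\<in>K. {x. u x < u y})" by blast
  moreover have "open {x. u x < u y}" for y using u by (simp add: upper_semicontinuous_def)
  ultimately obtain F where F: "F \<subseteq> K" "finite F" "K \<subseteq> (\<Union>y\<in>F. {x. u x < u y})"
    using compactE_image[OF K(1)] by metis
  then have "F \<noteq> {}" using K(2) by auto
  then have "Max (u ` F) \<in> u ` F" using F(2) by simp
  then obtain y where y: "y \<in> F" "u y = Max (u ` F)" by auto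
  then obtain y' where "y' \<in> F" "u y < u y'" using F by blast
  then show False using y F(2) by (metis Max_ge finite_imageI imageI not_le)
qed

section \<open>Subharmonic functions\<close>

lemma subharmonic_real:
  fixes g :: "complex \<Rightarrow> real"
  assumes "continuous_on UNIV g"
  shows "subharmonic (\<lambda>z. ereal (g z)) \<longleftrightarrow>
    (\<forall>z. \<forall>r>0. 2 * pi * g z \<le> integral {0..2*pi} (\<lambda>t. g (z + of_real r * cis t)))"
  using circle_mean_real[OF continuous_on_subset[OF assms subset_UNIV]] usc_continuous[OF assms]
  by (simp add: subharmonic_def field_simps cong: all_cong imp_cong)

lemma subharmonic_affine:
  assumes "subharmonic U"
  shows "subharmonic (\<lambda>\<zeta>. U (a + \<zeta> * b))"
proof (cases "b = 0")
  case True
  have "upper_semicontinuous (\<lambda>\<zeta>::complex. U a)"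
    by (auto simp: upper_semicontinuous_def)
  with True assms show ?thesis
    by (simp add: subharmonic_def circle_mean_const)
next
  case False
  have us: "upper_semicontinuous U" using assms by (simp add: subharmonic_def)
  have "upper_semicontinuous (\<lambda>\<zeta>. U (a + \<zeta> * b))"
    by (intro usc_compose[OF us] continuous_intros)
  moreover have "circle_mean (\<lambda>\<zeta>. U (a + \<zeta> * b)) z r = circle_mean U (a + z * b) (cmod b * r)" for z r
  proof -
    have "circle_mean (\<lambda>\<zeta>. U (a + \<zeta> * b)) z r = circle_mean (\<lambda>w. U ((a + z * b) + b * w ^ 1)) 0 r"
      by (simp add: circle_mean_def algebra_simps)
    also have "\<dots> = circle_mean U (a + z * b) (cmod b * r ^ 1)"
      by (rule circle_mean_power) (use us upper_semicontinuous_borel in auto)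
    finally show ?thesis by simp
  qed
  ultimately show ?thesis
    using assms False by (simp add: subharmonic_def)
qed

lemma subharmonic_max0:
  assumes "subharmonic U"
  shows "subharmonic (\<lambda>z. max 0 (U z))"
  unfolding subharmonic_def
proof (intro conjI allI impI)
  show "upper_semicontinuous (\<lambda>z. max 0 (U z))"
    using assms by (auto simp: upper_semicontinuous_def subharmonic_def open_Collect_conj)
  show "max 0 (U z) < \<infinity>" for z
    using assms by (simp add: subharmonic_def max_def)
  fix z and r :: real assume "r > 0"
  have "U z \<le> circle_mean U z r" using assms \<open>r > 0\<close> by (simp add: subharmonic_def)
  also have "\<dots> \<le> circle_mean (\<lambda>z. max 0 (U z)) z r" by (rule circle_mean_mono) (use \<open>r > 0\<close> in auto)
  finally have "U z \<le> circle_mean (\<lambda>z. max 0 (U z)) z r" .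
  moreover have "0 = circle_mean (\<lambda>z. 0) z r" by (simp add: circle_mean_const)
  then have "0 \<le> circle_mean (\<lambda>z. max 0 (U z)) z r"
    using circle_mean_mono[of z r "\<lambda>z. 0" "\<lambda>z. max 0 (U z)"] \<open>r > 0\<close> by auto
  ultimately show "max 0 (U z) \<le> circle_mean (\<lambda>z. max 0 (U z)) z r" by simp
qed

lemma e2ennreal_plus:
  assumes "0 \<le> a" "0 \<le> b"
  shows "e2ennreal (a + b) = e2ennreal a + e2ennreal b"
  using assms by (cases a; cases b) auto

lemma subharmonic_add_nonneg:
  assumes U: "subharmonic U" "\<And>z. 0 \<le> U z" and W: "subharmonic W" "\<And>z. 0 \<le> W z"
  shows "subharmonic (\<lambda>z. U z + W z)"
  unfolding subharmonic_def
proof (intro conjI allI impI)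
  show "upper_semicontinuous (\<lambda>z. U z + W z)"
    by (rule usc_add) (use U W in \<open>auto simp: subharmonic_def\<close>)
  show "U z + W z < \<infinity>" for z
    using U(1) W(1) by (simp add: subharmonic_def)
  fix z and r :: real assume "r > 0"
  have [measurable]: "U \<in> borel_measurable borel" "W \<in> borel_measurable borel"
    using U W by (auto simp: subharmonic_def intro: upper_semicontinuous_borel)
  have [measurable]: "(\<lambda>t. z + of_real r * cis t) \<in> borel_measurable borel"
    by (intro borel_measurable_continuous_onI continuous_intros)
  have "circle_mean (\<lambda>z. U z + W z) z r = circle_mean U z r + circle_mean W z r"
    using U(2) W(2)
    by (simp add: circle_mean_nonneg e2ennreal_plus distrib_right nn_integral_add plus_ennreal.rep_eq
          divide_ereal_def ereal_left_distrib)
  then show "U z + W z \<le> circle_mean (\<lambda>z. U z + W z) z r"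
    using U(1) W(1) \<open>r > 0\<close> by (auto simp: subharmonic_def intro: add_mono)
qed

lemma subharmonic_cmult_nonneg:
  assumes U: "subharmonic U" "\<And>z. 0 \<le> U z" and "0 \<le> s"
  shows "subharmonic (\<lambda>z. ereal s * U z)"
proof (cases "s = 0")
  case True
  have "upper_semicontinuous (\<lambda>\<zeta>::complex. 0::ereal)"
    by (auto simp: upper_semicontinuous_def)
  then show ?thesis using True by (simp add: subharmonic_def circle_mean_const flip: zero_ereal_def)
next
  case False
  with \<open>0 \<le> s\<close> have "0 < s" by simp
  show ?thesis
    unfolding subharmonic_def
  proof (intro conjI allI impI)
    have "{z. ereal s * U z < c} = {z. U z < c / ereal s}" for c
      using \<open>0 < s\<close> by (auto simp: ereal_less_divide_pos)
    then show "upper_semicontinuous (\<lambda>z. ereal s * U z)"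
      using U by (simp add: upper_semicontinuous_def subharmonic_def)
    show "ereal s * U z < \<infinity>" for z
    proof -
      have "U z < \<infinity>" using U(1) by (simp add: subharmonic_def)
      then show ?thesis using \<open>0 < s\<close> by (cases "U z") auto
    qed
    fix z and r :: real assume "r > 0"
    have [measurable]: "U \<in> borel_measurable borel"
      using U by (auto simp: subharmonic_def intro: upper_semicontinuous_borel)
    have [measurable]: "(\<lambda>t. z + of_real r * cis t) \<in> borel_measurable borel"
      by (intro borel_measurable_continuous_onI continuous_intros)
    have "e2ennreal (ereal s * U w) = ennreal s * e2ennreal (U w)" for w
      using U(2)[of w] \<open>0 < s\<close>
      by (cases "U w") (auto simp: ennreal_mult ennreal_mult_top)
    then have "circle_mean (\<lambda>z. ereal s * U z) z r = ereal s * circle_mean U z r"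
      using U(2) \<open>0 < s\<close>
      by (simp add: circle_mean_nonneg mult.assoc nn_integral_cmult times_ennreal.rep_eq enn2ereal_ennreal
         divide_ereal_def)
    then show "ereal s * U z \<le> circle_mean (\<lambda>z. ereal s * U z) z r"
      using U(1) \<open>r > 0\<close> \<open>0 < s\<close> by (auto simp: subharmonic_def intro: ereal_mult_left_mono)
  qed
qed

lemma subharmonic_sum_nonneg:
  assumes "finite I" and "\<And>i. i \<in> I \<Longrightarrow> subharmonic (U i)" and "\<And>i z. i \<in> I \<Longrightarrow> 0 \<le> U i z"
  shows "subharmonic (\<lambda>z. \<Sum>i\<in>I. U i z)"
  using assms
proof (induction I rule: finite_induct)
  case empty
  have "upper_semicontinuous (\<lambda>\<zeta>::complex. 0::ereal)"
    by (auto simp: upper_semicontinuous_def)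
  then show ?case by (simp add: subharmonic_def circle_mean_const)
next
  case (insert i I)
  then show ?case by (auto intro!: subharmonic_add_nonneg sum_nonneg)
qed

text \<open>The mean of the harmonic function \<open>Re H\<close> is its value 0 at the centre, so that function can be
  ignored when a subharmonic function is compared with it on a circle. All maximum principles below
  are contradictions to this statement at a maximum of a strictly subharmonic perturbation. The power
  \<open>\<zeta> ^ k\<close> allows for branched parametrisations.\<close>
lemma subharmonic_no_strict_peak:
  assumes U: "subharmonic U" and fin: "U a \<noteq> -\<infinity>" and "0 < k" "b \<noteq> 0"
    and H: "H holomorphic_on ball 0 R" "H 0 = 0" and r: "0 < r" "r < R"
    and le: "\<And>\<zeta>. cmod \<zeta> = r \<Longrightarrow> U (a + b * \<zeta> ^ k) \<le> U a + ereal (Re (H \<zeta>) - c)"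
  shows "c \<le> 0"
proof -
  obtain x where x: "U a = ereal x" using U fin by (cases "U a") (auto simp: subharmonic_def)
  have H': "((\<lambda>t. Re (H (0 + of_real r * cis t))) has_integral 2 * pi * Re (H 0)) {0..2*pi}"
    by (rule integral_circle_holomorphic[OF H(1) r])
  have int: "integral {0..2*pi} (\<lambda>t. x + Re (H (0 + of_real r * cis t)) - c) = 2 * pi * (x - c)"
  proof -
    have "((\<lambda>t. x - c) has_integral (2 * pi) * (x - c)) {0..2*pi}"
      using has_integral_const_real[of "x - c" 0 "2*pi"] by simp
    from has_integral_add[OF this H'] H(2)
    have "((\<lambda>t. x + Re (H (0 + of_real r * cis t)) - c) has_integral 2 * pi * (x - c)) {0..2*pi}"
      by (simp add: algebra_simps)
    then show ?thesis by (rule integral_unique)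
  qed
  have "U a \<le> circle_mean U a (cmod b * r ^ k)"
    using U r \<open>b \<noteq> 0\<close> by (simp add: subharmonic_def)
  also have "\<dots> = circle_mean (\<lambda>w. U (a + b * w ^ k)) 0 r"
    by (rule circle_mean_power[symmetric])
       (use U \<open>0 < k\<close> in \<open>auto simp: subharmonic_def intro: upper_semicontinuous_borel\<close>)
  also have "\<dots> \<le> circle_mean (\<lambda>w. ereal (x + Re (H w) - c)) 0 r"
    by (rule circle_mean_mono) (use le x r in \<open>auto simp: algebra_simps\<close>)
  also have "\<dots> = ereal (integral {0..2*pi} (\<lambda>t. x + Re (H (0 + of_real r * cis t)) - c) / (2*pi))"
  proof (rule circle_mean_real)
    have "sphere 0 r \<subseteq> ball 0 R" using r by auto
    from holomorphic_on_imp_continuous_on[OF holomorphic_on_subset[OF H(1) this]]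
    show "continuous_on (sphere 0 r) (\<lambda>w. x + Re (H w) - c)" by (intro continuous_intros)
  qed (use r in auto)
  also have "\<dots> = ereal (x - c)" unfolding int by simp
  finally show ?thesis using x by simp
qed

section \<open>Logarithms of polynomials\<close>

text \<open>If the circle does not meet the zero of the logarithm, its mean is \<open>ln (max |a| r)\<close>. When the zero
  is inside, the rotation \<open>|a + r e\<^sup>i\<^sup>t| = |r + cnj a e\<^sup>i\<^sup>t|\<close> exchanges the roles of \<open>a\<close> and \<open>r\<close>.\<close>
lemma integral_ln_circle_ge:
  assumes "a \<noteq> 0" "0 < r" "cmod a \<noteq> r"
  obtains I where "((\<lambda>t. ln (cmod (a + of_real r * cis t))) has_integral I) {0..2*pi}"
    "2 * pi * ln (cmod a) \<le> I"
proof (cases "r < cmod a")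
  case True
  define H where "H w = Ln (1 + w / a)" for w
  have ne: "1 + w / a \<noteq> 0 \<and> 1 + w / a \<notin> \<real>\<^sub>\<le>\<^sub>0" if "cmod w < cmod a" for w
  proof -
    have "cmod (w / a) < 1" using that \<open>a \<noteq> 0\<close> by (simp add: norm_divide)
    then have "Re (1 + w / a) > 0" using complex_Re_le_cmod[of "-(w/a)"] by simp
    then show ?thesis by (metis complex_nonpos_Reals_iff not_le zero_complex.sel(1) less_irrefl)
  qed
  have "H holomorphic_on ball 0 (cmod a)"
    unfolding H_def by (intro holomorphic_intros) (use ne \<open>a \<noteq> 0\<close> in auto)
  from integral_circle_holomorphic[OF this \<open>0 < r\<close> True]
  have *: "((\<lambda>t. Re (H (0 + of_real r * cis t))) has_integral 0) {0..2*pi}"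
    by (simp add: H_def)
  have eq: "ln (cmod a) + Re (H (0 + of_real r * cis t)) = ln (cmod (a + of_real r * cis t))" for t
  proof -
    let ?w = "of_real r * cis t"
    have "cmod ?w < cmod a" using True \<open>0 < r\<close> by (simp add: norm_mult)
    note n = ne[OF this]
    have "a + ?w = a * (1 + ?w / a)" using \<open>a \<noteq> 0\<close> by (simp add: field_simps)
    then have "cmod (a + ?w) = cmod a * cmod (1 + ?w / a)" by (metis norm_mult)
    then show ?thesis using n \<open>a \<noteq> 0\<close> by (simp add: H_def ln_mult)
  qed
  have "((\<lambda>t. ln (cmod a)) has_integral (2 * pi) * ln (cmod a)) {0..2*pi}"
    using has_integral_const_real[of "ln (cmod a)" 0 "2*pi"] by simp
  from has_integral_add[OF this *]
  have "((\<lambda>t. ln (cmod (a + of_real r * cis t))) has_integral 2 * pi * ln (cmod a)) {0..2*pi}"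
    unfolding eq by simp
  then show ?thesis using that by auto
next
  case False
  with assms have lt: "cmod a < r" by simp
  define H where "H w = Ln (1 + w * (cnj a / of_real r))" for w
  have ne: "1 + w * (cnj a / of_real r) \<noteq> 0 \<and> 1 + w * (cnj a / of_real r) \<notin> \<real>\<^sub>\<le>\<^sub>0" if "cmod w < r / cmod a" for w
  proof -
    have "cmod (w * (cnj a / of_real r)) < 1" using that assms by (simp add: norm_mult norm_divide field_simps)
    then have "Re (1 + w * (cnj a / of_real r)) > 0" using complex_Re_le_cmod[of "-(w * (cnj a / of_real r))"] by simp
    then show ?thesis by (metis complex_nonpos_Reals_iff not_le zero_complex.sel(1) less_irrefl)
  qed
  have "H holomorphic_on ball 0 (r / cmod a)"
    unfolding H_def by (intro holomorphic_intros) (use ne in auto)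
  from integral_circle_holomorphic[OF this, of 1] lt assms
  have *: "((\<lambda>t. Re (H (0 + of_real 1 * cis t))) has_integral 0) {0..2*pi}"
    by (simp add: H_def)
  have eq: "ln r + Re (H (0 + of_real 1 * cis t)) = ln (cmod (a + of_real r * cis t))" for t
  proof -
    have "cmod (cis t) < r / cmod a" using lt assms by (simp add: field_simps)
    note n = ne[OF this]
    have "cmod (a + of_real r * cis t) = cmod (cnj (a + of_real r * cis t) * cis t)"
      by (simp only: norm_mult complex_mod_cnj norm_cis mult_1_right)
    also have "cnj (a + of_real r * cis t) * cis t = of_real r * (1 + cis t * (cnj a / of_real r))"
      using \<open>0 < r\<close> by (simp add: field_simps cis_cnj cis_mult)
    finally have "cmod (a + of_real r * cis t) = r * cmod (1 + cis t * (cnj a / of_real r))"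
      using \<open>0 < r\<close> by (simp add: norm_mult)
    then show ?thesis using n \<open>0 < r\<close> by (simp add: H_def ln_mult)
  qed
  have "((\<lambda>t. ln r) has_integral (2 * pi) * ln r) {0..2*pi}"
    using has_integral_const_real[of "ln r" 0 "2*pi"] by simp
  from has_integral_add[OF this *]
  have "((\<lambda>t. ln (cmod (a + of_real r * cis t))) has_integral 2 * pi * ln r) {0..2*pi}"
    unfolding eq by simp
  moreover have "ln (cmod a) \<le> ln r" using lt assms by simp
  ultimately show ?thesis using that by simp
qed

definition root_prod :: "complex set \<Rightarrow> complex \<Rightarrow> complex" where
  "root_prod X z = (\<Prod>x\<in>X. z - x)"

lemma continuous_on_root_prod [continuous_intros]:
  "continuous_on A f \<Longrightarrow> continuous_on A (\<lambda>x. root_prod X (f x))"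
  unfolding root_prod_def by (intro continuous_intros)

lemma holomorphic_on_root_prod [holomorphic_intros]: "root_prod X holomorphic_on A"
  unfolding root_prod_def by (intro holomorphic_intros)

lemma ln_root_prod:
  assumes "finite X" "z \<notin> X"
  shows "root_prod X z \<noteq> 0" "ln (cmod (root_prod X z)) = (\<Sum>x\<in>X. ln (cmod (z - x)))"
proof -
  show "root_prod X z \<noteq> 0" using assms by (auto simp: root_prod_def)
  show "ln (cmod (root_prod X z)) = (\<Sum>x\<in>X. ln (cmod (z - x)))"
    unfolding root_prod_def prod_norm[symmetric]
    by (rule ln_prod) (use assms in auto)
qed

text \<open>The positive part of the logarithm, in a form that is visibly continuous at 0.\<close>
definition log_plus :: "real \<Rightarrow> real" where
  "log_plus x = ln (max 1 x)"

lemma continuous_on_log_plus [continuous_intros]: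
  "continuous_on A f \<Longrightarrow> continuous_on A (\<lambda>x. log_plus (f x))"
  unfolding log_plus_def by (intro continuous_intros) auto

lemma log_plus_nonneg [simp]: "0 \<le> log_plus x"
  by (simp add: log_plus_def)

lemma log_plus_ge_ln: "0 < x \<Longrightarrow> ln x \<le> log_plus x"
  by (simp add: log_plus_def)

lemma log_plus_eq_max: "0 \<le> x \<Longrightarrow> log_plus x = max 0 (ln x)"
  by (cases "x = 0") (auto simp: log_plus_def max_def)

text \<open>Away from the finitely many radii for which the circle meets a zero, the mean of
  \<open>ln |root_prod|\<close> is computed factor by factor; those radii are reached by continuity.\<close>
lemma subharmonic_log_plus:
  assumes "0 < \<kappa>" "finite X"
  shows "subharmonic (\<lambda>z. ereal (log_plus (\<kappa> * cmod (root_prod X z))))"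
proof -
  define g where "g z = log_plus (\<kappa> * cmod (root_prod X z))" for z
  have cont: "continuous_on A g" for A unfolding g_def by (intro continuous_intros)
  have submean: "2 * pi * g z \<le> integral {0..2*pi} (\<lambda>t. g (z + of_real r * cis t))" if "r > 0" for z r
  proof (cases "\<kappa> * cmod (root_prod X z) \<le> 1")
    case True
    then have "g z = 0" by (simp add: g_def log_plus_def)
    then show ?thesis by (simp add: integral_nonneg g_def integrable_continuous_real continuous_intros)
  next
    case False
    then have nz: "root_prod X z \<noteq> 0" by auto
    then have nzj: "z - x \<noteq> 0" if "x \<in> X" for x using that assms(2) by (auto simp: root_prod_def)
    define J where "J s = integral {0..2*pi} (\<lambda>t. g (z + of_real s * cis t))" for s
    have good: "2 * pi * g z \<le> J s" if s: "s > 0" "s \<notin> (\<lambda>x. cmod (z - x)) ` X" for s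
    proof -
      have "\<forall>x\<in>X. \<exists>I. ((\<lambda>t. ln (cmod (z - x + of_real s * cis t))) has_integral I) {0..2*pi} \<and> 2 * pi * ln (cmod (z - x)) \<le> I"
        using s nzj integral_ln_circle_ge by (metis imageI)
      then obtain I where I: "\<And>x. x \<in> X \<Longrightarrow> ((\<lambda>t. ln (cmod (z - x + of_real s * cis t))) has_integral I x) {0..2*pi}"
         "\<And>x. x \<in> X \<Longrightarrow> 2 * pi * ln (cmod (z - x)) \<le> I x"
        by metis
      have "((\<lambda>t. ln \<kappa>) has_integral (2 * pi) * ln \<kappa>) {0..2*pi}"
        using has_integral_const_real[of "ln \<kappa>" 0 "2*pi"] by simp
      then have "((\<lambda>t. ln \<kappa> + (\<Sum>x\<in>X. ln (cmod (z - x + of_real s * cis t)))) has_integral (2 * pi * ln \<kappa> + (\<Sum>x\<in>X. I x))) {0..2*pi}"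
        using I(1) assms(2) by (intro has_integral_add has_integral_sum) auto
      moreover have "((\<lambda>t. g (z + of_real s * cis t)) has_integral J s) {0..2*pi}"
        unfolding J_def
        by (intro integrable_integral integrable_continuous_real continuous_on_compose2[OF cont[of UNIV]] continuous_intros) auto
      moreover have "ln \<kappa> + (\<Sum>x\<in>X. ln (cmod (z - x + of_real s * cis t))) \<le> g (z + of_real s * cis t)" for t
      proof -
        have "z + of_real s * cis t - x \<noteq> 0" if "x \<in> X" for x
        proof
          assume "z + of_real s * cis t - x = 0"
          then have "z - x = - (of_real s * cis t)" by (simp add: algebra_simps)
          then have "cmod (z - x) = s" using s by (simp add: norm_mult)
          then show False using s that by auto
        qed
        then have "z + of_real s * cis t \<notin> X" by auto
        note r = ln_root_prod[OF assms(2) this]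
        have "ln \<kappa> + (\<Sum>x\<in>X. ln (cmod (z - x + of_real s * cis t))) = ln (\<kappa> * cmod (root_prod X (z + of_real s * cis t)))"
          and "0 < \<kappa> * cmod (root_prod X (z + of_real s * cis t))"
          using assms r by (auto simp: ln_mult algebra_simps)
        then show ?thesis unfolding g_def using log_plus_ge_ln by metis
      qed
      ultimately have "2 * pi * ln \<kappa> + (\<Sum>x\<in>X. I x) \<le> J s" by (rule has_integral_le)
      moreover have "2 * pi * (ln \<kappa> + (\<Sum>x\<in>X. ln (cmod (z - x)))) \<le> 2 * pi * ln \<kappa> + (\<Sum>x\<in>X. I x)"
        using sum_mono[of X, OF I(2)] by (simp add: distrib_left sum_distrib_left)
      moreover have "g z = ln \<kappa> + (\<Sum>x\<in>X. ln (cmod (z - x)))"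
        using assms nzj False nz ln_root_prod(2)[OF assms(2), of z] by (auto simp: g_def log_plus_def ln_mult)
      ultimately show ?thesis by simp
    qed
    have contJ: "continuous_on UNIV J"
    proof -
      have "continuous_on (UNIV \<times> {0..2*pi}) (\<lambda>(s, t). g (z + of_real s * cis t))"
        unfolding split_beta
        by (rule continuous_on_compose2[OF cont[of UNIV]]) (auto intro!: continuous_intros)
      then have "continuous_on UNIV (\<lambda>s. integral (cbox 0 (2*pi)) (\<lambda>t. g (z + of_real s * cis t)))"
        by (intro integral_continuous_on_param) (simp only: cbox_interval)
      then show ?thesis
        by (simp add: J_def[abs_def] cbox_interval)
    qed
    show ?thesis
    proof (rule ccontr)
      assume "\<not> ?thesis"
      then have r: "J r < 2 * pi * g z" by (simp add: J_def)
      have "open ({s. J s < 2 * pi * g z} \<inter> {0<..})"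
        by (intro open_Int open_Collect_less contJ continuous_intros)
      moreover have "{s. J s < 2 * pi * g z} \<inter> {0<..} \<subseteq> (\<lambda>x. cmod (z - x)) ` X"
        using good by force
      then have "finite ({s. J s < 2 * pi * g z} \<inter> {0<..})" by (rule finite_subset) (use assms(2) in simp)
      ultimately have "{s. J s < 2 * pi * g z} \<inter> {0<..} = {}" using finite_imp_not_open by blast
      then show False using r \<open>r > 0\<close> by auto
    qed
  qed
  have "subharmonic (\<lambda>z. ereal (g z))"
    using subharmonic_real[OF cont] submean by blast
  then show ?thesis by (simp add: g_def)
qed

section \<open>A criterion for polarity\<close>

text \<open>The positive parts converge by dominated convergence, since the first function is bounded above
  on the circle; the negative parts increase, so monotone convergence applies even if their integrals
  become infinite.\<close>
lemma subharmonic_decreasing_limit: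
  assumes sub: "\<And>k. subharmonic (U k)" and dec: "\<And>k z. U (Suc k) z \<le> U k z"
  shows "subharmonic (\<lambda>z. INF k. U k z)"
  unfolding subharmonic_def
proof (intro conjI allI impI)
  have [measurable]: "U k \<in> borel_measurable borel" for k
    using sub by (auto simp: subharmonic_def intro: upper_semicontinuous_borel)
  have dec': "decseq (\<lambda>k. U k z)" for z using dec by (intro decseq_SucI)
  have "{z. (INF k. U k z) < c} = (\<Union>k. {z. U k z < c})" for c
    by (auto simp: INF_less_iff)
  then show usc: "upper_semicontinuous (\<lambda>z. INF k. U k z)"
    using sub by (auto simp: upper_semicontinuous_def subharmonic_def)
  have [measurable]: "(\<lambda>z. INF k. U k z) \<in> borel_measurable borel"
    by (rule upper_semicontinuous_borel[OF usc])
  have "(INF k. U k z) \<le> U 0 z" for z by (rule INF_lower) simp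
  then show "(INF k. U k z) < \<infinity>" for z
    using sub[of 0] le_less_trans unfolding subharmonic_def by blast
  fix z and r :: real assume "r > 0"
  define c where "c t = z + of_real r * cis t" for t
  have [measurable]: "c \<in> borel_measurable borel"
    unfolding c_def by (intro borel_measurable_continuous_onI continuous_intros)
  have "sphere z r \<noteq> {}" using \<open>r > 0\<close> by simp
  then obtain x where x: "\<And>y. y \<in> sphere z r \<Longrightarrow> U 0 y \<le> U 0 x"
    using usc_attains_sup[of "U 0" "sphere z r"] sub[of 0] by (auto simp: subharmonic_def)
  have "U 0 x < \<infinity>" using sub[of 0] by (simp add: subharmonic_def)
  then obtain m where m: "U 0 x < ereal m" using ereal_dense2 by blast
  have bd: "U k (c t) \<le> ereal m" for k t
  proof -
    have "c t \<in> sphere z r" using \<open>r > 0\<close> by (simp add: c_def dist_norm norm_mult)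
    have "U k (c t) \<le> U 0 (c t)" using dec' by (auto simp: decseq_def)
    also have "\<dots> \<le> U 0 x" using x \<open>c t \<in> sphere z r\<close> .
    finally show ?thesis using m by simp
  qed
  have lim: "(\<lambda>k. U k w) \<longlonglongrightarrow> (INF k. U k w)" for w
    using dec' by (rule LIMSEQ_INF)
  define I :: "real \<Rightarrow> ennreal" where "I = indicator {0..2*pi}"
  have mI[measurable]: "I \<in> borel_measurable borel" by (simp add: I_def)
  have ind: "I t = 0 \<or> I t = (1::ennreal)" for t by (auto simp: I_def split: split_indicator)
  have L1: "(\<lambda>k. \<integral>\<^sup>+t. e2ennreal (U k (c t)) * I t \<partial>lborel)
     \<longlonglongrightarrow> (\<integral>\<^sup>+t. e2ennreal (INF k. U k (c t)) * I t \<partial>lborel)"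
  proof (rule nn_integral_dominated_convergence[where w = "\<lambda>t. ennreal m * I t"])
    show "AE t in lborel. e2ennreal (U k (c t)) * I t \<le> ennreal m * I t" for k
      using e2ennreal_mono[OF bd] by (intro AE_I2 mult_right_mono) auto
    show "(\<integral>\<^sup>+t. ennreal m * I t \<partial>lborel) < \<infinity>"
      by (simp add: I_def nn_integral_cmult ennreal_mult_less_top)
    show "AE t in lborel. (\<lambda>k. e2ennreal (U k (c t)) * I t) \<longlonglongrightarrow> e2ennreal (INF k. U k (c t)) * I t"
    proof (rule AE_I2)
      fix t show "(\<lambda>k. e2ennreal (U k (c t)) * I t) \<longlonglongrightarrow> e2ennreal (INF k. U k (c t)) * I t"
        using ind[of t] tendsto_e2ennrealI[OF lim[of "c t"]] by auto
    qed
  qed measurable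
  have L2: "(\<lambda>k. \<integral>\<^sup>+t. e2ennreal (- U k (c t)) * I t \<partial>lborel)
     \<longlonglongrightarrow> (\<integral>\<^sup>+t. e2ennreal (- (INF k. U k (c t))) * I t \<partial>lborel)"
  proof (rule nn_integral_LIMSEQ)
    show "incseq (\<lambda>k t. e2ennreal (- U k (c t)) * I t)"
      using dec by (intro incseq_SucI le_funI mult_right_mono e2ennreal_mono) auto
    fix t show "(\<lambda>k. e2ennreal (- U k (c t)) * I t) \<longlonglongrightarrow> e2ennreal (- (INF k. U k (c t))) * I t"
      using ind[of t] tendsto_e2ennrealI[OF tendsto_uminus_ereal[OF lim[of "c t"]]] by auto
  qed measurable
  have "(\<integral>\<^sup>+t. e2ennreal (INF k. U k (c t)) * I t \<partial>lborel) \<le> (\<integral>\<^sup>+t. ennreal m * I t \<partial>lborel)"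
    using e2ennreal_mono[OF INF_lower2[where f = "\<lambda>k. U k (c t)" for t, OF UNIV_I bd[of 0]]] by (intro nn_integral_mono mult_right_mono) auto
  also have "\<dots> < top" by (simp add: I_def nn_integral_cmult ennreal_mult_less_top)
  finally have fin: "enn2ereal (\<integral>\<^sup>+t. e2ennreal (INF k. U k (c t)) * I t \<partial>lborel) \<noteq> \<infinity>"
    by (auto simp: less_ennreal.rep_eq top_ennreal.rep_eq top_ereal_def)
  have nn: "enn2ereal x \<noteq> -\<infinity>" for x using enn2ereal_nonneg[of x] by auto
  have "(\<lambda>k. circle_mean (U k) z r) \<longlonglongrightarrow> circle_mean (\<lambda>z. INF k. U k z) z r"
    unfolding circle_mean_def c_def[symmetric] I_def[symmetric] divide_ereal_def
    unfolding mult.commute[of _ "inverse (ereal (2 * pi))"]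
    by (intro tendsto_cmult_ereal tendsto_diff_ereal_general tendsto_enn2erealI L1 L2) (use fin nn in auto)
  moreover have "(INF k. U k z) \<le> circle_mean (U k) z r" for k
    using sub[of k] \<open>r > 0\<close> INF_lower[of k UNIV "\<lambda>k. U k z"] order.trans
    unfolding subharmonic_def by blast
  ultimately show "(INF k. U k z) \<le> circle_mean (\<lambda>z. INF k. U k z) z r"
    by (meson LIMSEQ_le_const)
qed

definition cont_subharmonic :: "(complex \<Rightarrow> real) \<Rightarrow> bool" where
  "cont_subharmonic g \<longleftrightarrow> continuous_on UNIV g \<and> subharmonic (\<lambda>z. ereal (g z))"

lemma cont_subharmonic_iff:
  "cont_subharmonic g \<longleftrightarrow> continuous_on UNIV g \<and>
    (\<forall>z. \<forall>r>0. 2 * pi * g z \<le> integral {0..2*pi} (\<lambda>t. g (z + of_real r * cis t)))"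
  using subharmonic_real cont_subharmonic_def by blast

lemma circle_integrable:
  fixes g :: "complex \<Rightarrow> real"
  assumes "continuous_on UNIV g"
  shows "(\<lambda>t. g (z + of_real r * cis t)) integrable_on {0..2*pi}"
  by (intro integrable_continuous_real continuous_on_compose2[OF assms] continuous_intros) auto

lemma cont_subharmonic_const: "cont_subharmonic (\<lambda>_. c)"
  by (simp add: cont_subharmonic_iff)

lemma cont_subharmonic_add:
  assumes "cont_subharmonic f" "cont_subharmonic g"
  shows "cont_subharmonic (\<lambda>z. f z + g z)"
  using assms
  by (auto simp: cont_subharmonic_iff distrib_left integral_add[OF circle_integrable circle_integrable]
       intro!: continuous_intros add_mono)

lemma cont_subharmonic_cmult:
  assumes "cont_subharmonic f" "0 \<le> c"
  shows "cont_subharmonic (\<lambda>z. c * f z)"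
  using assms
  by (auto simp: cont_subharmonic_iff mult.left_commute[of _ c] intro!: continuous_intros mult_left_mono)

lemma cont_subharmonic_sum:
  "(\<And>j. j \<in> J \<Longrightarrow> cont_subharmonic (f j)) \<Longrightarrow> cont_subharmonic (\<lambda>z. \<Sum>j\<in>J. f j z)"
  by (induction J rule: infinite_finite_induct)
     (auto intro: cont_subharmonic_add cont_subharmonic_const)

lemma cont_subharmonic_log_plus:
  assumes "0 < \<kappa>" "finite X"
  shows "cont_subharmonic (\<lambda>z. log_plus (\<kappa> * cmod (root_prod X z)))"
  unfolding cont_subharmonic_def
  by (intro conjI subharmonic_log_plus continuous_intros assms)

lemma log_plus_mono: "x \<le> y \<Longrightarrow> log_plus x \<le> log_plus y"
  by (simp add: log_plus_def)

lemma log_plus_exp_mult: "0 \<le> a \<Longrightarrow> log_plus (exp a * y) \<le> a + log_plus y"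
proof -
  assume "0 \<le> a"
  then have *: "max 1 (exp a * y) \<le> exp a * max 1 y"
    using mult_mono[of 1 "exp a" 1 y] by (auto simp: max_def mult_left_mono)
  have "ln (max 1 (exp a * y)) \<le> ln (exp a * max 1 y)"
    using * by (subst ln_le_cancel_iff) auto
  also have "\<dots> = a + ln (max 1 y)" by (subst ln_mult) auto
  finally show ?thesis by (simp add: log_plus_def)
qed

text \<open>Each factor satisfies \<open>|z - x| \<le> (1 + R) max 1 |z|\<close>.\<close>
lemma log_plus_root_prod_le:
  assumes "\<And>x. x \<in> X \<Longrightarrow> cmod x \<le> R" "0 \<le> R"
  shows "log_plus (cmod (root_prod X z)) \<le> of_nat (card X) * (log_plus (cmod z) + ln (1 + R))"
proof -
  let ?b = "(1 + R) * max 1 (cmod z)"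
  have "cmod (z - x) \<le> ?b" if "x \<in> X" for x
  proof -
    have "cmod (z - x) \<le> cmod z + R" using assms(1)[OF that] norm_triangle_ineq4[of z x] by simp
    also have "\<dots> \<le> max 1 (cmod z) + R * max 1 (cmod z)"
      using assms(2) mult_left_mono[of 1 "max 1 (cmod z)" R] by simp
    finally show ?thesis by (simp add: algebra_simps)
  qed
  then have "cmod (root_prod X z) \<le> ?b ^ card X"
    unfolding root_prod_def prod_norm[symmetric]
    using prod_mono[of X "\<lambda>x. cmod (z - x)" "\<lambda>_. ?b"] by simp
  moreover have "1 \<le> ?b" using assms(2) mult_mono[of 1 "1+R" 1 "max 1 (cmod z)"] by simp
  ultimately have "log_plus (cmod (root_prod X z)) \<le> ln (?b ^ card X)"
    by (simp add: log_plus_def one_le_power)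
  also have "\<dots> = of_nat (card X) * ln ?b" by (rule ln_realpow)
  also have "ln ?b = ln (1 + R) + log_plus (cmod z)"
    using assms(2) by (simp add: log_plus_def ln_mult)
  finally show ?thesis by (simp add: algebra_simps)
qed

text \<open>Evans-type construction: with polynomials \<open>P j\<close> for which \<open>ln |P j| / N j \<le> - 2 ^ (j + 1)\<close> on \<open>K\<close>,
  the sum of the functions \<open>2 ^ - (j + 1) * ln |P j| / N j\<close> is \<open>-\<infinity>\<close> on \<open>K\<close>. All terms are nonnegative at
  the point \<open>R + 1\<close>, which has distance at least 1 from all roots. Truncating the first \<open>J\<close> terms at level
  \<open>- 2 ^ J\<close> and replacing the tail by a common majorant \<open>L\<close> exhibits the sum as a decreasing limit of
  continuous subharmonic functions.\<close>
lemma polar_if_small_polynomials: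
  assumes "compact K"
    and small: "\<And>C::real. \<exists>X. finite X \<and> X \<noteq> {} \<and> X \<subseteq> K \<and> (\<forall>z\<in>K. cmod (root_prod X z) \<le> exp (- C * of_nat (card X)))"
  shows "polar K"
proof -
  obtain R where R: "0 < R" "\<And>z. z \<in> K \<Longrightarrow> cmod z \<le> R"
    using compact_imp_bounded[OF assms(1)] bounded_pos by metis
  have "\<forall>j. \<exists>X. finite X \<and> X \<noteq> {} \<and> X \<subseteq> K \<and> (\<forall>z\<in>K. cmod (root_prod X z) \<le> exp (- (2 ^ Suc j) * of_nat (card X)))"
    using small by blast
  then obtain X where X: "\<And>j. finite (X j)" "\<And>j. X j \<noteq> {}" "\<And>j. X j \<subseteq> K"
      "\<And>j z. z \<in> K \<Longrightarrow> cmod (root_prod (X j) z) \<le> exp (- (2 ^ Suc j) * real (card (X j)))"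
    by metis
  define N where "N j = card (X j)" for j
  have Nw: "\<And>j. 0 < N j" "\<And>j x. x \<in> X j \<Longrightarrow> x \<in> K"
      "\<And>j z. z \<in> K \<Longrightarrow> cmod (root_prod (X j) z) \<le> exp (- (2 ^ Suc j) * real (N j))"
    using X by (auto simp: N_def card_gt_0_iff)
  \<comment> \<open>\<open>T j m\<close> is the maximum of \<open>ln |P j| / N j\<close> and \<open>- m\<close>.\<close>
  define T where "T j m z = log_plus (exp (m * real (N j)) * cmod (root_prod (X j) z)) / real (N j) - m"
    for j and m :: real and z
  define L where "L z = log_plus (cmod z) + ln (1 + R)" for z
  define U where "U J z = (\<Sum>j<J. (1/2) ^ Suc j * T j (2 ^ J) z) + (1/2) ^ J * L z" for J z
  have subT: "cont_subharmonic (T j m)" for j m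
  proof -
    have "cont_subharmonic (\<lambda>z. (1 / real (N j)) * log_plus (exp (m * real (N j)) * cmod (root_prod (X j) z)) + - m)"
      by (intro cont_subharmonic_add cont_subharmonic_cmult cont_subharmonic_const cont_subharmonic_log_plus X(1)) auto
    then show ?thesis by (simp add: T_def[abs_def])
  qed
  have subL: "cont_subharmonic L"
  proof -
    have "cont_subharmonic (\<lambda>z. log_plus (1 * cmod (root_prod {0} z)) + ln (1 + R))"
      by (intro cont_subharmonic_add cont_subharmonic_const cont_subharmonic_log_plus X(1)) auto
    then show ?thesis by (simp add: L_def[abs_def] root_prod_def)
  qed
  have subU: "subharmonic (\<lambda>z. ereal (U J z))" for J
  proof -
    have "cont_subharmonic (U J)"
      unfolding U_def[abs_def]
      by (intro cont_subharmonic_add cont_subharmonic_sum cont_subharmonic_cmult subT subL) auto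
    then show ?thesis by (simp add: cont_subharmonic_def)
  qed
  have T_anti: "T j m' z \<le> T j m z" if "m \<le> m'" for j m m' z
  proof -
    have "log_plus (exp ((m' - m) * real (N j)) * (exp (m * real (N j)) * cmod (root_prod (X j) z)))
      \<le> (m' - m) * real (N j) + log_plus (exp (m * real (N j)) * cmod (root_prod (X j) z))"
      using that by (intro log_plus_exp_mult) auto
    moreover have "exp ((m' - m) * real (N j)) * (exp (m * real (N j)) * cmod (root_prod (X j) z))
      = exp (m' * real (N j)) * cmod (root_prod (X j) z)"
      by (simp add: exp_add[symmetric] mult.assoc[symmetric] left_diff_distrib)
    ultimately have "log_plus (exp (m' * real (N j)) * cmod (root_prod (X j) z))
      \<le> (m' - m) * real (N j) + log_plus (exp (m * real (N j)) * cmod (root_prod (X j) z))"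
      by (simp only:)
    from divide_right_mono[OF this, of "real (N j)"] show ?thesis using Nw(1)[of j]
      by (simp add: T_def add_divide_distrib)
  qed
  have T_le: "T j m z \<le> L z" if "0 \<le> m" for j m z
  proof -
    have "log_plus (cmod (root_prod (X j) z)) \<le> real (N j) * L z"
      unfolding L_def unfolding N_def using R Nw(2) by (intro log_plus_root_prod_le) auto
    then have "T j 0 z \<le> L z" using Nw(1)[of j] by (simp add: T_def field_simps)
    then show ?thesis using T_anti[OF that] order.trans by blast
  qed
  have decU: "U (Suc J) z \<le> U J z" for J z
  proof -
    have "(\<Sum>j<J. (1/2) ^ Suc j * T j (2 ^ Suc J) z) \<le> (\<Sum>j<J. (1/2) ^ Suc j * T j (2 ^ J) z)"
      by (intro sum_mono mult_left_mono T_anti) auto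
    moreover have "(1/2) ^ Suc J * T J (2 ^ Suc J) z \<le> (1/2) ^ Suc J * L z"
      by (intro mult_left_mono T_le) auto
    moreover have "(1/2) ^ J * L z = (1/2) ^ Suc J * L z + (1/2) ^ Suc J * L z" by simp
    ultimately show ?thesis unfolding U_def sum.lessThan_Suc by linarith
  qed
  define W where "W z = (INF J. ereal (U J z))" for z
  have "subharmonic W"
    unfolding W_def[abs_def] by (rule subharmonic_decreasing_limit) (use subU decU in auto)
  moreover have "W z = -\<infinity>" if "z \<in> K" for z
  proof -
    have TK: "T j m z \<le> - (2 ^ Suc j)" if "2 ^ Suc j \<le> m" for j m
    proof -
      have "exp (m * real (N j)) * cmod (root_prod (X j) z) \<le> exp (m * real (N j)) * exp (- (2 ^ Suc j) * real (N j))"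
        using Nw(3)[OF \<open>z \<in> K\<close>] by (intro mult_left_mono) auto
      also have "\<dots> = exp ((m - 2 ^ Suc j) * real (N j)) * 1" by (simp add: exp_add[symmetric] algebra_simps)
      finally have "log_plus (exp (m * real (N j)) * cmod (root_prod (X j) z)) \<le> log_plus (exp ((m - 2 ^ Suc j) * real (N j)) * 1)"
        by (rule log_plus_mono)
      also have "\<dots> \<le> (m - 2 ^ Suc j) * real (N j) + log_plus 1" using that by (intro log_plus_exp_mult) auto
      finally show ?thesis using Nw(1)[of j] by (simp add: T_def field_simps log_plus_def)
    qed
    have UK: "U J z \<le> - real J + L z" for J
    proof -
      have "(1/2) ^ Suc j * T j (2 ^ J) z \<le> -1" if "j < J" for j
      proof -
        have "(2::real) ^ Suc j \<le> 2 ^ J" using that by (intro power_increasing) auto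
        from mult_left_mono[OF TK[OF this], of "(1/2) ^ Suc j"]
        show ?thesis by (simp add: power_one_over)
      qed
      from sum_mono[of "{..<J}", OF this] have "(\<Sum>j<J. (1/2) ^ Suc j * T j (2 ^ J) z) \<le> - real J" by simp
      moreover have "(1/2) ^ J * L z \<le> 1 * L z"
        by (intro mult_right_mono power_le_one) (use R(1) in \<open>auto simp: L_def\<close>)
      ultimately show ?thesis by (simp add: U_def)
    qed
    have "W z \<le> ereal B" for B
    proof -
      obtain J where "L z - B \<le> real J" using real_arch_simple by blast
      then have "U J z \<le> B" using UK[of J] by linarith
      then show ?thesis unfolding W_def by (meson INF_lower2 UNIV_I ereal_less_eq(3))
    qed
    then show ?thesis by (metis ereal_bot)
  qed
  moreover have "W (of_real (R + 1)) \<noteq> -\<infinity>"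
  proof -
    let ?z = "of_real (R + 1) :: complex"
    have "0 \<le> T j m ?z" for j m
    proof -
      have "1 \<le> cmod (?z - x)" if "x \<in> X j" for x
        using norm_triangle_ineq2[of ?z x] R(2)[OF Nw(2)[OF that]] R(1) by (simp add: norm_of_real del: of_real_add)
      then have "1 \<le> cmod (root_prod (X j) ?z)"
        unfolding root_prod_def prod_norm[symmetric] by (intro prod_ge_1) auto
      then have "exp (m * real (N j)) \<le> exp (m * real (N j)) * cmod (root_prod (X j) ?z)"
        by simp
      then have "ln (exp (m * real (N j))) \<le> log_plus (exp (m * real (N j)) * cmod (root_prod (X j) ?z))"
        by (intro order.trans[OF log_plus_ge_ln log_plus_mono]) auto
      then show ?thesis using Nw(1)[of j] by (simp add: T_def field_simps)
    qed
    then have "0 \<le> U J ?z" for J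
      unfolding U_def L_def using R(1) by (intro add_nonneg_nonneg sum_nonneg mult_nonneg_nonneg) auto
    then have "0 \<le> W ?z" unfolding W_def by (intro INF_greatest) auto
    then show ?thesis by auto
  qed
  ultimately show ?thesis unfolding polar_def by blast
qed

section \<open>Separating a point from a compact set by a polynomial\<close>

definition poly_approx :: "complex set \<Rightarrow> (complex \<Rightarrow> complex) \<Rightarrow> bool" where
  "poly_approx K f \<longleftrightarrow> (\<forall>e>0. \<exists>p. \<forall>z\<in>K. cmod (poly p z - f z) \<le> e)"

lemma poly_approx_poly: "poly_approx K (poly p)"
  unfolding poly_approx_def by (auto intro!: exI[of _ p])

lemma poly_approx_limit:
  assumes "\<And>e. e > 0 \<Longrightarrow> \<exists>g. poly_approx K g \<and> (\<forall>z\<in>K. cmod (g z - f z) \<le> e)"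
  shows "poly_approx K f"
  unfolding poly_approx_def
proof (intro allI impI)
  fix e :: real assume "e > 0"
  then obtain g where g: "poly_approx K g" "\<And>z. z \<in> K \<Longrightarrow> cmod (g z - f z) \<le> e/2"
    using assms[of "e/2"] by auto
  then obtain p where p: "\<And>z. z \<in> K \<Longrightarrow> cmod (poly p z - g z) \<le> e/2"
    using \<open>e > 0\<close> unfolding poly_approx_def by (meson half_gt_zero)
  have "cmod (poly p z - f z) \<le> e" if "z \<in> K" for z
    using norm_triangle_ineq[of "poly p z - g z" "g z - f z"] g(2)[OF that] p[OF that] by simp
  then show "\<exists>p. \<forall>z\<in>K. cmod (poly p z - f z) \<le> e" by blast
qed

lemma poly_approx_add:
  assumes "poly_approx K f" "poly_approx K g"
  shows "poly_approx K (\<lambda>z. f z + g z)"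
  unfolding poly_approx_def
proof (intro allI impI)
  fix e :: real assume "e > 0"
  then obtain p q where "\<And>z. z \<in> K \<Longrightarrow> cmod (poly p z - f z) \<le> e/2" "\<And>z. z \<in> K \<Longrightarrow> cmod (poly q z - g z) \<le> e/2"
    using assms unfolding poly_approx_def by (meson half_gt_zero)
  then have "cmod (poly (p + q) z - (f z + g z)) \<le> e" if "z \<in> K" for z
  proof -
    have eq: "poly (p + q) z - (f z + g z) = (poly p z - f z) + (poly q z - g z)" by simp
    show ?thesis
      unfolding eq using norm_triangle_ineq[of "poly p z - f z" "poly q z - g z"]
        \<open>\<And>z. z \<in> K \<Longrightarrow> cmod (poly p z - f z) \<le> e/2\<close>[OF that] \<open>\<And>z. z \<in> K \<Longrightarrow> cmod (poly q z - g z) \<le> e/2\<close>[OF that]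
      by simp
  qed
  then show "\<exists>p. \<forall>z\<in>K. cmod (poly p z - (f z + g z)) \<le> e" by blast
qed

lemma poly_approx_mult:
  assumes "poly_approx K f" "poly_approx K g"
    and "\<And>z. z \<in> K \<Longrightarrow> cmod (f z) \<le> A" "\<And>z. z \<in> K \<Longrightarrow> cmod (g z) \<le> B"
  shows "poly_approx K (\<lambda>z. f z * g z)"
  unfolding poly_approx_def
proof (intro allI impI)
  fix e :: real assume "e > 0"
  define C where "C = \<bar>A\<bar> + \<bar>B\<bar> + 1"
  define d where "d = min 1 (e / C)"
  have "C > 0" by (simp add: C_def)
  moreover have "d * C \<le> e / C * C"
    unfolding d_def using \<open>C > 0\<close> by (intro mult_right_mono) auto
  ultimately have C: "C > 0" "d > 0" "d \<le> 1" "d * C \<le> e"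
    using \<open>e > 0\<close> by (auto simp: d_def)
  obtain p q where p: "\<And>z. z \<in> K \<Longrightarrow> cmod (poly p z - f z) \<le> d" and q: "\<And>z. z \<in> K \<Longrightarrow> cmod (poly q z - g z) \<le> d"
    using assms(1,2) C unfolding poly_approx_def by meson
  have "cmod (poly (p * q) z - f z * g z) \<le> e" if "z \<in> K" for z
  proof -
    have "poly (p * q) z - f z * g z = (poly p z - f z) * (poly q z - g z) + (poly p z - f z) * g z + f z * (poly q z - g z)"
      by (simp add: algebra_simps)
    also have "cmod \<dots> \<le> cmod (poly p z - f z) * cmod (poly q z - g z) + cmod (poly p z - f z) * cmod (g z) + cmod (f z) * cmod (poly q z - g z)"
      unfolding norm_mult[symmetric] by (intro order.trans[OF norm_triangle_ineq] add_right_mono norm_triangle_ineq)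
    also have "\<dots> \<le> d * 1 + d * \<bar>B\<bar> + \<bar>A\<bar> * d"
      using p[OF that] q[OF that] assms(3,4)[OF that] C
      by (intro add_mono mult_mono) auto
    also have "\<dots> = d * C" by (simp add: C_def algebra_simps)
    finally show ?thesis using C by simp
  qed
  then show "\<exists>p. \<forall>z\<in>K. cmod (poly p z - f z * g z) \<le> e" by blast
qed

lemma norm_one_over_one_minus_le:
  fixes w :: complex
  assumes "cmod w \<le> 1/2"
  shows "cmod (1 / (1 - w)) \<le> 2"
proof -
  have "1/2 \<le> cmod (1 - w)" using assms norm_triangle_ineq2[of 1 w] by simp
  then have "1 / cmod (1 - w) \<le> 1 / (1/2)" by (intro divide_left_mono) auto
  then show ?thesis by (simp add: norm_divide)
qed

lemma poly_approx_geometric: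
  assumes g: "poly_approx K g" and small: "\<And>z. z \<in> K \<Longrightarrow> cmod (g z) \<le> 1/2"
  shows "poly_approx K (\<lambda>z. 1 / (1 - g z))"
proof (rule poly_approx_limit)
  have pow: "poly_approx K (\<lambda>z. g z ^ n) \<and> (\<forall>z\<in>K. cmod (g z ^ n) \<le> 1)" for n
  proof (induction n)
    case 0
    show ?case using poly_approx_poly[of K 1] by (simp add: poly_1[abs_def])
  next
    case (Suc n)
    have "cmod (g z ^ Suc n) \<le> 1" if "z \<in> K" for z
      using small[OF that] by (simp only: norm_power) (intro power_le_one, auto)
    then show ?case
      using poly_approx_mult[OF g conjunct1[OF Suc.IH], of "1/2" 1] small Suc.IH by auto
  qed
  have psum: "poly_approx K (\<lambda>z. \<Sum>n<N. g z ^ n)" for N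
  proof (induction N)
    case 0
    show ?case using poly_approx_poly[of K 0] by (simp add: poly_0[abs_def])
  next
    case (Suc N)
    then show ?case using poly_approx_add[OF Suc.IH conjunct1[OF pow[of N]]] by simp
  qed
  fix e :: real assume "e > 0"
  obtain N where N: "(1/2::real) ^ N < e / 2"
    using real_arch_pow_inv[of "e/2" "1/2"] \<open>e > 0\<close> by auto
  have "cmod ((\<Sum>n<N. g z ^ n) - 1 / (1 - g z)) \<le> e" if "z \<in> K" for z
  proof -
    have ne: "g z \<noteq> 1" using small[OF that] by auto
    have "(\<Sum>n<N. g z ^ n) - 1 / (1 - g z) = - (g z ^ N / (1 - g z))"
    proof -
      have flip: "1 - g z = - (g z - 1)" by simp
      show ?thesis
        unfolding geometric_sum[OF ne] flip divide_minus_right by (simp add: diff_divide_distrib)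
    qed
    then have "cmod ((\<Sum>n<N. g z ^ n) - 1 / (1 - g z)) = cmod (g z) ^ N / cmod (1 - g z)"
      by (simp add: norm_divide norm_power)
    also have "\<dots> \<le> (1/2) ^ N / (1/2)"
      using small[OF that] norm_triangle_ineq2[of 1 "g z"]
      by (intro frac_le power_mono) auto
    also have "\<dots> \<le> e" using N by simp
    finally show ?thesis .
  qed
  with psum show "\<exists>h. poly_approx K h \<and> (\<forall>z\<in>K. cmod (h z - 1 / (1 - g z)) \<le> e)" by blast
qed

text \<open>Pole pushing: \<open>1 / (z - b)\<close> is the quotient of \<open>f = 1 / (z - a)\<close> by \<open>1 - (b - a) f\<close>, a geometric
  series in \<open>f\<close> when \<open>b\<close> is close to \<open>a\<close>.\<close>
lemma poly_approx_push:
  assumes a: "poly_approx K (\<lambda>z. 1 / (z - a))" and "d > 0"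
    and far: "\<And>z. z \<in> K \<Longrightarrow> d \<le> cmod (z - a)" and near: "cmod (b - a) \<le> d / 2"
  shows "poly_approx K (\<lambda>z. 1 / (z - b))"
proof -
  have bd: "cmod (1 / (z - a)) \<le> 1 / d" if "z \<in> K" for z
    using far[OF that] \<open>d > 0\<close> by (auto simp: norm_divide intro!: divide_left_mono mult_pos_pos)
  have sm: "cmod (poly [:b - a:] z * (1 / (z - a))) \<le> 1/2" if "z \<in> K" for z
  proof -
    have "cmod (poly [:b - a:] z * (1 / (z - a))) \<le> d / 2 * (1 / d)"
      unfolding norm_mult using bd[OF that] near \<open>d > 0\<close> by (intro mult_mono) auto
    then show ?thesis using \<open>d > 0\<close> by simp
  qed
  have "poly_approx K (\<lambda>z. poly [:b - a:] z * (1 / (z - a)))"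
    by (rule poly_approx_mult[OF poly_approx_poly a, where A = "cmod (b - a)" and B = "1 / d"]) (use bd in auto)
  from poly_approx_geometric[OF this sm]
  have g: "poly_approx K (\<lambda>z. 1 / (1 - poly [:b - a:] z * (1 / (z - a))))" by simp
  have bdg: "cmod (1 / (1 - poly [:b - a:] z * (1 / (z - a)))) \<le> 2" if "z \<in> K" for z
  proof -
    show ?thesis by (rule norm_one_over_one_minus_le[OF sm[OF that]])
  qed
  have "poly_approx K (\<lambda>z. 1 / (z - a) * (1 / (1 - poly [:b - a:] z * (1 / (z - a)))))"
    by (rule poly_approx_mult[OF a g bd bdg])
  moreover have "1 / (z - a) * (1 / (1 - poly [:b - a:] z * (1 / (z - a)))) = 1 / (z - b)" if "z \<in> K" for z
  proof -
    have "z \<noteq> a" using far[OF that] \<open>d > 0\<close> by auto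
    moreover have "z \<noteq> b" using far[OF that] near \<open>d > 0\<close> by auto
    ultimately show ?thesis by (simp add: divide_simps)
  qed
  ultimately show ?thesis unfolding poly_approx_def by (metis (no_types, lifting))
qed

text \<open>The set \<open>V\<close> of admissible poles and its complement in \<open>- K\<close> are both open, because poles can be
  pushed both ways between nearby points. Moreover \<open>V\<close> contains a point far away, where the series is
  one in \<open>z / a\<close>; so \<open>V\<close> contains the connected set \<open>outside K\<close>.\<close>
lemma poly_approx_outside:
  assumes K: "compact K" and "a \<in> outside K"
  shows "poly_approx K (\<lambda>z. 1 / (z - a))"
proof (cases "K = {}")
  case True
  then show ?thesis by (simp add: poly_approx_def)
next
  case False
  define V where "V = {a. a \<notin> K \<and> poly_approx K (\<lambda>z. 1 / (z - a))}"
  have oK: "open (- K)" using K compact_imp_closed by blast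
  have key: "\<exists>e>0. ball a e \<subseteq> - K \<and> (\<forall>b\<in>ball a e. a \<in> V \<longleftrightarrow> b \<in> V)" if a: "a \<notin> K" for a
  proof -
    obtain e where e: "e > 0" "ball a e \<subseteq> - K" using oK a open_contains_ball by blast
    then have far: "e \<le> cmod (z - a)" if "z \<in> K" for z
    proof -
      have "z \<notin> ball a e" using e(2) that by blast
      then show ?thesis by (simp add: dist_norm norm_minus_commute)
    qed
    \<comment> \<open>With radius \<open>e / 3\<close> the distance of \<open>b\<close> to \<open>K\<close> is still at least twice that of \<open>b\<close> to \<open>a\<close>.\<close>
    have "a \<in> V \<longleftrightarrow> b \<in> V" if b: "b \<in> ball a (e/3)" for b
    proof -
      have ab: "cmod (b - a) < e/3" using b by (simp add: dist_norm norm_minus_commute)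
      have farb: "2 * e / 3 \<le> cmod (z - b)" if "z \<in> K" for z
        using far[OF that] ab norm_triangle_ineq[of "z - b" "b - a"] by simp
      have "b \<notin> K" using farb[of b] e(1) by auto
      then show ?thesis
        using poly_approx_push[of K a e b] poly_approx_push[of K b "2*e/3" a] far farb ab e(1) a
        by (auto simp: V_def norm_minus_commute)
    qed
    moreover have "ball a (e/3) \<subseteq> - K" using e subset_ball[of "e/3" e a] by auto
    ultimately show ?thesis using e(1) by (intro exI[of _ "e/3"]) auto
  qed
  have oV: "open V"
    unfolding open_contains_ball
  proof
    fix a assume "a \<in> V"
    then obtain e where "e > 0" "\<forall>b\<in>ball a e. a \<in> V \<longleftrightarrow> b \<in> V" using key[of a] by (auto simp: V_def)
    then show "\<exists>e>0. ball a e \<subseteq> V" using \<open>a \<in> V\<close> by blast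
  qed
  have oW: "open (- K - V)"
    unfolding open_contains_ball
  proof
    fix a assume "a \<in> - K - V"
    then obtain e where "e > 0" "ball a e \<subseteq> - K" "\<forall>b\<in>ball a e. a \<in> V \<longleftrightarrow> b \<in> V" using key by blast
    then show "\<exists>e>0. ball a e \<subseteq> - K - V" using \<open>a \<in> - K - V\<close> by blast
  qed
  have conn: "connected (outside K)" using K by (intro connected_outside) (auto simp: compact_imp_bounded)
  obtain R where R: "R > 0" "\<And>z. z \<in> K \<Longrightarrow> cmod z \<le> R"
    using compact_imp_bounded[OF K] bounded_pos by metis
  define a0 where "a0 = complex_of_real (2 * R)"
  have a0: "cmod a0 = 2 * R" using R by (simp add: a0_def)
  have "a0 \<in> outside K"
  proof -
    have "- cball 0 R \<subseteq> outside K" using R by (intro outside_subset_convex) auto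
    moreover have "a0 \<in> - cball 0 R" using a0 R by simp
    ultimately show ?thesis by blast
  qed
  moreover have "a0 \<in> V"
  proof -
    have a0n: "a0 \<noteq> 0" using R by (simp add: a0_def)
    have "a0 \<notin> K" using R a0 by force
    have sm: "cmod (poly [:0, 1 / a0:] z) \<le> 1/2" if "z \<in> K" for z
      using R(2)[OF that] R(1) a0 by (simp add: norm_mult norm_divide field_simps)
    from poly_approx_geometric[OF poly_approx_poly this]
    have g: "poly_approx K (\<lambda>z. 1 / (1 - poly [:0, 1 / a0:] z))" by simp
    have bdg: "cmod (1 / (1 - poly [:0, 1 / a0:] z)) \<le> 2" if "z \<in> K" for z
    proof -
      show ?thesis by (rule norm_one_over_one_minus_le[OF sm[OF that]])
    qed
    have "poly_approx K (\<lambda>z. poly [:- 1 / a0:] z * (1 / (1 - poly [:0, 1 / a0:] z)))"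
      by (rule poly_approx_mult[OF poly_approx_poly g _ bdg, where A = "cmod (1 / a0)"]) (auto simp: norm_divide)
    moreover have "poly [:- 1 / a0:] z * (1 / (1 - poly [:0, 1 / a0:] z)) = 1 / (z - a0)" if "z \<in> K" for z
    proof -
      have "z \<noteq> a0" using that \<open>a0 \<notin> K\<close> by auto
      then show ?thesis using a0n by (simp add: divide_simps)
    qed
    ultimately have "poly_approx K (\<lambda>z. 1 / (z - a0))"
      unfolding poly_approx_def by (metis (no_types, lifting))
    then show ?thesis using \<open>a0 \<notin> K\<close> by (simp add: V_def)
  qed
  moreover have "outside K \<subseteq> V \<union> (- K - V)" by (auto simp: outside_def)
  ultimately have "outside K \<inter> (- K - V) = {}"
    using connectedD[OF conn oV oW] by blast
  then show ?thesis using assms(2) by (auto simp: V_def outside_def)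
qed

text \<open>If \<open>p\<close> approximates \<open>1 / (z - a)\<close> on \<open>K\<close>, then \<open>1 - (z - a) p\<close> is small on \<open>K\<close> and equal to 1 at \<open>a\<close>.\<close>
lemma polynomial_separation:
  assumes K: "compact K" and a: "a \<in> outside K"
  obtains q where "\<And>z. z \<in> K \<Longrightarrow> cmod (poly q z) \<le> 1" "cmod (poly q a) > 2"
proof -
  obtain B where B: "B > 0" "\<And>z. z \<in> K \<Longrightarrow> cmod z \<le> B"
    using compact_imp_bounded[OF K] bounded_pos by metis
  define D where "D = B + cmod a"
  have D: "D > 0" "\<And>z. z \<in> K \<Longrightarrow> cmod (z - a) \<le> D"
    using B by (auto simp: D_def intro: add_pos_nonneg order.trans[OF norm_triangle_ineq4])
  obtain p where p: "\<And>z. z \<in> K \<Longrightarrow> cmod (poly p z - 1 / (z - a)) \<le> 1 / (3 * D)"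
    using poly_approx_outside[OF K a] D unfolding poly_approx_def by (meson divide_pos_pos mult_pos_pos zero_less_numeral zero_less_one)
  define q where "q = smult 3 (1 - [:- a, 1:] * p)"
  have "cmod (poly q z) \<le> 1" if "z \<in> K" for z
  proof -
    have "z \<noteq> a" using that a by (auto simp: outside_def)
    then have "3 * ((z - a) * (1 / (z - a))) = 3" by simp
    moreover have "poly q z = 3 - 3 * ((z - a) * poly p z)"
      by (simp add: q_def algebra_simps)
    moreover have "- 3 * (z - a) * (poly p z - c) = 3 * ((z - a) * c) - 3 * ((z - a) * poly p z)" for c
      by (simp add: algebra_simps)
    ultimately have "poly q z = - 3 * (z - a) * (poly p z - 1 / (z - a))"
      by (simp only:)
    then have "cmod (poly q z) = 3 * cmod (z - a) * cmod (poly p z - 1 / (z - a))"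
      by (simp only: norm_mult norm_neg_numeral)
    also have "\<dots> \<le> 3 * D * (1 / (3 * D))"
      using D p[OF that] that by (intro mult_mono) auto
    finally show ?thesis using D by simp
  qed
  moreover have "cmod (poly q a) > 2" by (simp add: q_def)
  ultimately show ?thesis using that by blast
qed

section \<open>Lemniscates around a compact set\<close>

lemma norm_root_prod: "cmod (root_prod X z) = (\<Prod>x\<in>X. cmod (z - x))"
  by (simp add: root_prod_def prod_norm)

lemma root_prod_eq_0_iff: "finite X \<Longrightarrow> root_prod X z = 0 \<longleftrightarrow> z \<in> X"
  by (auto simp: root_prod_def)

text \<open>The squared Vandermonde product. Indexing it by sets rather than by tuples of points makes the
  passage to a set with one point more or less a plain identity.\<close>
definition discriminant :: "complex set \<Rightarrow> real" where
  "discriminant X = (\<Prod>x\<in>X. cmod (root_prod (X - {x}) x))"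

lemma discriminant_insert:
  assumes "finite X" "z \<notin> X"
  shows "discriminant (insert z X) = (cmod (root_prod X z))\<^sup>2 * discriminant X"
proof -
  have "cmod (root_prod (insert z X - {x}) x) = cmod (z - x) * cmod (root_prod (X - {x}) x)" if "x \<in> X" for x
  proof -
    have "insert z X - {x} = insert z (X - {x})" using that assms by auto
    then show ?thesis using assms by (simp add: norm_root_prod norm_minus_commute)
  qed
  then have "(\<Prod>x\<in>X. cmod (root_prod (insert z X - {x}) x)) = cmod (root_prod X z) * discriminant X"
    by (simp add: discriminant_def prod.distrib norm_root_prod)
  moreover have "insert z X - {z} = X" using assms by auto
  ultimately show ?thesis using assms by (simp add: discriminant_def power2_eq_square)
qed

lemma discriminant_pos: "finite X \<Longrightarrow> 0 < discriminant X"
  unfolding discriminant_def by (intro prod_pos) (simp add: root_prod_eq_0_iff)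

definition max_discriminant :: "complex set \<Rightarrow> nat \<Rightarrow> real" where
  "max_discriminant K n = (SUP X\<in>{X. X \<subseteq> K \<and> finite X \<and> card X = n}. discriminant X)"

lemma lagrange_interpolation:
  fixes q :: "complex poly"
  assumes "finite X" "degree q < card X"
  shows "poly q z = (\<Sum>x\<in>X. poly q x * (root_prod (X - {x}) z / root_prod (X - {x}) x))"
proof -
  define B where "B x = (\<Prod>y\<in>X - {x}. [:- y, 1:])" for x
  have polyB: "poly (B x) z = root_prod (X - {x}) z" for x z
    by (simp add: B_def poly_prod root_prod_def)
  define L where "L = (\<Sum>x\<in>X. smult (poly q x / root_prod (X - {x}) x) (B x))"
  have polyL: "poly L z = (\<Sum>x\<in>X. poly q x * (root_prod (X - {x}) z / root_prod (X - {x}) x))" for z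
    by (simp add: L_def poly_sum polyB)
  have "degree (B x) < card X" if "x \<in> X" for x
  proof -
    have "degree (B x) \<le> (\<Sum>y\<in>X - {x}. degree [:- y, 1:])"
      unfolding B_def using degree_prod_sum_le[of "X - {x}" "\<lambda>y. [:- y, 1:]"] assms by (simp add: o_def)
    also have "\<dots> = card (X - {x})" by simp
    also have "\<dots> < card X" using that assms by (meson card_Diff1_less)
    finally show ?thesis .
  qed
  then have "degree L < card X"
    unfolding L_def using assms by (intro degree_sum_less) (auto intro: le_less_trans[OF degree_smult_le])
  moreover have "poly q x = poly L x" if "x \<in> X" for x
  proof -
    have "poly L x = (\<Sum>y\<in>X. if y = x then poly q x else 0)"
      unfolding polyL
    proof (rule sum.cong[OF refl])
      fix y assume "y \<in> X"
      show "poly q y * (root_prod (X - {y}) x / root_prod (X - {y}) y) = (if y = x then poly q x else 0)"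
        using assms that by (auto simp: root_prod_eq_0_iff)
    qed
    then show ?thesis using that assms by simp
  qed
  ultimately have "q = L" using assms by (intro poly_eqI_degree[of X]) auto
  then have "poly q z = poly L z" by (rule arg_cong)
  then show ?thesis by (simp only: polyL)
qed

context
  fixes K :: "complex set" and R :: real
  assumes inf: "infinite K" and bdd: "\<And>z. z \<in> K \<Longrightarrow> cmod z \<le> R" and R: "1 \<le> R"
begin

lemma root_prod_bound:
  assumes "finite X" "X \<subseteq> K" "cmod z \<le> R"
  shows "cmod (root_prod X z) \<le> (2 * R) ^ card X"
proof -
  have "cmod (root_prod X z) \<le> (\<Prod>x\<in>X. 2 * R)"
    unfolding norm_root_prod
  proof (rule prod_mono)
    fix x assume "x \<in> X"
    then show "0 \<le> cmod (z - x) \<and> cmod (z - x) \<le> 2 * R"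
      using assms bdd[of x] norm_triangle_ineq4[of z x] by auto
  qed
  then show ?thesis by simp
qed

lemma discriminant_bdd_above: "bdd_above (discriminant ` {X. X \<subseteq> K \<and> finite X \<and> card X = n})"
proof (rule bdd_aboveI2)
  fix X assume X: "X \<in> {X. X \<subseteq> K \<and> finite X \<and> card X = n}"
  have "discriminant X \<le> (\<Prod>x\<in>X. (2 * R) ^ n)"
    unfolding discriminant_def
  proof (rule prod_mono)
    fix x assume "x \<in> X"
    have "cmod (root_prod (X - {x}) x) \<le> (2 * R) ^ card (X - {x})"
      using X \<open>x \<in> X\<close> bdd by (intro root_prod_bound) auto
    also have "\<dots> \<le> (2 * R) ^ n"
      using R X by (intro power_increasing) (auto intro: card_mono)
    finally show "0 \<le> cmod (root_prod (X - {x}) x) \<and> cmod (root_prod (X - {x}) x) \<le> (2 * R) ^ n" by simp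
  qed
  also have "\<dots> = ((2 * R) ^ n) ^ n" using X by simp
  finally show "discriminant X \<le> ((2 * R) ^ n) ^ n" .
qed

lemma discriminant_le_max:
  "X \<subseteq> K \<Longrightarrow> finite X \<Longrightarrow> discriminant X \<le> max_discriminant K (card X)"
  unfolding max_discriminant_def by (rule cSUP_upper[OF _ discriminant_bdd_above]) auto

lemma max_discriminant_pos: "0 < max_discriminant K n"
proof -
  obtain X0 where X0: "X0 \<subseteq> K" "finite X0" "card X0 = n"
    using infinite_arbitrarily_large[OF inf] by metis
  then show ?thesis
    using discriminant_pos[of X0] discriminant_le_max[of X0] by simp
qed

lemma exists_near_max:
  assumes "t < 1"
  obtains X where "X \<subseteq> K" "finite X" "card X = n" "t * max_discriminant K n < discriminant X"
proof -
  obtain X0 where X0: "X0 \<subseteq> K" "finite X0" "card X0 = n"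
    using infinite_arbitrarily_large[OF inf] by metis
  have "t * max_discriminant K n < max_discriminant K n" using assms max_discriminant_pos by simp
  then obtain X where "X \<in> {X. X \<subseteq> K \<and> finite X \<and> card X = n}" "t * max_discriminant K n < discriminant X"
    unfolding max_discriminant_def
    using less_cSUP_iff[OF _ discriminant_bdd_above, of n] X0 by blast
  then show ?thesis using that by blast
qed

lemma max_discriminant_Suc_le: "max_discriminant K (Suc n) \<le> (2 * R) ^ (2 * n) * max_discriminant K n"
proof -
  obtain X0 where X0: "X0 \<subseteq> K" "finite X0" "card X0 = Suc n"
    using infinite_arbitrarily_large[OF inf] by metis
  show ?thesis
    unfolding max_discriminant_def[of K "Suc n"]
  proof (rule cSUP_least)
    show "{X. X \<subseteq> K \<and> finite X \<and> card X = Suc n} \<noteq> {}" using X0 by blast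
    fix Y assume "Y \<in> {X. X \<subseteq> K \<and> finite X \<and> card X = Suc n}"
    then obtain z X where Y: "Y = insert z X" "z \<notin> X" "finite X" "card X = n" "insert z X \<subseteq> K"
      by (auto simp: card_Suc_eq)
    have "(cmod (root_prod X z))\<^sup>2 \<le> ((2 * R) ^ n)\<^sup>2"
      using root_prod_bound[of X z] Y bdd[of z] by (intro power_mono) auto
    then have "discriminant Y \<le> ((2 * R) ^ n)\<^sup>2 * max_discriminant K n"
      using Y discriminant_le_max[of X] discriminant_pos[of X]
      by (simp add: discriminant_insert) (intro mult_mono, auto)
    then show "discriminant Y \<le> (2 * R) ^ (2 * n) * max_discriminant K n"
      by (simp only: power_even_eq)
  qed
qed

text \<open>The quotients of successive maximal discriminants are at most \<open>(4 R\<^sup>2) ^ n\<close>. If the stated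
  inequality failed from some index on, they would grow at least like \<open>(8 R\<^sup>2) ^ n\<close>.\<close>
lemma max_discriminant_ratio:
  obtains n where "m \<le> n"
    "max_discriminant K (Suc n) * max_discriminant K (n - 1) < 8 * R\<^sup>2 * (max_discriminant K n)\<^sup>2"
proof (rule ccontr)
  assume "\<not> thesis"
  then have neg: "\<forall>n\<ge>m. 8 * R\<^sup>2 * (max_discriminant K n)\<^sup>2 \<le> max_discriminant K (Suc n) * max_discriminant K (n - 1)"
    using that by (meson not_le)
  define \<rho> where "\<rho> n = max_discriminant K (Suc n) / max_discriminant K n" for n
  note pos = max_discriminant_pos
  have step: "8 * R\<^sup>2 * \<rho> n \<le> \<rho> (Suc n)" if "m \<le> Suc n" for n
  proof -
    have arith: "C * (b / a) \<le> c / b" if "0 < a" "0 < b" "C * b\<^sup>2 \<le> c * a" for a b c C :: real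
      using that by (simp add: field_simps power2_eq_square)
    show ?thesis
      unfolding \<rho>_def using neg[rule_format, OF that] by (intro arith pos) simp
  qed
  have up: "\<rho> n \<le> (4 * R\<^sup>2) ^ n" for n
  proof -
    have "(2 * R) ^ (2 * n) = (4 * R\<^sup>2) ^ n"
      by (simp add: power_mult power_mult_distrib)
    then show ?thesis
      using max_discriminant_Suc_le[of n] pos[of n] by (simp add: \<rho>_def pos_divide_le_eq)
  qed
  have low: "(8 * R\<^sup>2) ^ k * \<rho> m \<le> \<rho> (m + k)" for k
  proof (induction k)
    case (Suc k)
    have "(8 * R\<^sup>2) ^ Suc k * \<rho> m \<le> 8 * R\<^sup>2 * \<rho> (m + k)"
      using mult_left_mono[OF Suc.IH, of "8 * R\<^sup>2"] by (simp add: mult.assoc)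
    also have "\<dots> \<le> \<rho> (m + Suc k)" using step[of "m + k"] by simp
    finally show ?case .
  qed simp
  define c where "c = (4 * R\<^sup>2) ^ m / \<rho> m"
  have "0 < \<rho> m" using pos by (simp add: \<rho>_def)
  have "2 ^ k \<le> c" for k :: nat
  proof -
    have eq: "(8 * R\<^sup>2) ^ k = 2 ^ k * (4 * R\<^sup>2) ^ k"
      unfolding power_mult_distrib[symmetric] by simp
    have "(2 ^ k * \<rho> m) * (4 * R\<^sup>2) ^ k \<le> (4 * R\<^sup>2) ^ m * (4 * R\<^sup>2) ^ k"
      using order.trans[OF low[of k] up[of "m + k"]] unfolding eq power_add by (simp only: mult_ac)
    then have "2 ^ k * \<rho> m \<le> (4 * R\<^sup>2) ^ m"
      by (rule mult_right_le_imp_le) (use R in simp)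
    then show ?thesis using \<open>0 < \<rho> m\<close> by (simp add: c_def pos_le_divide_eq)
  qed
  moreover obtain k where "c < 2 ^ k" using real_arch_pow[of 2 c] by auto
  ultimately show False by (meson not_le)
qed

text \<open>At a point \<open>z\<close> where some polynomial bounded by 1 on \<open>K\<close> is large, a Lagrange basis polynomial of
  \<open>X\<close> is large. The one belonging to \<open>x\<close> is \<open>root_prod X z\<close> divided by \<open>z - x\<close>, which is not small, and
  by a factor that near-extremality of the discriminant of \<open>X\<close> bounds from below. Near-extremal sets, with the factor \<open>1/2\<close>, are good
  enough and exist without a compactness argument for sets of points.\<close>
lemma fekete_lower_bound:
  assumes X: "X \<subseteq> K" "finite X" "card X = Suc n" "1/2 * max_discriminant K (Suc n) < discriminant X"
    and q: "degree q \<le> n" "\<And>x. x \<in> K \<Longrightarrow> cmod (poly q x) \<le> 1"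
    and d: "0 < d" "\<And>x. x \<in> K \<Longrightarrow> d \<le> cmod (z - x)"
  shows "cmod (poly q z) * d / real (Suc n) * sqrt (max_discriminant K (Suc n) / (2 * max_discriminant K n))
     \<le> cmod (root_prod X z)"
proof -
  define s where "s = sqrt (max_discriminant K (Suc n) / (2 * max_discriminant K n))"
  have spos: "0 < s" using max_discriminant_pos by (simp add: s_def)
  have low: "s \<le> cmod (root_prod (X - {x}) x)" if "x \<in> X" for x
  proof -
    have "X = insert x (X - {x})" using that by auto
    then have "discriminant X = (cmod (root_prod (X - {x}) x))\<^sup>2 * discriminant (X - {x})"
      using discriminant_insert[of "X - {x}" x] X by simp
    also have "\<dots> \<le> (cmod (root_prod (X - {x}) x))\<^sup>2 * max_discriminant K n"
      using discriminant_le_max[of "X - {x}"] X that by (intro mult_left_mono) auto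
    finally have "max_discriminant K (Suc n) / (2 * max_discriminant K n) \<le> (cmod (root_prod (X - {x}) x))\<^sup>2"
      using X(4) max_discriminant_pos[of n] by (simp add: field_simps)
    then show ?thesis unfolding s_def by (metis norm_ge_zero real_sqrt_le_mono real_sqrt_unique)
  qed
  have "cmod (poly q z) = cmod (\<Sum>x\<in>X. poly q x * (root_prod (X - {x}) z / root_prod (X - {x}) x))"
    using lagrange_interpolation[of X q z] X q(1) by simp
  also have "\<dots> \<le> (\<Sum>x\<in>X. cmod (root_prod X z) / (d * s))"
  proof (rule sum_norm_le)
    fix x assume x: "x \<in> X"
    then have "x \<in> K" using X by blast
    have "root_prod X z = (z - x) * root_prod (X - {x}) z"
      using x X(2) by (simp add: root_prod_def prod.remove)
    then have "cmod (root_prod X z) = cmod (z - x) * cmod (root_prod (X - {x}) z)" by (simp add: norm_mult)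
    then have "cmod (root_prod (X - {x}) z) * d \<le> cmod (root_prod X z)"
      using mult_left_mono[OF d(2)[OF \<open>x \<in> K\<close>], of "cmod (root_prod (X - {x}) z)"] by (simp add: mult.commute)
    then have a: "cmod (root_prod (X - {x}) z) \<le> cmod (root_prod X z) / d" using d(1) by (simp add: field_simps)
    have "cmod (poly q x * (root_prod (X - {x}) z / root_prod (X - {x}) x))
       \<le> 1 * (cmod (root_prod (X - {x}) z) / cmod (root_prod (X - {x}) x))"
      unfolding norm_mult norm_divide using q(2)[OF \<open>x \<in> K\<close>] by (intro mult_right_mono) auto
    also have "\<dots> \<le> (cmod (root_prod X z) / d) / s"
      unfolding mult_1_left by (rule frac_le) (use a low[OF x] spos d(1) in auto)
    finally show "cmod (poly q x * (root_prod (X - {x}) z / root_prod (X - {x}) x)) \<le> cmod (root_prod X z) / (d * s)"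
      by simp
  qed
  also have "\<dots> = real (Suc n) * (cmod (root_prod X z) / (d * s))" using X(3) by simp
  finally show ?thesis unfolding s_def[symmetric] using spos d(1) by (simp add: field_simps)
qed

text \<open>Adding \<open>z\<close> to \<open>X\<close> multiplies the discriminant by \<open>|root_prod X z|\<^sup>2\<close>.\<close>
lemma fekete_upper_bound:
  assumes X: "X \<subseteq> K" "finite X" "1/2 * max_discriminant K (card X) < discriminant X" and z: "z \<in> K"
  shows "cmod (root_prod X z) \<le> sqrt (2 * max_discriminant K (Suc (card X)) / max_discriminant K (card X))"
proof (cases "z \<in> X")
  case True
  then have "root_prod X z = 0" using X by (simp add: root_prod_eq_0_iff)
  then show ?thesis using max_discriminant_pos less_imp_le by (auto intro!: divide_nonneg_nonneg mult_nonneg_nonneg)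
next
  case False
  have "(cmod (root_prod X z))\<^sup>2 * (1/2 * max_discriminant K (card X)) \<le> (cmod (root_prod X z))\<^sup>2 * discriminant X"
    using X by (intro mult_left_mono) auto
  also have "\<dots> \<le> max_discriminant K (Suc (card X))"
    using discriminant_le_max[of "insert z X"] X z False by (simp add: discriminant_insert)
  finally have "(cmod (root_prod X z))\<^sup>2 \<le> 2 * max_discriminant K (Suc (card X)) / max_discriminant K (card X)"
    using max_discriminant_pos[of "card X"] by (simp add: field_simps)
  then show ?thesis by (metis norm_ge_zero real_sqrt_le_mono real_sqrt_unique)
qed

end

lemma power_over_square_unbounded:
  fixes c M :: real
  assumes "0 < c"
  obtains k0 :: nat where "\<And>k. k0 \<le> k \<Longrightarrow> M * (real k + 1)\<^sup>2 < c * 4 ^ k"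
proof -
  have "(\<lambda>k. real k * (1/2) ^ k) \<longlonglongrightarrow> 0" "(\<lambda>k. (1/2::real) ^ k) \<longlonglongrightarrow> 0"
    by (auto intro: powser_times_n_limit_0 LIMSEQ_power_zero)
  from tendsto_power[OF tendsto_add[OF this], of 2]
  have "eventually (\<lambda>k::nat. (real k * (1/2) ^ k + (1/2) ^ k)\<^sup>2 < c / (\<bar>M\<bar> + 1)) sequentially"
    by (rule order_tendstoD(2)) (use assms in \<open>auto intro: add_nonneg_pos\<close>)
  then obtain k0 where k0: "\<And>k::nat. k0 \<le> k \<Longrightarrow> (real k * (1/2) ^ k + (1/2) ^ k)\<^sup>2 < c / (\<bar>M\<bar> + 1)"
    by (auto simp: eventually_sequentially)
  have "M * (real k + 1)\<^sup>2 < c * 4 ^ k" if "k0 \<le> k" for k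
  proof -
    have "(real k * (1/2) ^ k + (1/2) ^ k)\<^sup>2 = (real k + 1)\<^sup>2 * ((1/2) ^ k)\<^sup>2"
      by (simp add: power_mult_distrib[symmetric] distrib_right)
    also have "((1/2::real) ^ k)\<^sup>2 = 1 / 4 ^ k"
      unfolding power2_eq_square power_mult_distrib[symmetric] by (simp add: power_one_over)
    finally have "(\<bar>M\<bar> + 1) * (real k + 1)\<^sup>2 < c * 4 ^ k"
      using k0[OF that] by (simp add: pos_less_divide_eq pos_divide_less_eq mult.commute)
    moreover have "M * (real k + 1)\<^sup>2 \<le> (\<bar>M\<bar> + 1) * (real k + 1)\<^sup>2" by (intro mult_right_mono) auto
    ultimately show ?thesis by linarith
  qed
  then show ?thesis using that by blast
qed

text \<open>Hilbert's lemniscate theorem. Finitely many polynomials separate \<open>K\<close> from the compact part \<open>Q\<close> of the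
  complement of \<open>U\<close>. High powers of them make a Lagrange basis polynomial of a near-Fekete set
  exponentially large on \<open>Q\<close>. By \<open>fekete_lower_bound\<close>, \<open>fekete_upper_bound\<close> and
  \<open>max_discriminant_ratio\<close> this growth beats the ratio of the maximum of \<open>|root_prod X|\<close> on \<open>K\<close> to
  the factors in the Lagrange basis. Points further away than \<open>3 R\<close> are separated trivially.\<close>
theorem lemniscate_neighbourhood:
  assumes K: "compact K" "infinite K" and U: "open U" "K \<union> inside K \<subseteq> U"
  obtains X M where "X \<subseteq> K" "finite X" "X \<noteq> {}" "0 < M"
    "\<And>z. z \<in> K \<Longrightarrow> cmod (root_prod X z) \<le> M"
    "\<And>z. z \<notin> U \<Longrightarrow> M < cmod (root_prod X z)"
proof -
  obtain R0 where R0: "R0 > 0" "\<And>z. z \<in> K \<Longrightarrow> cmod z \<le> R0"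
    using compact_imp_bounded[OF K(1)] bounded_pos by metis
  define R where "R = max 1 R0"
  have R: "1 \<le> R" and bdd: "\<And>z. z \<in> K \<Longrightarrow> cmod z \<le> R"
    using R0(2) by (force simp: R_def)+
  note pos = max_discriminant_pos[OF K(2) bdd R]
  define Q where "Q = cball 0 (3 * R) - U"
  have Q: "compact Q" using U(1) by (simp add: Q_def compact_diff)
  have "Q \<inter> K = {}" using U(2) by (auto simp: Q_def)
  then obtain d where d: "0 < d" "\<And>z x. z \<in> Q \<Longrightarrow> x \<in> K \<Longrightarrow> d \<le> cmod (z - x)"
    using separate_compact_closed[OF Q compact_imp_closed[OF K(1)]] by (metis dist_norm)
  have "\<forall>z\<in>Q. \<exists>q. (\<forall>x\<in>K. cmod (poly q x) \<le> 1) \<and> 2 < cmod (poly q z)"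
  proof
    fix z assume "z \<in> Q"
    then have "z \<in> outside K" using U(2) union_with_inside[of K] by (auto simp: Q_def)
    then show "\<exists>q. (\<forall>x\<in>K. cmod (poly q x) \<le> 1) \<and> 2 < cmod (poly q z)"
      using polynomial_separation[OF K(1)] by metis
  qed
  then obtain q where q: "\<And>z x. z \<in> Q \<Longrightarrow> x \<in> K \<Longrightarrow> cmod (poly (q z) x) \<le> 1" "\<And>z. z \<in> Q \<Longrightarrow> 2 < cmod (poly (q z) z)"
    by metis
  have "open {y. 2 < cmod (poly (q z) y)}" for z
    by (intro open_Collect_less continuous_intros)
  moreover have "Q \<subseteq> (\<Union>z\<in>Q. {y. 2 < cmod (poly (q z) y)})" using q(2) by auto
  ultimately obtain F where F: "F \<subseteq> Q" "finite F" "Q \<subseteq> (\<Union>z\<in>F. {y. 2 < cmod (poly (q z) y)})"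
    using compactE_image[OF Q] by metis
  \<comment> \<open>A common positive bound for the degrees; a power \<open>k\<close> then needs about \<open>D * k\<close> points. The index
    \<open>k0\<close> is where \<open>4 ^ k\<close> overtakes all polynomial factors.\<close>
  define D where "D = Suc (\<Sum>z\<in>F. degree (q z))"
  have D: "0 < D" "\<And>z. z \<in> F \<Longrightarrow> degree (q z) \<le> D"
    using F(2) by (auto simp: D_def intro!: le_SucI member_le_sum)
  obtain k0 where k0: "\<And>k. k0 \<le> k \<Longrightarrow> 32 * R\<^sup>2 * (real D)\<^sup>2 * (real k + 1)\<^sup>2 < d\<^sup>2 * 4 ^ k"
    using power_over_square_unbounded[of "d\<^sup>2" "32 * R\<^sup>2 * (real D)\<^sup>2"] d(1) by auto
  obtain n' where n': "D * k0 + 1 \<le> n'"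
    "max_discriminant K (Suc n') * max_discriminant K (n' - 1) < 8 * R\<^sup>2 * (max_discriminant K n')\<^sup>2"
    using max_discriminant_ratio[OF K(2) bdd R, of "D * k0 + 1"] by auto
  define n where "n = n' - 1"
  have n: "n' = Suc n" "D * k0 \<le> n" using n'(1) by (auto simp: n_def)
  define k where "k = n div D"
  have k: "k0 \<le> k" "D * k \<le> n" "Suc n \<le> D * (k + 1)"
  proof -
    show "k0 \<le> k" using div_le_mono[OF n(2), of D] D(1) by (simp add: k_def)
    show "D * k \<le> n" by (simp add: k_def)
    show "Suc n \<le> D * (k + 1)"
      using dividend_less_times_div[OF D(1), of n] by (simp add: k_def)
  qed
  define a where "a i = max_discriminant K (n + i)" for i
  have apos: "0 < a i" for i using pos by (simp add: a_def)
  have ratio: "a 2 * a 0 < 8 * R\<^sup>2 * (a 1)\<^sup>2"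
    using n'(2) by (simp add: n a_def)
  obtain X where X: "X \<subseteq> K" "finite X" "card X = Suc n" "1/2 * max_discriminant K (Suc n) < discriminant X"
    by (rule exists_near_max[OF K(2) bdd R, of "1/2" "Suc n"]) simp_all
  have "K \<noteq> {}" using K(2) by auto
  have "continuous_on K (\<lambda>z. cmod (root_prod X z))" by (intro continuous_intros)
  then obtain z0 where z0: "z0 \<in> K" "\<And>z. z \<in> K \<Longrightarrow> cmod (root_prod X z) \<le> cmod (root_prod X z0)"
    using continuous_attains_sup[OF K(1) \<open>K \<noteq> {}\<close>] by metis
  define M where "M = cmod (root_prod X z0)"
  have "0 < M"
  proof -
    have "\<not> K \<subseteq> X" using finite_subset[OF _ X(2)] K(2) by blast
    then obtain z where "z \<in> K" "z \<notin> X" by blast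
    then have "0 < cmod (root_prod X z)" using X(2) root_prod_eq_0_iff by simp
    also have "\<dots> \<le> M" unfolding M_def by (rule z0(2)[OF \<open>z \<in> K\<close>])
    finally show ?thesis .
  qed
  have Msmall: "M\<^sup>2 \<le> 2 * a 2 / a 1"
  proof -
    have "M \<le> sqrt (2 * a 2 / a 1)"
      using fekete_upper_bound[OF K(2) bdd R X(1,2) _ z0(1)] X by (simp add: M_def a_def)
    then show ?thesis using \<open>0 < M\<close> by (simp add: real_le_rsqrt sqrt_ge_absD real_sqrt_ge_zero abs_of_pos)
  qed
  have "M < cmod (root_prod X z)" if "z \<notin> U" for z
  proof (cases "cmod z \<le> 3 * R")
    case True
    then have "z \<in> Q" using that by (simp add: Q_def)
    then obtain y where y: "y \<in> F" "2 < cmod (poly (q y) z)" using F(3) by auto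
    have "degree (q y ^ k) \<le> n"
      using degree_power_le[of "q y" k] mult_right_mono[OF D(2)[OF y(1)], of k] k(2)
      by linarith
    moreover have "cmod (poly (q y ^ k) x) \<le> 1" if "x \<in> K" for x
      using q(1)[of y x] that y(1) F(1) by (simp add: poly_power norm_power power_le_one subset_iff)
    ultimately have "cmod (poly (q y ^ k) z) * d / real (Suc n) * sqrt (a 1 / (2 * a 0)) \<le> cmod (root_prod X z)"
      using fekete_lower_bound[OF K(2) bdd R X, of "q y ^ k" d z] d \<open>z \<in> Q\<close> by (simp add: a_def)
    moreover have "2 ^ k * d / (real D * (real k + 1)) * sqrt (a 1 / (2 * a 0))
       \<le> cmod (poly (q y ^ k) z) * d / real (Suc n) * sqrt (a 1 / (2 * a 0))"
    proof (intro mult_right_mono frac_le)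
      show "2 ^ k \<le> cmod (poly (q y ^ k) z)" using y(2) by (simp add: poly_power norm_power power_mono)
      have "real (Suc n) \<le> real (D * (k + 1))" using k(3) by (rule of_nat_mono)
      then show "real (Suc n) \<le> real D * (real k + 1)" by (simp add: algebra_simps)
    qed (use d(1) apos in \<open>auto intro: less_imp_le\<close>)
    ultimately have low: "2 ^ k * d / (real D * (real k + 1)) * sqrt (a 1 / (2 * a 0)) \<le> cmod (root_prod X z)"
      by simp
    have "M\<^sup>2 < (2 ^ k * d / (real D * (real k + 1)) * sqrt (a 1 / (2 * a 0)))\<^sup>2"
    proof -
      have "2 * a 2 / a 1 < 16 * R\<^sup>2 * (a 1 / a 0)"
        using ratio apos[of 0] apos[of 1] by (simp add: field_simps power2_eq_square)
      also have "16 * R\<^sup>2 * (a 1 / a 0) \<le> (d\<^sup>2 * 4 ^ k / (2 * ((real D)\<^sup>2 * (real k + 1)\<^sup>2))) * (a 1 / a 0)"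
      proof (rule mult_right_mono)
        have "0 < 2 * ((real D)\<^sup>2 * (real k + 1)\<^sup>2)" using D(1) by simp
        then show "16 * R\<^sup>2 \<le> d\<^sup>2 * 4 ^ k / (2 * ((real D)\<^sup>2 * (real k + 1)\<^sup>2))"
          using k0[OF k(1)] by (subst le_divide_eq) (auto simp: algebra_simps)
        show "0 \<le> a 1 / a 0" using apos[of 0] apos[of 1] by simp
      qed
      also have "\<dots> = (2 ^ k * d / (real D * (real k + 1)) * sqrt (a 1 / (2 * a 0)))\<^sup>2"
      proof -
        have "(sqrt (a 1 / (2 * a 0)))\<^sup>2 = a 1 / (2 * a 0)" using apos[of 0] apos[of 1] by simp
        moreover have "(2 ^ k)\<^sup>2 = (4::real) ^ k"
          unfolding power2_eq_square power_mult_distrib[symmetric] by simp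
        ultimately show ?thesis by (simp add: power_mult_distrib power_divide ac_simps)
      qed
      finally show ?thesis using Msmall by simp
    qed
    then have "M < 2 ^ k * d / (real D * (real k + 1)) * sqrt (a 1 / (2 * a 0))"
    proof (rule power2_less_imp_less)
      have "0 \<le> sqrt (a 1 / (2 * a 0))"
        using apos[of 0] apos[of 1] by (intro real_sqrt_ge_zero divide_nonneg_nonneg) auto
      moreover have "0 \<le> 2 ^ k * d / (real D * (real k + 1))" using d(1) by simp
      ultimately show "0 \<le> 2 ^ k * d / (real D * (real k + 1)) * sqrt (a 1 / (2 * a 0))"
        by (rule mult_nonneg_nonneg[rotated])
    qed
    with low show ?thesis by simp
  next
    case False
    have "M \<le> (2 * R) ^ card X"
      unfolding M_def using root_prod_bound[OF K(2) bdd R X(2,1)] bdd[OF z0(1)] by simp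
    also have "\<dots> = (\<Prod>x\<in>X. 2 * R)" by simp
    also have "\<dots> < cmod (root_prod X z)"
      unfolding norm_root_prod
    proof -
      have far: "2 * R < cmod (z - x)" if "x \<in> X" for x
        using False R bdd[of x] X(1) norm_triangle_ineq2[of z x] that by auto
      have "z \<notin> X" using far[of z] R by auto
      obtain x0 where "x0 \<in> X" using X(3) by fastforce
      then show "(\<Prod>x\<in>X. 2 * R) < (\<Prod>x\<in>X. cmod (z - x))"
        using far R X(2) \<open>z \<notin> X\<close> by (intro prod_mono_strict[of x0]) (auto intro: less_imp_le order_le_less_trans[OF _ far])
    qed
    finally show ?thesis .
  qed
  moreover have "X \<noteq> {}" using X by auto
  ultimately show ?thesis using that[OF X(1,2) _ \<open>0 < M\<close>] z0 by (auto simp: M_def)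
qed

section \<open>Level curves of logarithms of polynomials\<close>

lemma not_constant_root_prod:
  assumes "finite X" "X \<noteq> {}" "r > 0" "root_prod X z0 \<noteq> 0"
  shows "\<exists>z\<in>ball z0 r. root_prod X z \<noteq> root_prod X z0"
proof (rule ccontr)
  define p where "p = (\<Prod>x\<in>X. [:- x, 1:])"
  have p: "poly p z = root_prod X z" for z by (simp add: p_def poly_prod root_prod_def)
  assume "\<not> ?thesis"
  then have "ball z0 r \<subseteq> {z. poly (p - [:root_prod X z0:]) z = 0}" by (auto simp: p)
  moreover have "infinite (ball z0 r)" using \<open>r > 0\<close> finite_imp_not_open[of "ball z0 r"] by auto
  ultimately have "p - [:root_prod X z0:] = 0" using poly_roots_finite finite_subset by blast
  then have "poly p x = root_prod X z0" for x by simp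
  moreover obtain x where "x \<in> X" using assms by blast
  then have "root_prod X x = 0" using root_prod_eq_0_iff assms by blast
  ultimately show False using p assms(4) by metis
qed

text \<open>Near \<open>z0\<close>, the function \<open>ln (P z / P z0)\<close> is the \<open>m\<close>-th power of a local coordinate, where \<open>m > 1\<close>
  at critical points of \<open>P\<close>; the inverse of that coordinate, rescaled by an \<open>m\<close>-th root of \<open>c\<close>, is \<open>F\<close>.\<close>
lemma branched_level_curve:
  assumes X: "finite X" "X \<noteq> {}" and z0: "root_prod X z0 \<noteq> 0" and "0 < c"
  obtains m r F \<beta> C where "0 < m" "0 < r" "r \<le> 1" "F holomorphic_on ball 0 r" "F 0 = z0" "\<beta> \<noteq> 0" "0 \<le> C"
    "\<And>s. s \<in> ball 0 r \<Longrightarrow> root_prod X (F s) = root_prod X z0 * exp (of_real c * s ^ m)"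
    "\<And>s. s \<in> ball 0 r \<Longrightarrow> cmod (F s - z0 - \<beta> * s) \<le> C * (cmod s)\<^sup>2"
proof -
  define q where "q z = root_prod X z / root_prod X z0" for z
  have qhol: "q holomorphic_on A" for A unfolding q_def using z0 by (intro holomorphic_intros) auto
  have "isCont q z0" using qhol[of UNIV] holomorphic_on_imp_continuous_on continuous_on_eq_continuous_at by blast
  then obtain r1 where r1: "r1 > 0" "\<And>z. z \<in> ball z0 r1 \<Longrightarrow> cmod (q z - 1) < 1"
    using z0 unfolding continuous_at_eps_delta q_def
    by (metis (no_types, lifting) dist_commute dist_norm divide_self mem_ball zero_less_one)
  have qpos: "q z \<noteq> 0 \<and> q z \<notin> \<real>\<^sub>\<le>\<^sub>0" if "z \<in> ball z0 r1" for z
  proof -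
    have "Re (q z) > 0" using r1(2)[OF that] complex_Re_le_cmod[of "1 - q z"] by (simp add: norm_minus_commute)
    then show ?thesis by (metis complex_nonpos_Reals_iff not_le zero_complex.sel(1) less_irrefl)
  qed
  define f where "f z = Ln (q z)" for z
  have fhol: "f holomorphic_on ball z0 r1"
    unfolding f_def by (intro holomorphic_intros qhol) (use qpos in auto)
  have f0: "f z0 = 0" using z0 by (simp add: f_def q_def)
  have expf: "exp (f z) = q z" if "z \<in> ball z0 r1" for z using qpos[OF that] by (simp add: f_def)
  have nconst: "\<exists>n>0. (deriv ^^ n) f z0 \<noteq> 0"
  proof (rule ccontr)
    assume "\<not> ?thesis"
    then have zero: "(deriv ^^ n) f z0 = 0" if "0 < n" for n using that by blast
    have "f z = f z0" if "z \<in> ball z0 r1" for z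
      by (rule holomorphic_fun_eq_const_on_connected[OF fhol open_ball connected_ball zero])
         (use that r1(1) in simp_all)
    then have "q z = q z0" if "z \<in> ball z0 r1" for z using expf that r1(1) by (metis centre_in_ball)
    then have "root_prod X z = root_prod X z0" if "z \<in> ball z0 r1" for z using that z0 by (auto simp: q_def)
    then show False using not_constant_root_prod[OF X r1(1) z0] by blast
  qed
  define n where "n = (LEAST n. n > 0 \<and> (deriv ^^ n) f z0 \<noteq> 0)"
  have n: "n > 0" "(deriv ^^ n) f z0 \<noteq> 0"
    using LeastI_ex[of "\<lambda>n. n > 0 \<and> (deriv ^^ n) f z0 \<noteq> 0"] nconst by (auto simp: n_def)
  have nmin: "(deriv ^^ k) f z0 = 0" if "0 < k" "k < n" for k
    using not_less_Least[of k "\<lambda>n. n > 0 \<and> (deriv ^^ n) f z0 \<noteq> 0"] that by (auto simp: n_def)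
  obtain g r2 where g: "0 < r2" "g holomorphic_on ball z0 r2"
      "\<And>w. w \<in> ball z0 r2 \<Longrightarrow> f w - f z0 = ((w - z0) * g w) ^ n" "\<And>w. w \<in> ball z0 r2 \<Longrightarrow> g w \<noteq> 0"
    using holomorphic_factor_order_of_zero_strong[OF fhol open_ball _ n nmin] r1(1) by (metis centre_in_ball)
  define \<psi> where "\<psi> w = (w - z0) * g w" for w
  define r3 where "r3 = min r1 r2"
  have r3: "0 < r3" "ball z0 r3 \<subseteq> ball z0 r1" "ball z0 r3 \<subseteq> ball z0 r2" using r1 g by (auto simp: r3_def)
  have psihol: "\<psi> holomorphic_on ball z0 r3"
    unfolding \<psi>_def by (intro holomorphic_intros holomorphic_on_subset[OF g(2) r3(3)])
  have "(g has_field_derivative deriv g z0) (at z0)"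
    using holomorphic_derivI[OF g(2)] g(1) by simp
  then have "(\<psi> has_field_derivative g z0) (at z0)"
    unfolding \<psi>_def by (auto intro!: derivative_eq_intros)
  then have dpsi: "deriv \<psi> z0 = g z0" by (rule DERIV_imp_deriv)
  then have "deriv \<psi> z0 \<noteq> 0" using g by simp
  then obtain r4 where r4: "r4 > 0" "ball z0 r4 \<subseteq> ball z0 r3" "open (\<psi> ` ball z0 r4)" "inj_on \<psi> (ball z0 r4)"
    using has_complex_derivative_locally_invertible[OF psihol _ open_ball] r3(1) by (metis centre_in_ball)
  obtain G where G: "G holomorphic_on \<psi> ` ball z0 r4"
      "\<And>z. z \<in> ball z0 r4 \<Longrightarrow> deriv \<psi> z * deriv G (\<psi> z) = 1" "\<And>z. z \<in> ball z0 r4 \<Longrightarrow> G (\<psi> z) = z"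
    using holomorphic_has_inverse[OF holomorphic_on_subset[OF psihol r4(2)] open_ball r4(4)] by metis
  have psi0: "\<psi> z0 = 0" by (simp add: \<psi>_def)
  have "0 \<in> \<psi> ` ball z0 r4" using psi0 r4(1) by (metis centre_in_ball imageI)
  then obtain r5 where r5: "r5 > 0" "ball 0 r5 \<subseteq> \<psi> ` ball z0 r4" using r4(3) open_contains_ball by blast
  define \<gamma> where "\<gamma> = root n c"
  have \<gamma>: "\<gamma> > 0" "\<gamma> ^ n = c" using \<open>0 < c\<close> n(1) by (auto simp: \<gamma>_def)
  define r6 where "r6 = r5 / \<gamma>"
  have r6: "r6 > 0" using r5 \<gamma> by (simp add: r6_def)
  have in5: "of_real \<gamma> * s \<in> \<psi> ` ball z0 r4" if "s \<in> ball 0 r6" for s :: complex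
    using that \<gamma> r5(2) by (intro subsetD[OF r5(2)]) (simp add: r6_def norm_mult field_simps)
  define F where "F s = G (of_real \<gamma> * s)" for s
  have Fhol: "F holomorphic_on ball 0 r6"
    unfolding F_def
    by (intro holomorphic_on_compose_gen[OF _ G(1), unfolded o_def] holomorphic_intros) (use in5 in auto)
  have F0: "F 0 = z0" using G(3)[of z0] psi0 r4(1) by (simp add: F_def)
  have "deriv \<psi> z0 * deriv G 0 = 1" using G(2)[of z0] psi0 r4(1) by simp
  then have dG: "deriv G 0 \<noteq> 0" by auto
  have "(G has_field_derivative deriv G 0) (at 0)"
    by (rule holomorphic_derivI[OF G(1) r4(3)]) fact
  then have "(F has_field_derivative deriv G 0 * of_real \<gamma>) (at 0)"
    unfolding F_def by (intro DERIV_chain2[of G]) (auto intro!: derivative_eq_intros)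
  then have dF: "deriv F 0 = deriv G 0 * of_real \<gamma>" by (rule DERIV_imp_deriv)
  have level: "root_prod X (F s) = root_prod X z0 * exp (of_real c * s ^ n)" if s: "s \<in> ball 0 r6" for s
  proof -
    obtain z where z: "z \<in> ball z0 r4" "of_real \<gamma> * s = \<psi> z" using in5[OF s] by auto
    then have Fs: "F s = z" using G(3) by (simp add: F_def)
    have zin: "z \<in> ball z0 r1" "z \<in> ball z0 r2" using z(1) r4(2) r3(2,3) by blast+
    have "f z = (\<psi> z) ^ n" using g(3)[OF zin(2)] f0 by (simp add: \<psi>_def)
    also have "\<dots> = of_real c * s ^ n" unfolding z(2)[symmetric] using \<gamma>(2) by (simp add: power_mult_distrib flip: of_real_power)
    finally have "q z = exp (of_real c * s ^ n)" using expf[OF zin(1)] by simp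
    then show ?thesis using z0 Fs by (simp add: q_def field_simps)
  qed
  define r where "r = min 1 (r6 / 2)"
  have r: "0 < r" "r \<le> 1" "ball 0 r \<subseteq> ball 0 r6" "cball 0 r \<subseteq> ball 0 r6" using r6 by (auto simp: r_def)
  have d1: "deriv F holomorphic_on ball 0 r6" by (rule holomorphic_deriv[OF Fhol open_ball])
  have d2: "deriv (deriv F) holomorphic_on ball 0 r6" by (rule holomorphic_deriv[OF d1 open_ball])
  have "compact (deriv (deriv F) ` cball 0 r)"
    by (intro compact_continuous_image holomorphic_on_imp_continuous_on holomorphic_on_subset[OF d2 r(4)]) auto
  then obtain B where B: "0 < B" "\<And>s. s \<in> cball 0 r \<Longrightarrow> cmod (deriv (deriv F) s) \<le> B"
    using compact_imp_bounded bounded_pos by (metis imageI)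
  have taylor: "cmod (F s - z0 - deriv F 0 * s) \<le> B * (cmod s)\<^sup>2" if "s \<in> ball 0 r" for s
  proof -
    have "cmod ((deriv ^^ 0) F s - (\<Sum>i\<le>1. (deriv ^^ i) F 0 * (s - 0) ^ i / fact i)) \<le> B * cmod (s - 0) ^ (Suc 1) / fact 1"
    proof (rule complex_Taylor[where S = "cball 0 r"])
      fix i :: nat and x :: complex assume x: "x \<in> cball 0 r" and i: "i \<le> 1"
      have "(deriv ^^ i) F holomorphic_on ball 0 r6" by (rule holomorphic_higher_deriv[OF Fhol open_ball])
      then have "((deriv ^^ i) F has_field_derivative deriv ((deriv ^^ i) F) x) (at x)"
        by (rule holomorphic_derivI[OF _ open_ball subsetD[OF r(4) x]])
      then show "((deriv ^^ i) F has_field_derivative (deriv ^^ Suc i) F x) (at x within cball 0 r)"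
        by (auto intro: has_field_derivative_at_within)
    next
      fix x :: complex assume "x \<in> cball 0 r"
      then show "cmod ((deriv ^^ Suc 1) F x) \<le> B" using B(2) by simp
    qed (use that r in auto)
    then show ?thesis using F0 by (simp add: algebra_simps power2_eq_square)
  qed
  have "deriv F 0 \<noteq> 0" using dF dG \<gamma>(1) by simp
  from that[OF n(1) r(1,2) holomorphic_on_subset[OF Fhol r(3)] F0 this less_imp_le[OF B(1)]
      level[OF subsetD[OF r(3)]] taylor]
  show ?thesis .
qed

text \<open>Curves for different coordinates have different branching orders and are reparametrised by
  different powers \<open>\<zeta> ^ l\<close>. With \<open>k\<close> the least of these exponents, a coordinate with \<open>l > k\<close> contributes
  to the error term only.\<close>
lemma branched_level_curve_power:
  assumes "r \<le> 1" "0 \<le> C" "0 < k" "k \<le> l"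
    and taylor: "\<And>s. s \<in> ball 0 r \<Longrightarrow> cmod (F s - z0 - \<beta> * s) \<le> C * (cmod s)\<^sup>2"
    and \<zeta>: "\<zeta> \<in> ball 0 r"
  shows "cmod (F (\<zeta> ^ l) - z0 - (if l = k then \<beta> else 0) * \<zeta> ^ k) \<le> (C + cmod \<beta>) * cmod \<zeta> ^ Suc k"
proof -
  let ?t = "cmod \<zeta>"
  have t: "0 \<le> ?t" "?t \<le> 1" "?t < r" using \<zeta> assms(1) by auto
  have tl: "?t ^ l \<le> ?t" using power_decreasing[of 1 l ?t] t assms(3,4) by simp
  then have "\<zeta> ^ l \<in> ball 0 r" using t by (simp add: norm_power)
  from taylor[OF this] have T: "cmod (F (\<zeta> ^ l) - z0 - \<beta> * \<zeta> ^ l) \<le> C * (?t ^ l)\<^sup>2" by (simp add: norm_power)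
  have sq: "(?t ^ l)\<^sup>2 \<le> ?t ^ Suc k"
    unfolding power_mult[symmetric] using t assms(3,4) by (intro power_decreasing) auto
  show ?thesis
  proof (cases "l = k")
    case True
    have "cmod (F (\<zeta> ^ l) - z0 - \<beta> * \<zeta> ^ k) \<le> C * (?t ^ l)\<^sup>2" using T True by simp
    also have "\<dots> \<le> (C + cmod \<beta>) * ?t ^ Suc k" using sq assms(2) t by (intro mult_mono) auto
    finally show ?thesis using True by simp
  next
    case False
    have "F (\<zeta> ^ l) - z0 = (F (\<zeta> ^ l) - z0 - \<beta> * \<zeta> ^ l) + \<beta> * \<zeta> ^ l" by simp
    then have "cmod (F (\<zeta> ^ l) - z0) \<le> C * (?t ^ l)\<^sup>2 + cmod \<beta> * ?t ^ l"
      using T norm_triangle_ineq by (metis (no_types, lifting) add_right_mono norm_mult norm_power order.trans)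
    also have "\<dots> \<le> C * ?t ^ Suc k + cmod \<beta> * ?t ^ Suc k"
      using sq assms(2,4) False t by (intro add_mono mult_left_mono power_decreasing) auto
    finally show ?thesis using False by (simp add: algebra_simps)
  qed
qed

section \<open>The maximum principle on products of level curves\<close>

lemma norm_cvec_sq: "(norm (y :: complex^'n))\<^sup>2 = (\<Sum>i\<in>UNIV. (cmod (y $ i))\<^sup>2)"
  by (simp add: norm_vec_def L2_set_def sum_nonneg)

lemma norm_cvec_scale: "norm (s *s b) = cmod s * norm (b :: complex^'n)"
proof -
  have "(norm (s *s b))\<^sup>2 = (cmod s * norm b)\<^sup>2"
    by (simp add: norm_cvec_sq norm_mult power_mult_distrib sum_distrib_left)
  then show ?thesis by (rule power2_eq_imp_eq) auto
qed

lemma cmod_add_sq: "(cmod (a + b))\<^sup>2 = (cmod a)\<^sup>2 + 2 * Re (cnj a * b) + (cmod b)\<^sup>2"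
  unfolding cmod_power2 by (simp add: power2_eq_square algebra_simps)

text \<open>As \<open>h\<close> varies, these sets sweep out the set described at the top, foliated by analytic
  discs; \<open>c i\<close> is the speed at which the logarithm of the \<open>i\<close>-th polynomial grows with \<open>h\<close>. Coordinates
  that already lie in their lemniscate are frozen.\<close>
definition level_torus ::
  "'n set \<Rightarrow> ('n \<Rightarrow> complex set) \<Rightarrow> ('n \<Rightarrow> real) \<Rightarrow> ('n \<Rightarrow> real) \<Rightarrow> complex^'n \<Rightarrow> real \<Rightarrow> (complex^'n) set" where
  "level_torus I X \<rho> c a h =
    {z. (\<forall>i\<in>I. cmod (root_prod (X i) (z $ i)) = \<rho> i * exp (c i * h)) \<and> (\<forall>i. i \<notin> I \<longrightarrow> z $ i = a $ i)}"

text \<open>The conclusion of \<open>branched_level_curve\<close> as a predicate, so that one curve can be chosen for each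
  coordinate.\<close>
definition level_curve_at :: "complex set \<Rightarrow> complex \<Rightarrow> real \<Rightarrow> nat \<Rightarrow> real \<Rightarrow> (complex \<Rightarrow> complex) \<Rightarrow> complex \<Rightarrow> real \<Rightarrow> bool" where
  "level_curve_at X z0 c m r F \<beta> C \<longleftrightarrow> 0 < m \<and> 0 < r \<and> r \<le> 1 \<and> F holomorphic_on ball 0 r \<and> F 0 = z0 \<and> \<beta> \<noteq> 0 \<and> 0 \<le> C \<and>
    (\<forall>s\<in>ball 0 r. root_prod X (F s) = root_prod X z0 * exp (of_real c * s ^ m)) \<and>
    (\<forall>s\<in>ball 0 r. cmod (F s - z0 - \<beta> * s) \<le> C * (cmod s)\<^sup>2)"

lemma exists_level_curve:
  assumes "finite X" "X \<noteq> {}" "root_prod X z0 \<noteq> 0" "0 < c"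
  shows "\<exists>m r F \<beta> C. level_curve_at X z0 c m r F \<beta> C"
  using branched_level_curve[OF assms] unfolding level_curve_at_def by metis

text \<open>The \<open>i\<close>-th curve needs the parameter \<open>\<zeta> ^ l\<close> with \<open>l = K / m i\<close> for all logarithms to change by
  multiples of the same function \<open>\<zeta> ^ K\<close>; the product \<open>K\<close> of the branching orders \<open>m i\<close> serves them all.
  The disc is split into its lowest order part \<open>b \<zeta> ^ k\<close>, which moves along a complex line, and a
  remainder \<open>e\<close>: only the former will be seen by \<open>u\<close>.\<close>
lemma level_torus_disc:
  fixes X :: "'n::finite \<Rightarrow> complex set"
  assumes I: "I \<noteq> {}" and X: "\<And>i. i \<in> I \<Longrightarrow> finite (X i)" "\<And>i. i \<in> I \<Longrightarrow> X i \<noteq> {}"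
    and pos: "\<And>i. i \<in> I \<Longrightarrow> 0 < \<rho> i" "\<And>i. i \<in> I \<Longrightarrow> 0 < c i"
    and z: "z \<in> level_torus I X \<rho> c a h"
  obtains r K k b C e where "0 < r" "r \<le> 1" "0 < K" "0 < k" "b \<noteq> 0" "0 \<le> C"
    "\<And>i. e i holomorphic_on ball 0 r" "\<And>i. e i 0 = 0"
    "\<And>i \<zeta>. \<zeta> \<in> ball 0 r \<Longrightarrow> cmod (e i \<zeta>) \<le> C * cmod \<zeta> ^ Suc k"
    "\<And>\<zeta>. \<zeta> \<in> ball 0 r \<Longrightarrow> (\<chi> i. z $ i + b $ i * \<zeta> ^ k + e i \<zeta>) \<in> level_torus I X \<rho> c a (h + Re (\<zeta> ^ K))"
proof -
  have nz: "root_prod (X i) (z $ i) \<noteq> 0" if "i \<in> I" for i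
  proof -
    have "cmod (root_prod (X i) (z $ i)) = \<rho> i * exp (c i * h)" using z that by (simp add: level_torus_def)
    then show ?thesis using pos(1)[OF that] by (metis exp_gt_zero less_irrefl mult_pos_pos norm_zero)
  qed
  have "\<forall>i\<in>I. \<exists>m r F \<beta> C. level_curve_at (X i) (z $ i) (c i) m r F \<beta> C"
    by (intro ballI exists_level_curve X nz pos)
  then obtain m where "\<forall>i\<in>I. \<exists>r F \<beta> C. level_curve_at (X i) (z $ i) (c i) (m i) r F \<beta> C"
    by (rule bchoice[THEN exE])
  then obtain r where "\<forall>i\<in>I. \<exists>F \<beta> C. level_curve_at (X i) (z $ i) (c i) (m i) (r i) F \<beta> C"
    by (rule bchoice[THEN exE])
  then obtain F where "\<forall>i\<in>I. \<exists>\<beta> C. level_curve_at (X i) (z $ i) (c i) (m i) (r i) (F i) \<beta> C"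
    by (rule bchoice[THEN exE])
  then obtain \<beta> where "\<forall>i\<in>I. \<exists>C. level_curve_at (X i) (z $ i) (c i) (m i) (r i) (F i) (\<beta> i) C"
    by (rule bchoice[THEN exE])
  then obtain C where lc: "\<forall>i\<in>I. level_curve_at (X i) (z $ i) (c i) (m i) (r i) (F i) (\<beta> i) (C i)"
    by (rule bchoice[THEN exE])
  note lc' = lc[rule_format, unfolded level_curve_at_def]
  have m: "0 < m i" if "i \<in> I" for i using lc'[OF that] by simp
  have r: "0 < r i" "r i \<le> 1" if "i \<in> I" for i using lc'[OF that] by simp_all
  have Fh: "F i holomorphic_on ball 0 (r i)" if "i \<in> I" for i using lc'[OF that] by simp
  have F0: "F i 0 = z $ i" if "i \<in> I" for i using lc'[OF that] by simp
  have \<beta>: "\<beta> i \<noteq> 0" if "i \<in> I" for i using lc'[OF that] by simp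
  have C: "0 \<le> C i" if "i \<in> I" for i using lc'[OF that] by simp
  have lev: "root_prod (X i) (F i s) = root_prod (X i) (z $ i) * exp (of_real (c i) * s ^ m i)"
    if "i \<in> I" "s \<in> ball 0 (r i)" for i s using lc'[OF that(1)] that(2) by simp
  have tay: "cmod (F i s - z $ i - \<beta> i * s) \<le> C i * (cmod s)\<^sup>2"
    if "i \<in> I" "s \<in> ball 0 (r i)" for i s using lc'[OF that(1)] that(2) by simp
  define K where "K = (\<Prod>i\<in>I. m i)"
  define l where "l i = K div m i" for i
  have K: "0 < K" unfolding K_def using m by (intro prod_pos) auto
  have ml: "l i * m i = K" if "i \<in> I" for i
    unfolding l_def K_def using that by (intro dvd_div_mult_self dvd_prodI) auto
  have lpos: "0 < l i" if "i \<in> I" for i using ml[OF that] K by (metis gr0I mult_zero_left less_irrefl)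
  define k where "k = Min (l ` I)"
  have "k \<in> l ` I" unfolding k_def using I by (intro Min_in) auto
  then obtain i0 where i0: "i0 \<in> I" "l i0 = k" by auto
  have k: "0 < k" using lpos i0 by auto
  have kl: "k \<le> l i" if "i \<in> I" for i unfolding k_def using that by (intro Min_le) auto
  define r0 where "r0 = Min (r ` I)"
  have "r0 \<in> r ` I" unfolding r0_def using I by (intro Min_in) auto
  then have r0: "0 < r0" "r0 \<le> 1" using r by auto
  have r0i: "r0 \<le> r i" if "i \<in> I" for i unfolding r0_def using that by (intro Min_le) auto
  define C0 where "C0 = (\<Sum>i\<in>I. C i + cmod (\<beta> i))"
  have C0: "C i + cmod (\<beta> i) \<le> C0" if "i \<in> I" for i
    unfolding C0_def using that C by (intro member_le_sum) auto
  have C0n: "0 \<le> C0" unfolding C0_def using C by (intro sum_nonneg) auto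
  define b :: "complex^'n" where "b = (\<chi> i. if i \<in> I \<and> l i = k then \<beta> i else 0)"
  have "b $ i0 \<noteq> 0" using i0 \<beta> by (simp add: b_def)
  then have b: "b \<noteq> 0" by auto
  define e where "e i \<zeta> = (if i \<in> I then F i (\<zeta> ^ l i) - z $ i - (if l i = k then \<beta> i else 0) * \<zeta> ^ k else 0)" for i \<zeta>
  have pw: "\<zeta> ^ l i \<in> ball 0 (r i)" if "i \<in> I" "\<zeta> \<in> ball 0 r0" for i and \<zeta> :: complex
  proof -
    have "cmod \<zeta> ^ l i \<le> cmod \<zeta> ^ 1" using that r0 lpos[OF that(1)] by (intro power_decreasing) auto
    then show ?thesis using that r0i[OF that(1)] by (simp add: norm_power)
  qed
  have eh: "e i holomorphic_on ball 0 r0" for i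
  proof (cases "i \<in> I")
    case True
    have "(\<lambda>\<zeta>. F i (\<zeta> ^ l i)) holomorphic_on ball 0 r0"
      by (intro holomorphic_on_compose_gen[OF _ Fh[OF True], unfolded o_def] holomorphic_intros) (use pw True in auto)
    then have "(\<lambda>\<zeta>. F i (\<zeta> ^ l i) - z $ i - (if l i = k then \<beta> i else 0) * \<zeta> ^ k) holomorphic_on ball 0 r0"
      by (intro holomorphic_intros)
    moreover have "e i = (\<lambda>\<zeta>. F i (\<zeta> ^ l i) - z $ i - (if l i = k then \<beta> i else 0) * \<zeta> ^ k)"
      using True by (simp add: e_def[abs_def])
    ultimately show ?thesis by simp
  next
    case False
    then show ?thesis by (simp add: e_def[abs_def])
  qed
  have e0: "e i 0 = 0" for i using F0 lpos k by (simp add: e_def zero_power)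
  have eb: "cmod (e i \<zeta>) \<le> C0 * cmod \<zeta> ^ Suc k" if "\<zeta> \<in> ball 0 r0" for i and \<zeta> :: complex
  proof (cases "i \<in> I")
    case True
    have "\<zeta> \<in> ball 0 (r i)" using that r0i[OF True] by auto
    from branched_level_curve_power[OF r(2)[OF True] C[OF True] k kl[OF True] tay[OF True] this]
    have "cmod (e i \<zeta>) \<le> (C i + cmod (\<beta> i)) * cmod \<zeta> ^ Suc k" using True by (simp add: e_def)
    also have "\<dots> \<le> C0 * cmod \<zeta> ^ Suc k" using C0[OF True] by (intro mult_right_mono) auto
    finally show ?thesis .
  next
    case False
    then show ?thesis using C0n by (simp add: e_def)
  qed
  have disc: "(\<chi> i. z $ i + b $ i * \<zeta> ^ k + e i \<zeta>) \<in> level_torus I X \<rho> c a (h + Re (\<zeta> ^ K))" if \<zeta>: "\<zeta> \<in> ball 0 r0" for \<zeta>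
    unfolding level_torus_def
  proof (safe)
    fix i assume i: "i \<in> I"
    have f: "(\<chi> i. z $ i + b $ i * \<zeta> ^ k + e i \<zeta>) $ i = F i (\<zeta> ^ l i)" using i by (simp add: e_def b_def)
    have "cmod (root_prod (X i) (F i (\<zeta> ^ l i))) = cmod (root_prod (X i) (z $ i)) * exp (Re (of_real (c i) * (\<zeta> ^ l i) ^ m i))"
      unfolding lev[OF i pw[OF i \<zeta>]] norm_mult by simp
    also have "cmod (root_prod (X i) (z $ i)) = \<rho> i * exp (c i * h)" using z i by (simp add: level_torus_def)
    also have "(\<zeta> ^ l i) ^ m i = \<zeta> ^ K" using ml[OF i] by (simp flip: power_mult)
    finally show "cmod (root_prod (X i) ((\<chi> i. z $ i + b $ i * \<zeta> ^ k + e i \<zeta>) $ i)) = \<rho> i * exp (c i * (h + Re (\<zeta> ^ K)))"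
      unfolding f by (simp add: distrib_left exp_add)
  next
    fix i assume i: "i \<notin> I"
    then show "(\<chi> i. z $ i + b $ i * \<zeta> ^ k + e i \<zeta>) $ i = a $ i" using z by (simp add: e_def b_def level_torus_def)
  qed
  show ?thesis using that[OF r0 K k b C0n eh e0 eb disc] .
qed

text \<open>Suppose \<open>u y + \<delta> |y|\<^sup>2 - N |y - z|\<^sup>2 - A h\<close> had a maximum with \<open>0 < h < R\<close>. Move \<open>z\<close> along the analytic
  disc \<open>z + b \<zeta> ^ k + e \<zeta>\<close> and \<open>y\<close> along the complex line \<open>y + b \<zeta> ^ k\<close>, on which \<open>u\<close> is subharmonic. The
  difference \<open>y - z\<close> changes by the holomorphic remainder \<open>- e \<zeta>\<close> only, so up to real parts of holomorphic
  functions \<open>N |y - z|\<^sup>2\<close> changes by \<open>O(|\<zeta>| ^ (2 k + 2))\<close>, whereas \<open>\<delta> |y|\<^sup>2\<close> gains \<open>\<delta> |b|\<^sup>2 |\<zeta>| ^ (2 k)\<close>.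
  This contradicts \<open>subharmonic_no_strict_peak\<close> on a small circle.\<close>
lemma level_torus_no_interior_max:
  fixes u :: "complex^'n::finite \<Rightarrow> ereal"
  assumes u: "plurisubharmonic u"
    and I: "I \<noteq> {}" and X: "\<And>i. i \<in> I \<Longrightarrow> finite (X i)" "\<And>i. i \<in> I \<Longrightarrow> X i \<noteq> {}"
    and pos: "\<And>i. i \<in> I \<Longrightarrow> 0 < \<rho> i" "\<And>i. i \<in> I \<Longrightarrow> 0 < c i"
    and z: "z \<in> level_torus I X \<rho> c a h" and h: "0 < h" "h < R"
    and fin: "u y = ereal x" and par: "0 < \<delta>" "0 \<le> N" "0 < \<eta>"
    and max: "\<And>y' z' h'. dist y' y < \<eta> \<Longrightarrow> 0 \<le> h' \<Longrightarrow> h' \<le> R \<Longrightarrow> z' \<in> level_torus I X \<rho> c a h' \<Longrightarrow>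
      u y' + ereal (\<delta> * (norm y')\<^sup>2 - N * (norm (y' - z'))\<^sup>2 - A * h')
      \<le> ereal (x + \<delta> * (norm y)\<^sup>2 - N * (norm (y - z))\<^sup>2 - A * h)"
  shows False
proof -
  obtain r K k b C e where r: "0 < r" "r \<le> 1" and Kk: "0 < K" "0 < k" and b: "b \<noteq> 0" and C: "0 \<le> C"
    and e: "\<And>i. e i holomorphic_on ball 0 r" "\<And>i. e i 0 = 0"
    "\<And>i \<zeta>. \<zeta> \<in> ball 0 r \<Longrightarrow> cmod (e i \<zeta>) \<le> C * cmod \<zeta> ^ Suc k"
    and disc: "\<And>\<zeta>. \<zeta> \<in> ball 0 r \<Longrightarrow> (\<chi> i. z $ i + b $ i * \<zeta> ^ k + e i \<zeta>) \<in> level_torus I X \<rho> c a (h + Re (\<zeta> ^ K))"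
    by (rule level_torus_disc[OF I X pos z]) (assumption | rule that)+
  define H where "H \<zeta> = - 2 * of_real \<delta> * (\<Sum>i\<in>UNIV. cnj (y $ i) * (b $ i * \<zeta> ^ k))
     - 2 * of_real N * (\<Sum>i\<in>UNIV. cnj (y $ i - z $ i) * e i \<zeta>) + of_real A * \<zeta> ^ K" for \<zeta>
  have Hh: "H holomorphic_on ball 0 r"
    unfolding H_def by (intro holomorphic_intros e(1))
  have H0: "H 0 = 0" using Kk e(2) by (simp add: H_def zero_power)
  define n where "n = real CARD('n)"
  define D where "D = N * n * C\<^sup>2"
  have D: "0 \<le> D" using par by (simp add: D_def n_def)
  have nb: "0 < norm b" using b by simp
  \<comment> \<open>The radius keeps \<open>\<zeta>\<close> in the disc, \<open>h\<close> between 0 and \<open>R\<close>, the moved \<open>y\<close> near \<open>y\<close>, and the gain positive.\<close>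
  define t0 where "t0 = Min {r, h, R - h, \<eta> / norm b, \<delta> * (norm b)\<^sup>2 / (D + 1)}"
  have "0 < t0" unfolding t0_def using r h par nb D by (subst Min_gr_iff) auto
  then obtain t where t: "0 < t" "t < t0" using dense by blast
  have "t < r" "t < h" "t < R - h" and tb: "t < \<eta> / norm b" and td: "t < \<delta> * (norm b)\<^sup>2 / (D + 1)"
    using t(2) unfolding t0_def by (subst (asm) Min_gr_iff; simp)+
  have t1: "t < 1" using \<open>t < r\<close> r by simp
  define g where "g = \<delta> * (norm b)\<^sup>2 * t ^ (2 * k) - D * t ^ (2 * Suc k)"
  have "g \<le> 0"
  proof (rule subharmonic_no_strict_peak[where U = "\<lambda>s. u (y + s *s b)" and a = 0 and b = 1 and k = k and H = H and R = r and r = t])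
    show "subharmonic (\<lambda>s. u (y + s *s b))" using u by (simp add: plurisubharmonic_def)
    show "u (y + 0 *s b) \<noteq> -\<infinity>" using fin by simp
    fix \<zeta> :: complex assume \<zeta>: "cmod \<zeta> = t"
    define y' where "y' = y + \<zeta> ^ k *s b"
    define z' where "z' = (\<chi> i. z $ i + b $ i * \<zeta> ^ k + e i \<zeta>)"
    define h' where "h' = h + Re (\<zeta> ^ K)"
    have in_r: "\<zeta> \<in> ball 0 r" using \<zeta> \<open>t < r\<close> by simp
    have tk: "t ^ j \<le> t" if "0 < j" for j using power_decreasing[of 1 j t] t(1) t1 that by simp
    have "\<bar>Re (\<zeta> ^ K)\<bar> \<le> t"
      using abs_Re_le_cmod[of "\<zeta> ^ K"] tk[OF Kk(1)] \<zeta> by (simp add: norm_power)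
    then have h': "0 \<le> h'" "h' \<le> R" using \<open>t < h\<close> \<open>t < R - h\<close> by (auto simp: h'_def)
    have "dist y' y = t ^ k * norm b"
      using \<zeta> by (simp add: y'_def dist_norm norm_cvec_scale norm_power)
    also have "\<dots> \<le> t * norm b" using tk[OF Kk(2)] by (intro mult_right_mono) auto
    also have "\<dots> < \<eta>" using tb nb by (simp add: pos_less_divide_eq)
    finally have "dist y' y < \<eta>" .
    note mx = max[OF this h', of z'] 
    have zt: "z' \<in> level_torus I X \<rho> c a h'" using disc[OF in_r] by (simp add: z'_def h'_def)
    have n1: "(norm y')\<^sup>2 = (norm y)\<^sup>2 + 2 * Re (\<Sum>i\<in>UNIV. cnj (y $ i) * (b $ i * \<zeta> ^ k)) + (norm b)\<^sup>2 * t ^ (2 * k)"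
    proof -
      have "(cmod (y' $ i))\<^sup>2 = (cmod (y $ i))\<^sup>2 + 2 * Re (cnj (y $ i) * (b $ i * \<zeta> ^ k)) + (cmod (b $ i))\<^sup>2 * t ^ (2 * k)" for i
      proof -
        have "y' $ i = y $ i + b $ i * \<zeta> ^ k" by (simp add: y'_def mult.commute)
        moreover have "(cmod (b $ i * \<zeta> ^ k))\<^sup>2 = (cmod (b $ i))\<^sup>2 * t ^ (2 * k)"
          using \<zeta> by (simp add: norm_mult norm_power power_mult_distrib power_even_eq)
        ultimately show ?thesis by (simp only: cmod_add_sq)
      qed
      then show ?thesis by (simp only: norm_cvec_sq sum.distrib Re_sum sum_distrib_left sum_distrib_right)
    qed
    have n2: "(norm (y' - z'))\<^sup>2 \<le> (norm (y - z))\<^sup>2 - 2 * Re (\<Sum>i\<in>UNIV. cnj (y $ i - z $ i) * e i \<zeta>) + n * C\<^sup>2 * t ^ (2 * Suc k)"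
    proof -
      have key: "(cmod ((y' - z') $ i))\<^sup>2 \<le> (cmod ((y - z) $ i))\<^sup>2 + (- 2) * Re (cnj (y $ i - z $ i) * e i \<zeta>) + C\<^sup>2 * t ^ (2 * Suc k)" for i
      proof -
        have "(y' - z') $ i = (y $ i - z $ i) + (- e i \<zeta>)" by (simp add: y'_def z'_def mult.commute)
        then have "(cmod ((y' - z') $ i))\<^sup>2 = (cmod (y $ i - z $ i))\<^sup>2 + 2 * Re (cnj (y $ i - z $ i) * (- e i \<zeta>)) + (cmod (- e i \<zeta>))\<^sup>2"
          by (simp only: cmod_add_sq)
        moreover have "(cmod (- e i \<zeta>))\<^sup>2 \<le> (C * t ^ Suc k)\<^sup>2"
          using e(3)[OF in_r, of i] \<zeta> by (intro power_mono) auto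
        moreover have "(C * t ^ Suc k)\<^sup>2 = C\<^sup>2 * t ^ (2 * Suc k)" by (simp only: power_mult_distrib power_even_eq)
        ultimately show ?thesis by simp
      qed
      have "(norm (y' - z'))\<^sup>2 \<le> (\<Sum>i\<in>UNIV. (cmod ((y - z) $ i))\<^sup>2 + (- 2) * Re (cnj (y $ i - z $ i) * e i \<zeta>) + C\<^sup>2 * t ^ (2 * Suc k))"
        unfolding norm_cvec_sq by (rule sum_mono) (rule key)
      also have "\<dots> = (\<Sum>i\<in>UNIV. (cmod ((y - z) $ i))\<^sup>2) + (- 2) * (\<Sum>i\<in>UNIV. Re (cnj (y $ i - z $ i) * e i \<zeta>)) + real CARD('n) * (C\<^sup>2 * t ^ (2 * Suc k))"
        by (simp only: sum.distrib sum_distrib_left sum_constant)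
      finally show ?thesis by (simp only: norm_cvec_sq Re_sum n_def mult.assoc)
    qed
    have Hre: "Re (H \<zeta>) = - 2 * \<delta> * Re (\<Sum>i\<in>UNIV. cnj (y $ i) * (b $ i * \<zeta> ^ k))
       - 2 * N * Re (\<Sum>i\<in>UNIV. cnj (y $ i - z $ i) * e i \<zeta>) + A * Re (\<zeta> ^ K)"
      unfolding H_def by (simp add: mult.assoc del: Re_sum)
    have "u y' \<le> ereal (x + Re (H \<zeta>) - g)"
    proof (cases "u y'")
      case (real x')
      have "x' + \<delta> * (norm y')\<^sup>2 - N * (norm (y' - z'))\<^sup>2 - A * h' \<le> x + \<delta> * (norm y)\<^sup>2 - N * (norm (y - z))\<^sup>2 - A * h"
        using mx[OF zt] real by simp
      moreover have "N * (norm (y' - z'))\<^sup>2 \<le> N * ((norm (y - z))\<^sup>2 - 2 * Re (\<Sum>i\<in>UNIV. cnj (y $ i - z $ i) * e i \<zeta>) + n * C\<^sup>2 * t ^ (2 * Suc k))"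
        using n2 par(2) by (rule mult_left_mono)
      ultimately have "x' \<le> x + Re (H \<zeta>) - g"
        unfolding Hre g_def n1 h'_def D_def by (simp only: algebra_simps)
      then show ?thesis using real by simp
    next
      case PInf
      then show ?thesis using u unfolding plurisubharmonic_def by (metis less_irrefl)
    qed simp
    then show "u (y + (0 + 1 * \<zeta> ^ k) *s b) \<le> u (y + 0 *s b) + ereal (Re (H \<zeta>) - g)"
      using fin by (simp add: y'_def algebra_simps)
  qed (use Kk Hh H0 t(1) \<open>t < r\<close> in auto)
  moreover have "0 < g"
  proof -
    have "t * (D + 1) < \<delta> * (norm b)\<^sup>2" using td D by (simp add: pos_less_divide_eq)
    moreover have "t * t * D \<le> 1 * t * D" using t(1) t1 D by (intro mult_right_mono) auto
    ultimately have "D * (t * t) < \<delta> * (norm b)\<^sup>2" using t(1) by (simp add: algebra_simps)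
    then have "0 < (\<delta> * (norm b)\<^sup>2 - D * (t * t)) * t ^ (2 * k)" using t(1) by simp
    also have "\<dots> = g" by (simp add: g_def algebra_simps)
    finally show ?thesis .
  qed
  ultimately show False by simp
qed

lemma root_prod_bounded_preimage:
  assumes "finite X" "X \<noteq> {}"
  obtains b where "\<And>z. cmod (root_prod X z) \<le> M \<Longrightarrow> cmod z \<le> b"
proof -
  obtain r where r: "\<And>x. x \<in> X \<Longrightarrow> cmod x \<le> r"
    using finite_imp_bounded[OF assms(1)] bounded_iff by metis
  have "cmod z \<le> r + 1 + \<bar>M\<bar>" if "cmod (root_prod X z) \<le> M" for z
  proof (rule ccontr)
    assume "\<not> ?thesis"
    then have far: "1 + \<bar>M\<bar> \<le> cmod (z - x)" if "x \<in> X" for x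
      using norm_triangle_ineq2[of z x] r[OF that] by simp
    have "(\<Prod>x\<in>X. 1 + \<bar>M\<bar>) \<le> cmod (root_prod X z)"
      unfolding norm_root_prod using far by (intro prod_mono) auto
    moreover have "1 + \<bar>M\<bar> \<le> (1 + \<bar>M\<bar>) ^ card X"
      using assms by (intro self_le_power) (auto simp: card_gt_0_iff)
    ultimately show False using that by simp
  qed
  then show ?thesis using that by blast
qed

lemma norm_cvec_le: "norm (z :: complex^'n) \<le> (\<Sum>i\<in>UNIV. cmod (z $ i))"
  unfolding norm_vec_def by (rule L2_set_le_sum) simp

lemma compact_level_tori:
  fixes X :: "'n::finite \<Rightarrow> complex set"
  assumes X: "\<And>i. i \<in> I \<Longrightarrow> finite (X i)" "\<And>i. i \<in> I \<Longrightarrow> X i \<noteq> {}"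
    and pos: "\<And>i. i \<in> I \<Longrightarrow> 0 < \<rho> i" "\<And>i. i \<in> I \<Longrightarrow> 0 < c i"
  shows "compact {p. s \<le> snd p \<and> snd p \<le> R \<and> fst p \<in> level_torus I X \<rho> c a (snd p)}"
    (is "compact ?S")
proof -
  have "?S = {p. s \<le> snd p} \<inter> {p. snd p \<le> R} \<inter>
      ((\<Inter>i\<in>I. {p. cmod (root_prod (X i) (fst p $ i)) = \<rho> i * exp (c i * snd p)}) \<inter> (\<Inter>i\<in>-I. {p. fst p $ i = a $ i}))"
    by (auto simp: level_torus_def)
  also have "closed \<dots>"
    by (intro closed_Int closed_INT ballI closed_Collect_le closed_Collect_eq continuous_intros)
  finally have "closed ?S" .
  moreover have "bounded ?S"
  proof -
    have "\<forall>i\<in>I. \<exists>b. \<forall>z. cmod (root_prod (X i) z) \<le> \<rho> i * exp (c i * R) \<longrightarrow> cmod z \<le> b"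
      using root_prod_bounded_preimage X by metis
    then obtain b where b: "\<And>i z. i \<in> I \<Longrightarrow> cmod (root_prod (X i) z) \<le> \<rho> i * exp (c i * R) \<Longrightarrow> cmod z \<le> b i"
      by metis
    define B where "B = (\<Sum>i\<in>UNIV. if i \<in> I then b i else cmod (a $ i))"
    have "norm p \<le> B + (\<bar>s\<bar> + \<bar>R\<bar>)" if "p \<in> ?S" for p
    proof -
      have "cmod (fst p $ i) \<le> (if i \<in> I then b i else cmod (a $ i))" for i
      proof (cases "i \<in> I")
        case True
        have "cmod (root_prod (X i) (fst p $ i)) = \<rho> i * exp (c i * snd p)" using that True by (auto simp: level_torus_def)
        also have "\<dots> \<le> \<rho> i * exp (c i * R)" using that pos[OF True] by (auto intro!: mult_left_mono)
        finally show ?thesis using b[OF True] True by simp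
      next
        case False
        then show ?thesis using that by (auto simp: level_torus_def)
      qed
      then have "norm (fst p) \<le> B" unfolding B_def by (intro order.trans[OF norm_cvec_le] sum_mono) auto
      moreover have "norm p \<le> norm (fst p) + norm (snd p)" using norm_Pair_le[of "fst p" "snd p"] by simp
      moreover have "norm (snd p) \<le> \<bar>s\<bar> + \<bar>R\<bar>" using that by auto
      ultimately show ?thesis by linarith
    qed
    then show ?thesis unfolding bounded_iff by blast
  qed
  ultimately show ?thesis by (simp add: compact_eq_bounded_closed)
qed

text \<open>Doubling of variables: a restriction of \<open>u\<close> to a curved disc is not controlled by the hypothesis,
  so the point \<open>y\<close> where \<open>u\<close> is evaluated and the point \<open>z\<close> of the set are varied independently, and
  \<open>N |y - z|\<^sup>2\<close> penalises their distance. The small term \<open>\<delta> |y|\<^sup>2\<close> makes \<open>u\<close> strictly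
  plurisubharmonic. Near the two boundary sets the required bound holds by semicontinuity and
  compactness, so for large \<open>N\<close> a violation would produce a maximum with \<open>0 < h < R\<close>.\<close>
theorem level_torus_max_principle:
  fixes u :: "complex^'n::finite \<Rightarrow> ereal"
  assumes u: "plurisubharmonic u"
    and I: "I \<noteq> {}" and X: "\<And>i. i \<in> I \<Longrightarrow> finite (X i)" "\<And>i. i \<in> I \<Longrightarrow> X i \<noteq> {}"
    and pos: "\<And>i. i \<in> I \<Longrightarrow> 0 < \<rho> i" "\<And>i. i \<in> I \<Longrightarrow> 0 < c i"
    and "0 < R"
    and b0: "\<And>z. z \<in> level_torus I X \<rho> c a 0 \<Longrightarrow> u z < ereal m"
    and bR: "\<And>z. z \<in> level_torus I X \<rho> c a R \<Longrightarrow> u z < ereal (m + A * R)"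
    and z1: "z1 \<in> level_torus I X \<rho> c a h1" "0 \<le> h1" "h1 \<le> R"
  shows "u z1 \<le> ereal (m + A * h1)"
proof (rule ccontr)
  have usc: "upper_semicontinuous u" and fin: "\<And>z. u z < \<infinity>" using u by (auto simp: plurisubharmonic_def)
  assume "\<not> ?thesis"
  then obtain q where q: "m + A * h1 < q" "ereal q < u z1"
    using ereal_dense2[of "ereal (m + A * h1)" "u z1"] by (auto simp: not_le)
  define gap where "gap = q - (m + A * h1)"
  have gap: "0 < gap" using q by (simp add: gap_def)
  define Y where "Y = {p. 0 \<le> snd p \<and> snd p \<le> R \<and> fst p \<in> level_torus I X \<rho> c a (snd p)}"
  have cY: "compact Y" unfolding Y_def by (rule compact_level_tori[OF X pos])
  have ctorus: "compact (level_torus I X \<rho> c a h)" for h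
  proof -
    have "level_torus I X \<rho> c a h = fst ` {p. h \<le> snd p \<and> snd p \<le> h \<and> fst p \<in> level_torus I X \<rho> c a (snd p)}"
      by (force simp: image_iff)
    then show ?thesis
      using compact_continuous_image[OF continuous_on_fst[OF continuous_on_id] compact_level_tori[OF X pos]] by simp
  qed
  obtain r0 where r0: "0 < r0" "\<And>p. p \<in> Y \<Longrightarrow> norm p \<le> r0"
    using compact_imp_bounded[OF cY] bounded_pos by metis
  have nY: "norm z \<le> r0" if "z \<in> level_torus I X \<rho> c a h" "0 \<le> h" "h \<le> R" for z h
    using r0(2)[of "(z, h)"] norm_fst_le[of z h] that by (simp add: Y_def)
  \<comment> \<open>Half of the gap pays for the term \<open>\<delta> |y|\<^sup>2\<close>, hence the new level \<open>m1\<close>.\<close>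
  define \<delta> where "\<delta> = gap / (2 * r0\<^sup>2)"
  have \<delta>: "0 < \<delta>" "\<delta> * r0\<^sup>2 = gap / 2" using gap r0(1) by (auto simp: \<delta>_def)
  define m1 where "m1 = m + gap / 2"
  define w where "w y = u y + ereal (\<delta> * (norm y)\<^sup>2)" for y
  have wusc: "upper_semicontinuous w"
    unfolding w_def by (intro usc_add usc usc_continuous continuous_intros fin) auto
  have wfin: "w y < \<infinity>" for y using fin[of y] by (simp add: w_def)
  have wbd: "w z < ereal (e + gap / 2)" if "z \<in> level_torus I X \<rho> c a h" "0 \<le> h" "h \<le> R" "u z < ereal e" for z h e
  proof -
    have "\<delta> * (norm z)\<^sup>2 \<le> \<delta> * r0\<^sup>2" using nY[OF that(1-3)] \<delta>(1) by (intro mult_left_mono power_mono) auto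
    then show ?thesis using that(4) \<delta>(2) by (cases "u z") (auto simp: w_def)
  qed
  obtain e0 where e0: "e0 > 0" "(\<Union>z\<in>level_torus I X \<rho> c a 0. ball z e0) \<subseteq> {y. w y < ereal m1}"
  proof (rule compact_subset_open_imp_ball_epsilon_subset[OF ctorus[of 0]])
    show "open {y. w y < ereal m1}" using wusc by (simp add: upper_semicontinuous_def)
    show "level_torus I X \<rho> c a 0 \<subseteq> {y. w y < ereal m1}"
      using wbd[of _ 0 m] b0 \<open>0 < R\<close> by (auto simp: m1_def)
  qed
  obtain eR where eR: "eR > 0" "(\<Union>z\<in>level_torus I X \<rho> c a R. ball z eR) \<subseteq> {y. w y < ereal (m1 + A * R)}"
  proof (rule compact_subset_open_imp_ball_epsilon_subset[OF ctorus[of R]])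
    show "open {y. w y < ereal (m1 + A * R)}" using wusc by (simp add: upper_semicontinuous_def)
    show "level_torus I X \<rho> c a R \<subseteq> {y. w y < ereal (m1 + A * R)}"
      using wbd[of _ R "m + A * R"] bR \<open>0 < R\<close> by (auto simp: m1_def algebra_simps)
  qed
  define \<eta> where "\<eta> = min 1 (min e0 eR)"
  have \<eta>: "0 < \<eta>" "\<eta> \<le> 1" "\<eta> \<le> e0" "\<eta> \<le> eR" using e0(1) eR(1) by (auto simp: \<eta>_def)
  define B where "B = cball (0 :: complex^'n) (r0 + 1)"
  have "B \<noteq> {}" using r0(1) by (simp add: B_def)
  then obtain y0 where y0: "\<And>y. y \<in> B \<Longrightarrow> w y \<le> w y0"
    using usc_attains_sup[OF wusc, of B] by (auto simp: B_def)
  obtain W where W: "w y0 < ereal W" using ereal_dense2[OF wfin[of y0]] by auto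
  \<comment> \<open>At distance \<open>\<eta>\<close> or more the penalty pushes \<open>w - A h\<close> below \<open>m1\<close>.\<close>
  define N where "N = max 0 ((W + \<bar>A\<bar> * R - m1) / \<eta>\<^sup>2)"
  have N: "0 \<le> N" "W + \<bar>A\<bar> * R - m1 \<le> N * \<eta>\<^sup>2"
  proof -
    show "0 \<le> N" by (simp add: N_def)
    have "(W + \<bar>A\<bar> * R - m1) / \<eta>\<^sup>2 * \<eta>\<^sup>2 \<le> N * \<eta>\<^sup>2" unfolding N_def by (intro mult_right_mono) auto
    then show "W + \<bar>A\<bar> * R - m1 \<le> N * \<eta>\<^sup>2" using \<eta>(1) by simp
  qed
  define \<Phi> where "\<Phi> p = u (fst p) + ereal (\<delta> * (norm (fst p))\<^sup>2 - N * (norm (fst p - fst (snd p)))\<^sup>2 - A * snd (snd p))"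
    for p :: "(complex^'n) \<times> (complex^'n) \<times> real"
  have \<Phi>usc: "upper_semicontinuous \<Phi>"
    unfolding \<Phi>_def by (intro usc_add usc_compose[OF usc] usc_continuous continuous_intros fin) auto
  have p1: "(z1, z1, h1) \<in> B \<times> Y" using nY[OF z1] z1 by (auto simp: B_def Y_def)
  have "compact (B \<times> Y)" using cY by (intro compact_Times) (auto simp: B_def)
  then obtain p where p: "p \<in> B \<times> Y" "\<And>p'. p' \<in> B \<times> Y \<Longrightarrow> \<Phi> p' \<le> \<Phi> p"
    using usc_attains_sup[OF \<Phi>usc] p1 by (metis empty_iff)
  obtain y z h where pe: "p = (y, z, h)" by (metis surj_pair)
  have yB: "y \<in> B" and zY: "z \<in> level_torus I X \<rho> c a h" "0 \<le> h" "h \<le> R" using p(1) by (auto simp: pe Y_def)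
  have "ereal m1 < \<Phi> (z1, z1, h1)"
  proof -
    have "m1 + A * h1 < q" using q(1) unfolding m1_def gap_def by (simp add: field_simps)
    then have "ereal (m1 + A * h1) < u z1" using q(2) by (meson ereal_less_le less_imp_le order_le_less_trans ereal_less_eq(3))
    moreover have "0 \<le> \<delta> * (norm z1)\<^sup>2" using \<delta> by simp
    ultimately show ?thesis using fin[of z1] by (cases "u z1") (auto simp: \<Phi>_def)
  qed
  also have "\<dots> \<le> \<Phi> p" by (rule p(2)[OF p1])
  finally have big: "ereal m1 < \<Phi> p" .
  then obtain x where x: "u y = ereal x" using fin[of y] by (cases "u y") (auto simp: \<Phi>_def pe)
  have big': "m1 < x + \<delta> * (norm y)\<^sup>2 - N * (norm (y - z))\<^sup>2 - A * h"
    using big by (simp add: \<Phi>_def pe x algebra_simps)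
  have wy: "w y = ereal (x + \<delta> * (norm y)\<^sup>2)" by (simp add: w_def x)
  have near: "dist z y < \<eta>"
  proof (rule ccontr)
    assume "\<not> ?thesis"
    then have "\<eta>\<^sup>2 \<le> (norm (y - z))\<^sup>2" using \<eta>(1) by (intro power_mono) (auto simp: dist_norm norm_minus_commute)
    then have "N * \<eta>\<^sup>2 \<le> N * (norm (y - z))\<^sup>2" using N(1) by (rule mult_left_mono)
    moreover have "x + \<delta> * (norm y)\<^sup>2 < W" using y0[OF yB] W wy by (metis ereal_less_eq(3) less_ereal.simps(1) order_le_less_trans)
    moreover have "- A * h \<le> \<bar>A\<bar> * R" using zY(2,3) by (intro mult_mono) auto
    ultimately show False using big' N(2) by simp
  qed
  have Npos: "0 \<le> N * (norm (y - z))\<^sup>2" using N(1) by simp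
  have "h \<noteq> 0"
  proof
    assume "h = 0"
    have "y \<in> ball z e0" using near \<eta>(3) by simp
    then have "w y < ereal m1" using e0(2) zY(1) \<open>h = 0\<close> by blast
    then show False using big' Npos \<open>h = 0\<close> by (simp add: wy)
  qed
  moreover have "h \<noteq> R"
  proof
    assume "h = R"
    have "y \<in> ball z eR" using near \<eta>(4) by simp
    then have "w y < ereal (m1 + A * R)" using eR(2) zY(1) \<open>h = R\<close> by blast
    then show False using big' Npos \<open>h = R\<close> by (simp add: wy)
  qed
  ultimately have h: "0 < h" "h < R" using zY by auto
  define \<eta>' where "\<eta>' = 1 - norm (y - z)"
  have "0 < \<eta>'" using near \<eta>(2) by (simp add: \<eta>'_def dist_norm norm_minus_commute)
  show False
  proof (rule level_torus_no_interior_max[OF u I X pos zY(1) h x \<delta>(1) N(1) \<open>0 < \<eta>'\<close>, where A = A])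
    fix y' z' h' assume y': "dist y' y < \<eta>'" and h': "0 \<le> h'" "h' \<le> R" "z' \<in> level_torus I X \<rho> c a h'"
    have "norm y' \<le> norm z + norm (y - z) + norm (y' - y)"
      using norm_triangle_ineq[of z "y - z"] norm_triangle_ineq[of y "y' - y"] by simp
    then have "y' \<in> B" using y' nY[OF zY] by (simp add: B_def \<eta>'_def dist_norm)
    then have "(y', z', h') \<in> B \<times> Y" using h' by (simp add: Y_def)
    from p(2)[OF this]
    show "u y' + ereal (\<delta> * (norm y')\<^sup>2 - N * (norm (y' - z'))\<^sup>2 - A * h')
      \<le> ereal (x + \<delta> * (norm y)\<^sup>2 - N * (norm (y - z))\<^sup>2 - A * h)"
      by (simp add: \<Phi>_def pe x algebra_simps)
  qed auto
qed

section \<open>Supporting functions\<close>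

lemma supporting_fun_bdd:
  assumes "bounded S"
  shows "bdd_above ((\<lambda>x. x \<bullet> \<xi>) ` S)"
proof -
  obtain B where "\<And>x. x \<in> S \<Longrightarrow> norm x \<le> B" using assms bounded_iff by metis
  then have "x \<bullet> \<xi> \<le> B * norm \<xi>" if "x \<in> S" for x
    using norm_cauchy_schwarz[of x \<xi>] mult_right_mono[of "norm x" B "norm \<xi>"] that by fastforce
  then show ?thesis by (rule bdd_aboveI2)
qed

lemma supporting_fun_upper: "bounded S \<Longrightarrow> x \<in> S \<Longrightarrow> x \<bullet> \<xi> \<le> supporting_fun S \<xi>"
  unfolding supporting_fun_def by (rule cSUP_upper[OF _ supporting_fun_bdd])

lemma supporting_fun_least: "S \<noteq> {} \<Longrightarrow> (\<And>x. x \<in> S \<Longrightarrow> x \<bullet> \<xi> \<le> b) \<Longrightarrow> supporting_fun S \<xi> \<le> b"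
  unfolding supporting_fun_def by (rule cSUP_least)

lemma supporting_fun_mono:
  fixes \<xi> \<eta> :: "real^'n"
  assumes "bounded S" "S \<noteq> {}" "S \<subseteq> nonneg_orthant" "\<And>i. \<xi> $ i \<le> \<eta> $ i"
  shows "supporting_fun S \<xi> \<le> supporting_fun S \<eta>"
proof (rule supporting_fun_least[OF assms(2)])
  fix x assume x: "x \<in> S"
  then have "x \<bullet> \<xi> \<le> x \<bullet> \<eta>"
    using assms(3,4) by (auto simp: inner_vec_def nonneg_orthant_def intro!: sum_mono mult_left_mono)
  also have "\<dots> \<le> supporting_fun S \<eta>" by (rule supporting_fun_upper[OF assms(1) x])
  finally show "x \<bullet> \<xi> \<le> supporting_fun S \<eta>" .
qed

lemma supporting_fun_add_le:
  assumes "bounded S" "S \<noteq> {}"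
  shows "supporting_fun S (\<xi> + \<eta>) \<le> supporting_fun S \<xi> + supporting_fun S \<eta>"
  using assms by (intro supporting_fun_least) (auto simp: inner_add_right intro!: add_mono supporting_fun_upper)

lemma supporting_fun_scale_le:
  assumes "bounded S" "S \<noteq> {}" "0 \<le> t"
  shows "supporting_fun S (t *\<^sub>R \<xi>) \<le> t * supporting_fun S \<xi>"
  using assms by (intro supporting_fun_least) (auto intro!: mult_left_mono supporting_fun_upper)

section \<open>Bounds by polynomials\<close>

text \<open>The Green function, with pole at infinity, of the lemniscate \<open>\<kappa> |root_prod X| \<le> 1\<close>.\<close>
definition lemniscate_green :: "complex set \<Rightarrow> real \<Rightarrow> complex \<Rightarrow> real" where
  "lemniscate_green X \<kappa> z = log_plus (\<kappa> * cmod (root_prod X z)) / real (card X)"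

lemma lemniscate_green_nonneg: "0 \<le> lemniscate_green X \<kappa> z"
  by (simp add: lemniscate_green_def)

lemma lemniscate_green_growth:
  assumes X: "finite X" "X \<noteq> {}" and "0 < \<kappa>"
  obtains C where "0 \<le> C" "\<And>z. log_plus (cmod z) \<le> lemniscate_green X \<kappa> z + C"
proof -
  obtain r where r: "0 < r" "\<And>x. x \<in> X \<Longrightarrow> cmod x \<le> r"
    using finite_imp_bounded[OF X(1)] bounded_pos by metis
  define n where "n = real (card X)"
  have n: "1 \<le> n" using X by (simp add: n_def Suc_le_eq card_gt_0_iff)
  define C where "C = ln (2 * r + 1) + ln 2 + \<bar>ln \<kappa>\<bar>"
  have "0 \<le> C" using r(1) by (simp add: C_def)
  moreover have "log_plus (cmod z) \<le> lemniscate_green X \<kappa> z + C" for z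
  proof (cases "cmod z \<le> 2 * r + 1")
    case True
    then have "log_plus (cmod z) \<le> ln (2 * r + 1)" using r(1) by (simp add: log_plus_def)
    moreover have "0 \<le> ln (2::real)" "0 \<le> \<bar>ln \<kappa>\<bar>" by auto
    ultimately show ?thesis using lemniscate_green_nonneg[of X \<kappa> z] unfolding C_def by linarith
  next
    case False
    then have z: "1 < cmod z" "0 < cmod z" using r(1) by auto
    have "cmod z / 2 \<le> cmod (z - x)" if "x \<in> X" for x
      using norm_triangle_ineq2[of z x] r(2)[OF that] False by simp
    then have "(\<Prod>x\<in>X. cmod z / 2) \<le> cmod (root_prod X z)"
      unfolding norm_root_prod by (intro prod_mono) auto
    then have low: "\<kappa> * (cmod z / 2) ^ card X \<le> \<kappa> * cmod (root_prod X z)" using \<open>0 < \<kappa>\<close> by simp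
    have "ln \<kappa> + n * (ln (cmod z) - ln 2) = ln (\<kappa> * (cmod z / 2) ^ card X)"
      using z \<open>0 < \<kappa>\<close> by (simp add: ln_mult ln_realpow ln_div n_def)
    also have "\<dots> \<le> log_plus (\<kappa> * (cmod z / 2) ^ card X)" using z \<open>0 < \<kappa>\<close> by (intro log_plus_ge_ln) simp
    also have "\<dots> \<le> log_plus (\<kappa> * cmod (root_prod X z))" by (rule log_plus_mono[OF low])
    finally have "(ln \<kappa> + n * (ln (cmod z) - ln 2)) / n \<le> lemniscate_green X \<kappa> z"
      unfolding lemniscate_green_def n_def[symmetric] using n by (intro divide_right_mono) auto
    then have "ln \<kappa> / n + ln (cmod z) - ln 2 \<le> lemniscate_green X \<kappa> z"
      using n by (simp add: add_divide_distrib)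
    moreover have "\<bar>ln \<kappa>\<bar> / n \<le> \<bar>ln \<kappa>\<bar> / 1" using n by (intro divide_left_mono) auto
    then have "\<bar>ln \<kappa> / n\<bar> \<le> \<bar>ln \<kappa>\<bar>" using n by (simp add: abs_divide)
    then have "- \<bar>ln \<kappa>\<bar> \<le> ln \<kappa> / n" by linarith
    moreover have "log_plus (cmod z) = ln (cmod z)" using z by (simp add: log_plus_def)
    moreover have "0 \<le> ln (2 * r + 1)" using r(1) by simp
    ultimately show ?thesis unfolding C_def by linarith
  qed
  ultimately show ?thesis using that by blast
qed

text \<open>This is the product formula for lemniscates, up to \<open>\<epsilon>\<close>. The maximum principle is applied between
  \<open>h = 0\<close>, where all polynomials have modulus at most 1, and \<open>h = R\<close>, where the \<open>i\<close>-th Green function is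
  \<open>R\<close> times its value at \<open>a\<close>; the point \<open>a\<close> itself has \<open>h = 1\<close>. The constant in the growth condition
  contributes \<open>D / R\<close>, which tends to 0.\<close>
theorem psh_bound_by_lemniscates:
  fixes u :: "complex^'n::finite \<Rightarrow> ereal"
  assumes u: "plurisubharmonic u"
    and S: "bounded S" "S \<noteq> {}" "S \<subseteq> nonneg_orthant"
    and growth: "\<And>z. u z \<le> ereal (supporting_fun S (\<chi> i. log_plus (cmod (z $ i))) + c)"
    and X: "\<And>i. finite (X i)" "\<And>i. X i \<noteq> {}" and \<kappa>: "\<And>i. 0 < \<kappa> i"
    and small: "\<And>z. (\<And>i. \<kappa> i * cmod (root_prod (X i) (z $ i)) \<le> 1) \<Longrightarrow> u z < ereal \<epsilon>" and "0 \<le> \<epsilon>"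
  shows "u a \<le> ereal (\<epsilon> + supporting_fun S (\<chi> i. lemniscate_green (X i) (\<kappa> i) (a $ i)))"
proof -
  define g where "g i = lemniscate_green (X i) (\<kappa> i) (a $ i)" for i
  define N where "N i = real (card (X i))" for i
  have N: "0 < N i" for i using X by (simp add: N_def card_gt_0_iff)
  have gpos: "0 \<le> g i" for i by (simp add: g_def lemniscate_green_nonneg)
  define I where "I = {i. 0 < g i}"
  have out: "\<kappa> i * cmod (root_prod (X i) (a $ i)) \<le> 1" if "i \<notin> I" for i
  proof -
    have "g i = 0" using that gpos[of i] by (simp add: I_def)
    then have "log_plus (\<kappa> i * cmod (root_prod (X i) (a $ i))) = 0" using N[of i] by (simp add: g_def lemniscate_green_def N_def)
    then show ?thesis by (auto simp: log_plus_def max_def split: if_splits)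
  qed
  have on: "\<kappa> i * cmod (root_prod (X i) (a $ i)) = exp (N i * g i)" if "i \<in> I" for i
  proof -
    have "log_plus (\<kappa> i * cmod (root_prod (X i) (a $ i))) = N i * g i" using N[of i] by (simp add: g_def lemniscate_green_def N_def)
    moreover have "0 < N i * g i" using that N by (simp add: I_def)
    ultimately have "ln (max 1 (\<kappa> i * cmod (root_prod (X i) (a $ i)))) = N i * g i" "0 < N i * g i"
      by (auto simp: log_plus_def)
    then have "exp (N i * g i) = max 1 (\<kappa> i * cmod (root_prod (X i) (a $ i)))" "1 < exp (N i * g i)"
      by (metis exp_ln max.strict_coboundedI1 zero_less_one, simp)
    then show ?thesis by (simp add: max_def split: if_splits)
  qed
  define \<phi> where "\<phi> = supporting_fun S"
  have phi_nonneg: "0 \<le> \<phi> \<xi>" if "\<And>i. 0 \<le> \<xi> $ i" for \<xi> :: "real^'n"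
  proof -
    obtain x where x: "x \<in> S" using S(2) by blast
    then have "0 \<le> x \<bullet> \<xi>" using S(3) that by (auto simp: inner_vec_def nonneg_orthant_def intro!: sum_nonneg)
    then show ?thesis using supporting_fun_upper[OF S(1) x, of \<xi>] by (simp add: \<phi>_def)
  qed
  show ?thesis
  proof (cases "I = {}")
    case True
    then have "u a < ereal \<epsilon>" using out by (intro small) auto
    moreover have "0 \<le> \<phi> (\<chi> i. g i)" using gpos by (intro phi_nonneg) simp
    then have "ereal \<epsilon> \<le> ereal (\<epsilon> + \<phi> (\<chi> i. g i))" by simp
    ultimately show ?thesis unfolding g_def \<phi>_def by (meson less_imp_le order.trans)
  next
    case False
    have "\<forall>i. \<exists>C\<ge>0. \<forall>z. log_plus (cmod z) \<le> lemniscate_green (X i) (\<kappa> i) z + C"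
      using lemniscate_green_growth[OF X \<kappa>] by metis
    then obtain C where C: "\<And>i. 0 \<le> C i" "\<And>i z. log_plus (cmod z) \<le> lemniscate_green (X i) (\<kappa> i) z + C i" by metis
    define D where "D = \<phi> (\<chi> i. C i) + \<bar>c\<bar> + 1"
    have "0 \<le> \<phi> (\<chi> i. C i)" using C by (intro phi_nonneg) simp
    then have D: "0 < D" by (simp add: D_def)
    define \<rho> where "\<rho> i = 1 / \<kappa> i" for i
    define cc where "cc i = N i * g i" for i
    have torus: "z \<in> level_torus I X \<rho> cc a h \<longleftrightarrow>
        (\<forall>i\<in>I. \<kappa> i * cmod (root_prod (X i) (z $ i)) = exp (cc i * h)) \<and> (\<forall>i. i \<notin> I \<longrightarrow> z $ i = a $ i)" for z h
      using \<kappa> by (simp add: level_torus_def \<rho>_def field_simps less_imp_neq[OF \<kappa>, symmetric])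
    have bound: "u a \<le> ereal (\<epsilon> + \<phi> (\<chi> i. g i) + D / R)" if R: "1 \<le> R" for R
    proof -
      have "u a \<le> ereal (\<epsilon> + (\<phi> (\<chi> i. g i) + D / R) * 1)"
      proof (rule level_torus_max_principle[OF u False, of X \<rho> cc R a])
        show "a \<in> level_torus I X \<rho> cc a 1" using on by (simp add: torus cc_def)
        show "u z < ereal \<epsilon>" if "z \<in> level_torus I X \<rho> cc a 0" for z
        proof (rule small)
          fix i show "\<kappa> i * cmod (root_prod (X i) (z $ i)) \<le> 1"
            using that out[of i] by (cases "i \<in> I") (auto simp: torus)
        qed
        show "u z < ereal (\<epsilon> + (\<phi> (\<chi> i. g i) + D / R) * R)" if "z \<in> level_torus I X \<rho> cc a R" for z
        proof -
          have "log_plus (cmod (z $ i)) \<le> R * g i + C i" for i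
          proof -
            have "lemniscate_green (X i) (\<kappa> i) (z $ i) = R * g i"
            proof (cases "i \<in> I")
              case True
              then have "\<kappa> i * cmod (root_prod (X i) (z $ i)) = exp (cc i * R)" using that by (simp add: torus)
              moreover have "0 \<le> cc i * R" using gpos[of i] N[of i] R by (simp add: cc_def)
              ultimately have "log_plus (\<kappa> i * cmod (root_prod (X i) (z $ i))) = cc i * R" by (simp add: log_plus_def)
              then show ?thesis using N[of i] by (simp add: lemniscate_green_def N_def cc_def)
            next
              case False
              then have "z $ i = a $ i" using that unfolding torus by blast
              moreover have "g i = 0" using False gpos[of i] by (simp add: I_def)
              ultimately show ?thesis by (simp add: g_def)
            qed
            then show ?thesis using C(2)[of "z $ i" i] by simp
          qed
          then have "\<phi> (\<chi> i. log_plus (cmod (z $ i))) \<le> \<phi> (R *\<^sub>R (\<chi> i. g i) + (\<chi> i. C i))"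
            unfolding \<phi>_def using S by (intro supporting_fun_mono) auto
          also have "\<dots> \<le> \<phi> (R *\<^sub>R (\<chi> i. g i)) + \<phi> (\<chi> i. C i)"
            unfolding \<phi>_def using S by (intro supporting_fun_add_le)
          also have "\<phi> (R *\<^sub>R (\<chi> i. g i)) \<le> R * \<phi> (\<chi> i. g i)"
            unfolding \<phi>_def using S R by (intro supporting_fun_scale_le) auto
          finally have le: "\<phi> (\<chi> i. log_plus (cmod (z $ i))) \<le> R * \<phi> (\<chi> i. g i) + \<phi> (\<chi> i. C i)" by simp
          have "(\<phi> (\<chi> i. g i) + D / R) * R = R * \<phi> (\<chi> i. g i) + D" using R by (simp add: field_simps)
          then have "\<phi> (\<chi> i. log_plus (cmod (z $ i))) + c < \<epsilon> + (\<phi> (\<chi> i. g i) + D / R) * R"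
            using le \<open>0 \<le> \<epsilon>\<close> unfolding D_def by linarith
          then show ?thesis using growth[of z] unfolding \<phi>_def by (meson less_ereal.simps(1) order_le_less_trans)
        qed
      qed (use X R \<kappa> N in \<open>auto simp: \<rho>_def cc_def I_def\<close>)
      then show ?thesis by (simp add: add.assoc)
    qed
    have le_e: "u a \<le> ereal (\<epsilon> + \<phi> (\<chi> i. g i)) + ereal e" if "0 < e" for e
    proof -
      have "D / max 1 (D / e) \<le> D / (D / e)" using D that by (intro divide_left_mono) auto
      then have "D / max 1 (D / e) \<le> e" using D by simp
      then have "ereal (\<epsilon> + \<phi> (\<chi> i. g i) + D / max 1 (D / e)) \<le> ereal (\<epsilon> + \<phi> (\<chi> i. g i)) + ereal e" by simp
      with bound[of "max 1 (D / e)", OF max.cobounded1] show ?thesis by (rule order.trans)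
    qed
    have "u a \<le> ereal (\<epsilon> + \<phi> (\<chi> i. g i))" by (rule ereal_le_epsilon2) (use le_e in blast)
    then show ?thesis by (simp add: g_def \<phi>_def)
  qed
qed

section \<open>Filling in the factors\<close>

lemma compact_product:
  fixes L :: "'n::finite \<Rightarrow> complex set"
  assumes "\<And>i. compact (L i)"
  shows "compact {z :: complex^'n. \<forall>i. z $ i \<in> L i}"
proof -
  have "{z :: complex^'n. \<forall>i. z $ i \<in> L i} = (\<Inter>i. (\<lambda>z. z $ i) -` L i)" by auto
  also have "closed \<dots>"
    using assms by (intro closed_INT ballI continuous_closed_vimage continuous_intros compact_imp_closed)
  finally have cl: "closed {z :: complex^'n. \<forall>i. z $ i \<in> L i}" .
  have "\<forall>i. \<exists>b. \<forall>x\<in>L i. cmod x \<le> b"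
    using assms compact_imp_bounded bounded_iff by metis
  then obtain b where b: "\<And>i x. x \<in> L i \<Longrightarrow> cmod x \<le> b i" by metis
  have "norm z \<le> (\<Sum>i\<in>UNIV. b i)" if "z \<in> {z :: complex^'n. \<forall>i. z $ i \<in> L i}" for z
    using that b by (intro order.trans[OF norm_cvec_le] sum_mono) auto
  then have "bounded {z :: complex^'n. \<forall>i. z $ i \<in> L i}" unfolding bounded_iff by blast
  with cl show ?thesis by (simp add: compact_eq_bounded_closed)
qed

lemma compact_filled:
  fixes K :: "complex set"
  assumes "compact K"
  shows "compact (K \<union> inside K)"
proof -
  have "closed (K \<union> inside K)"
    unfolding union_with_inside using open_outside[OF compact_imp_closed[OF assms]] by (rule closed_Compl)
  moreover have "bounded (K \<union> inside K)"
    using compact_imp_bounded[OF assms] bounded_inside by auto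
  ultimately show ?thesis by (simp add: compact_eq_bounded_closed)
qed

lemma norm_cvec_add_axis_sq:
  fixes z :: "complex^'n"
  shows "(norm (z + s *s axis i 1))\<^sup>2 = (norm z)\<^sup>2 + 2 * Re (cnj (z $ i) * s) + (cmod s)\<^sup>2"
proof -
  have "(cmod ((z + s *s axis i 1) $ j))\<^sup>2 = (cmod (z $ j))\<^sup>2 + (if j = i then 2 * Re (cnj (z $ i) * s) + (cmod s)\<^sup>2 else 0)" for j
  proof (cases "j = i")
    case True
    then have "(z + s *s axis i 1) $ j = z $ i + s" by (simp add: axis_def)
    then show ?thesis using True by (simp only: cmod_add_sq) simp
  qed (simp add: axis_def)
  then have "(norm (z + s *s axis i 1))\<^sup>2 = (\<Sum>j\<in>UNIV. (cmod (z $ j))\<^sup>2 + (if j = i then 2 * Re (cnj (z $ i) * s) + (cmod s)\<^sup>2 else 0))"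
    by (simp only: norm_cvec_sq)
  also have "\<dots> = (norm z)\<^sup>2 + (2 * Re (cnj (z $ i) * s) + (cmod s)\<^sup>2)"
    unfolding sum.distrib norm_cvec_sq by (subst sum.delta) auto
  finally show ?thesis by simp
qed

text \<open>Maximum principle: a strictly plurisubharmonic perturbation cannot have a maximum at a point
  with a coordinate in the open set \<open>inside (K i)\<close>.\<close>
lemma psh_nonpos_on_filled:
  fixes u :: "complex^'n::finite \<Rightarrow> ereal" and z0 :: "complex^'n"
  assumes u: "plurisubharmonic u" and K: "\<And>i. compact (K i)"
    and le: "\<And>z. (\<And>i. z $ i \<in> K i) \<Longrightarrow> u z \<le> 0"
    and z0: "\<And>i. z0 $ i \<in> K i \<union> inside (K i)"
  shows "u z0 \<le> 0"
proof (rule ccontr)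
  have usc: "upper_semicontinuous u" and fin: "\<And>z. u z < \<infinity>" using u by (auto simp: plurisubharmonic_def)
  assume "\<not> ?thesis"
  then obtain g where g: "0 < g" "ereal g < u z0"
    using ereal_dense2[of 0 "u z0"] by (auto simp: not_le zero_ereal_def)
  define L where "L = {z :: complex^'n. \<forall>i. z $ i \<in> K i \<union> inside (K i)}"
  have L: "compact L" unfolding L_def by (intro compact_product compact_filled K)
  obtain B where B: "0 < B" "\<And>z. z \<in> L \<Longrightarrow> norm z \<le> B"
    using compact_imp_bounded[OF L] bounded_pos by metis
  define \<delta> where "\<delta> = g / (2 * B\<^sup>2)"
  have \<delta>: "0 < \<delta>" "\<delta> * B\<^sup>2 = g / 2" using g B(1) by (auto simp: \<delta>_def)
  define w where "w y = u y + ereal (\<delta> * (norm y)\<^sup>2)" for y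
  have "upper_semicontinuous w"
    unfolding w_def by (intro usc_add usc usc_continuous continuous_intros fin) auto
  moreover have z0L: "z0 \<in> L" using z0 by (simp add: L_def)
  ultimately obtain z where z: "z \<in> L" "\<And>y. y \<in> L \<Longrightarrow> w y \<le> w z"
    using usc_attains_sup[of w L] L by blast
  have "ereal g < w z0"
  proof -
    have "0 \<le> \<delta> * (norm z0)\<^sup>2" using \<delta>(1) by simp
    then show ?thesis using g(2) fin[of z0] by (cases "u z0") (auto simp: w_def)
  qed
  then have big: "ereal g < w z" using z(2)[OF z0L] by (rule less_le_trans)
  have sq: "\<delta> * (norm z)\<^sup>2 \<le> g / 2"
  proof -
    have "\<delta> * (norm z)\<^sup>2 \<le> \<delta> * B\<^sup>2" using B z(1) \<delta>(1) by (intro mult_left_mono power_mono) auto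
    then show ?thesis using \<delta>(2) by simp
  qed
  obtain x where x: "u z = ereal x" using big fin[of z] by (cases "u z") (auto simp: w_def)
  have "\<not> (\<forall>i. z $ i \<in> K i)"
  proof
    assume "\<forall>i. z $ i \<in> K i"
    then have "x \<le> 0" using le[of z] x by simp
    then show False using big sq g(1) x by (simp add: w_def)
  qed
  then obtain i where i: "z $ i \<in> inside (K i)" using z(1) by (auto simp: L_def)
  obtain r where r: "0 < r" "ball (z $ i) r \<subseteq> inside (K i)"
    using open_inside[OF compact_imp_closed[OF K[of i]]] i open_contains_ball by blast
  define t where "t = r / 2"
  have t: "0 < t" "t < r" using r(1) by (auto simp: t_def)
  have "\<delta> * t\<^sup>2 \<le> 0"
  proof (rule subharmonic_no_strict_peak[where U = "\<lambda>s. u (z + s *s axis i 1)" and a = 0 and b = 1 and k = 1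
        and H = "\<lambda>\<zeta>. - 2 * of_real \<delta> * (cnj (z $ i) * \<zeta>)" and R = r and r = t])
    show "subharmonic (\<lambda>s. u (z + s *s axis i 1))" using u by (simp add: plurisubharmonic_def)
    show "u (z + 0 *s axis i 1) \<noteq> -\<infinity>" using x by simp
    show "(\<lambda>\<zeta>. - 2 * of_real \<delta> * (cnj (z $ i) * \<zeta>)) holomorphic_on ball 0 r" by (intro holomorphic_intros)
    fix \<zeta> :: complex assume \<zeta>: "cmod \<zeta> = t"
    have "z $ i + \<zeta> \<in> inside (K i)" using r(2) t \<zeta> by (intro subsetD[OF r(2)]) (simp add: dist_norm)
    then have "z + \<zeta> *s axis i 1 \<in> L" using z(1) by (auto simp: L_def axis_def)
    from z(2)[OF this] have "u (z + \<zeta> *s axis i 1) + ereal (\<delta> * (norm (z + \<zeta> *s axis i 1))\<^sup>2) \<le> ereal (x + \<delta> * (norm z)\<^sup>2)"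
      by (simp add: w_def x)
    then have "u (z + \<zeta> *s axis i 1) \<le> ereal (x + (- 2 * \<delta> * Re (cnj (z $ i) * \<zeta>)) - \<delta> * t\<^sup>2)"
      unfolding norm_cvec_add_axis_sq \<zeta> by (cases "u (z + \<zeta> *s axis i 1)") (auto simp: algebra_simps)
    then show "u (z + (0 + 1 * \<zeta> ^ 1) *s axis i 1) \<le> u (z + 0 *s axis i 1) + ereal (Re (- 2 * of_real \<delta> * (cnj (z $ i) * \<zeta>)) - \<delta> * t\<^sup>2)"
      by (simp add: x algebra_simps)
  qed (use t in auto)
  then show False using \<delta>(1) t(1) by (simp add: mult_le_0_iff)
qed

section \<open>Non-polar compact sets\<close>

text \<open>For a finite set the polynomial with these roots vanishes on it.\<close>
lemma non_polar_infinite: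
  assumes "\<not> polar K"
  shows "infinite K"
proof
  assume fin: "finite K"
  have "polar K"
  proof (cases "K = {}")
    case True
    have "subharmonic (\<lambda>z. ereal 0)"
      using cont_subharmonic_const[of 0] by (simp add: cont_subharmonic_def)
    then show ?thesis unfolding polar_def using True by (intro exI[of _ "\<lambda>z. ereal 0"]) auto
  next
    case False
    have "\<forall>z\<in>K. cmod (root_prod K z) \<le> exp (- C * real (card K))" for C
      using root_prod_eq_0_iff[OF fin] by (metis exp_ge_zero norm_zero)
    then show ?thesis using fin False by (intro polar_if_small_polynomials finite_imp_compact) blast+
  qed
  then show False using assms by simp
qed

lemma non_polar_polynomial_bound:
  assumes "compact K" "\<not> polar K"
  obtains C where "\<And>X. finite X \<Longrightarrow> X \<noteq> {} \<Longrightarrow> X \<subseteq> K \<Longrightarrow> \<exists>z\<in>K. exp (- C * real (card X)) < cmod (root_prod X z)"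
  using polar_if_small_polynomials[OF assms(1)] assms(2) by (meson not_le)

text \<open>The set where \<open>u < \<epsilon>\<close> is open and contains the compact product of the filled sets, hence a product of
  neighbourhoods of these, in which lemniscates can be inscribed.\<close>
lemma exists_lemniscates:
  fixes u :: "complex^'n::finite \<Rightarrow> ereal"
  assumes u: "plurisubharmonic u" and K: "\<And>i. compact (K i)" "\<And>i. infinite (K i)"
    and le: "\<And>z. (\<And>i. z $ i \<in> K i) \<Longrightarrow> u z \<le> 0" and "0 < \<epsilon>"
  obtains X \<kappa> where "\<And>i. X i \<subseteq> K i" "\<And>i. finite (X i)" "\<And>i. X i \<noteq> {}" "\<And>i. 0 < \<kappa> i"
    "\<And>i z. z \<in> K i \<Longrightarrow> \<kappa> i * cmod (root_prod (X i) z) \<le> 1"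
    "\<forall>z. (\<forall>i. \<kappa> i * cmod (root_prod (X i) (z $ i)) \<le> 1) \<longrightarrow> u z < ereal \<epsilon>"
proof -
  have usc: "upper_semicontinuous u" using u by (simp add: plurisubharmonic_def)
  define L where "L i = K i \<union> inside (K i)" for i
  have "compact {z :: complex^'n. \<forall>i. z $ i \<in> L i}" unfolding L_def by (intro compact_product compact_filled K)
  moreover have "open {z. u z < ereal \<epsilon>}" using usc by (simp add: upper_semicontinuous_def)
  moreover have "{z :: complex^'n. \<forall>i. z $ i \<in> L i} \<subseteq> {z. u z < ereal \<epsilon>}"
  proof
    fix z :: "complex^'n" assume "z \<in> {z. \<forall>i. z $ i \<in> L i}"
    then have "u z \<le> 0" by (intro psh_nonpos_on_filled[OF u K(1) le]) (auto simp: L_def)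
    also have "\<dots> < ereal \<epsilon>" using \<open>0 < \<epsilon>\<close> by simp
    finally show "z \<in> {z. u z < ereal \<epsilon>}" by simp
  qed
  ultimately obtain e where e: "e > 0" "(\<Union>z\<in>{z :: complex^'n. \<forall>i. z $ i \<in> L i}. ball z e) \<subseteq> {z. u z < ereal \<epsilon>}"
    by (rule compact_subset_open_imp_ball_epsilon_subset)
  define d where "d = e / real CARD('n)"
  have d: "0 < d" using e(1) by (simp add: d_def)
  define U where "U i = (\<Union>x\<in>L i. ball x d)" for i
  have U: "open (U i)" "K i \<union> inside (K i) \<subseteq> U i" for i
    using d by (auto simp: U_def L_def)
  have "\<forall>i. \<exists>X M. X \<subseteq> K i \<and> finite X \<and> X \<noteq> {} \<and> 0 < M \<and> (\<forall>z\<in>K i. cmod (root_prod X z) \<le> M) \<and>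
      (\<forall>z. z \<notin> U i \<longrightarrow> M < cmod (root_prod X z))"
    using lemniscate_neighbourhood[OF K U] by metis
  then obtain X M where XM: "\<And>i. X i \<subseteq> K i \<and> finite (X i) \<and> X i \<noteq> {} \<and> 0 < M i \<and> (\<forall>z\<in>K i. cmod (root_prod (X i) z) \<le> M i) \<and>
      (\<forall>z. z \<notin> U i \<longrightarrow> M i < cmod (root_prod (X i) z))"
    by metis
  have M: "0 < M i" for i using XM by blast
  have "u z < ereal \<epsilon>" if small: "\<And>i. 1 / M i * cmod (root_prod (X i) (z $ i)) \<le> 1" for z
  proof -
    have "z $ i \<in> U i" for i
    proof -
      have "cmod (root_prod (X i) (z $ i)) \<le> M i" using small[of i] M[of i] by (simp add: field_simps)
      then show ?thesis using XM[of i] not_le by blast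
    qed
    then have "\<forall>i. \<exists>x\<in>L i. dist x (z $ i) < d" by (auto simp: U_def)
    then obtain x where x: "\<And>i. x i \<in> L i" "\<And>i. dist (x i) (z $ i) < d" by metis
    define y :: "complex^'n" where "y = (\<chi> i. x i)"
    have "norm (y - z) \<le> (\<Sum>i\<in>UNIV. cmod ((y - z) $ i))" by (rule norm_cvec_le)
    also have "\<dots> < (\<Sum>i\<in>(UNIV :: 'n set). d)"
      using x(2) by (intro sum_strict_mono) (auto simp: y_def dist_norm)
    also have "\<dots> = e" by (simp add: d_def)
    finally have "z \<in> ball y e" by (simp add: dist_norm)
    moreover have "y \<in> {z. \<forall>i. z $ i \<in> L i}" using x(1) by (simp add: y_def)
    ultimately show ?thesis using e(2) by blast
  qed
  then show ?thesis
    using that[of X "\<lambda>i. 1 / M i"] XM M by (simp add: field_simps)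
qed

section \<open>The extremal function of one variable\<close>

lemma max0_ln_eq: "max 0 (ln (cmod z)) = log_plus (cmod z)"
  by (simp add: log_plus_eq_max)

lemma lemniscate_green_le:
  assumes X: "finite X" "X \<noteq> {}" "\<And>x. x \<in> X \<Longrightarrow> cmod x \<le> R" "0 \<le> R" and \<kappa>: "0 < \<kappa>" "\<kappa> \<le> exp (C * real (card X))" and "0 \<le> C"
  shows "lemniscate_green X \<kappa> z \<le> log_plus (cmod z) + (ln (1 + R) + C)"
proof -
  have n: "0 < real (card X)" using X by (simp add: card_gt_0_iff)
  have "log_plus (\<kappa> * cmod (root_prod X z)) \<le> log_plus (exp (C * real (card X)) * cmod (root_prod X z))"
    using \<kappa> by (intro log_plus_mono mult_right_mono) auto
  also have "\<dots> \<le> C * real (card X) + log_plus (cmod (root_prod X z))"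
    using \<open>0 \<le> C\<close> by (intro log_plus_exp_mult) auto
  also have "\<dots> \<le> C * real (card X) + real (card X) * (log_plus (cmod z) + ln (1 + R))"
    using log_plus_root_prod_le[OF X(3,4)] by simp
  also have "\<dots> = (log_plus (cmod z) + (ln (1 + R) + C)) * real (card X)" by (simp add: algebra_simps)
  finally show ?thesis unfolding lemniscate_green_def using n by (simp add: pos_divide_le_eq)
qed

lemma lemniscate_green_lelong:
  assumes X: "finite X" "X \<noteq> {}" and \<kappa>: "0 < \<kappa>"
  shows "(\<lambda>z. ereal (lemniscate_green X \<kappa> z)) \<in> lelong_class1"
proof -
  have "cont_subharmonic (\<lambda>z. (1 / real (card X)) * log_plus (\<kappa> * cmod (root_prod X z)))"
    by (intro cont_subharmonic_cmult cont_subharmonic_log_plus \<kappa> X) auto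
  then have sub: "subharmonic (\<lambda>z. ereal (lemniscate_green X \<kappa> z))"
    by (simp add: cont_subharmonic_def lemniscate_green_def)
  obtain R where R: "0 < R" "\<And>x. x \<in> X \<Longrightarrow> cmod x \<le> R"
    using finite_imp_bounded[OF X(1)] bounded_pos by metis
  have "\<kappa> = exp (ln \<kappa>)" using \<kappa> by simp
  also have "\<dots> \<le> exp (\<bar>ln \<kappa>\<bar> * real (card X))"
  proof -
    have "1 \<le> real (card X)" using X by (simp add: Suc_le_eq card_gt_0_iff)
    from mult_left_mono[OF this, of "\<bar>ln \<kappa>\<bar>"] show ?thesis by simp
  qed
  finally have "lemniscate_green X \<kappa> z \<le> log_plus (cmod z) + (ln (1 + R) + \<bar>ln \<kappa>\<bar>)" for z
    using R by (intro lemniscate_green_le X \<kappa>) auto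
  with sub show ?thesis
    unfolding lelong_class1_def max0_ln_eq by (auto intro!: exI[of _ "ln (1 + R) + \<bar>ln \<kappa>\<bar>"])
qed

lemma psh_coordinate:
  assumes "subharmonic v"
  shows "plurisubharmonic (\<lambda>z :: complex^'n. v (z $ i))"
  unfolding plurisubharmonic_def
proof (intro conjI allI)
  show "upper_semicontinuous (\<lambda>z :: complex^'n. v (z $ i))"
    by (rule usc_compose[where u = v]) (use assms in \<open>auto simp: subharmonic_def intro: continuous_intros\<close>)
  show "v (z $ i) < \<infinity>" for z using assms by (simp add: subharmonic_def)
  fix a b :: "complex^'n"
  show "subharmonic (\<lambda>\<zeta>. v ((a + \<zeta> *s b) $ i))"
    using subharmonic_affine[OF assms, of "a $ i" "b $ i"] by simp
qed

lemma supporting_fun_unit_interval: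
  fixes \<xi> :: "real^1"
  assumes "0 \<le> \<xi> $ 1"
  shows "supporting_fun (cbox 0 1) \<xi> = \<xi> $ 1"
proof (rule antisym)
  have b: "bounded (cbox 0 1 :: (real^1) set)" by simp
  have ne: "(0 :: real^1) \<in> cbox 0 1" "(1 :: real^1) \<in> cbox 0 1" by (auto simp: mem_box_cart)
  show "supporting_fun (cbox 0 1) \<xi> \<le> \<xi> $ 1"
  proof (rule supporting_fun_least)
    fix x :: "real^1" assume "x \<in> cbox 0 1"
    then have "x $ 1 * \<xi> $ 1 \<le> 1 * \<xi> $ 1" using assms by (intro mult_right_mono) (auto simp: mem_box_cart)
    then show "x \<bullet> \<xi> \<le> \<xi> $ 1" by (simp add: inner_vec_def sum_1)
  qed (use ne in auto)
  show "\<xi> $ 1 \<le> supporting_fun (cbox 0 1) \<xi>"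
    using supporting_fun_upper[OF b ne(2), of \<xi>] by (simp add: inner_vec_def sum_1)
qed

text \<open>By \<open>psh_bound_by_lemniscates\<close> in dimension one, each competitor is at most 1 plus the Green function
  of a lemniscate around \<open>K\<close>. These Green functions have a common bound: as \<open>\<kappa> |root_prod X| \<le> 1\<close> on the
  non-polar set \<open>K\<close>, the constant \<open>\<kappa>\<close> is at most \<open>exp (C * card X)\<close>.\<close>
lemma lelong_class1_bound:
  assumes K: "compact K" "\<not> polar K"
  obtains B where "\<And>u z. u \<in> lelong_class1 \<Longrightarrow> (\<And>w. w \<in> K \<Longrightarrow> u w \<le> 0) \<Longrightarrow> u z \<le> ereal (log_plus (cmod z) + B)"
proof -
  obtain C where C: "\<And>X. finite X \<Longrightarrow> X \<noteq> {} \<Longrightarrow> X \<subseteq> K \<Longrightarrow> \<exists>z\<in>K. exp (- C * real (card X)) < cmod (root_prod X z)"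
    using non_polar_polynomial_bound[OF K] by blast
  obtain R where R: "0 < R" "\<And>z. z \<in> K \<Longrightarrow> cmod z \<le> R"
    using compact_imp_bounded[OF K(1)] bounded_pos by metis
  have "u z \<le> ereal (log_plus (cmod z) + (1 + ln (1 + R) + \<bar>C\<bar>))"
    if uL: "u \<in> lelong_class1" and le: "\<And>w. w \<in> K \<Longrightarrow> u w \<le> 0" for u z
  proof -
    have sub: "subharmonic u" using uL by (simp add: lelong_class1_def)
    obtain c where c: "\<And>\<zeta>. u \<zeta> \<le> ereal (log_plus (cmod \<zeta>) + c)"
      using uL unfolding lelong_class1_def max0_ln_eq by blast
    have psh: "plurisubharmonic (\<lambda>z :: complex^1. u (z $ 1))" by (rule psh_coordinate[OF sub])
    obtain X \<kappa> where X: "\<And>i :: 1. X i \<subseteq> K" "\<And>i. finite (X i)" "\<And>i. X i \<noteq> {}" "\<And>i. 0 < \<kappa> i"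
      "\<And>i z. z \<in> K \<Longrightarrow> \<kappa> i * cmod (root_prod (X i) z) \<le> 1"
      "\<forall>z :: complex^1. (\<forall>i. \<kappa> i * cmod (root_prod (X i) (z $ i)) \<le> 1) \<longrightarrow> u (z $ 1) < ereal 1"
    proof (rule exists_lemniscates[OF psh, where K = "\<lambda>_. K" and \<epsilon> = 1])
      show "u (w $ 1) \<le> 0" if "\<And>i. w $ i \<in> K" for w :: "complex^1"
        by (rule le[OF that])
    qed (assumption | rule that K(1) non_polar_infinite[OF K(2)] zero_less_one)+
    have "u ((\<chi> i. z) $ (1 :: 1)) \<le> ereal (1 + supporting_fun (cbox 0 1) (\<chi> i :: 1. lemniscate_green (X i) (\<kappa> i) ((\<chi> i. z) $ i)))"
    proof (rule psh_bound_by_lemniscates[OF psh _ _ _ _ X(2,3,4), where c = c])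
      show "bounded (cbox 0 1 :: (real^1) set)" "cbox 0 1 \<noteq> ({} :: (real^1) set)"
        by (auto simp: interval_eq_empty_cart)
      show "cbox 0 1 \<subseteq> (nonneg_orthant :: (real^1) set)" by (auto simp: mem_box_cart nonneg_orthant_def)
      show "u (z $ 1) \<le> ereal (supporting_fun (cbox 0 1) (\<chi> i. log_plus (cmod (z $ i))) + c)" for z :: "complex^1"
        using c[of "z $ 1"] by (simp add: supporting_fun_unit_interval)
      show "u (z $ 1) < ereal 1" if "\<And>i. \<kappa> i * cmod (root_prod (X i) (z $ i)) \<le> 1" for z :: "complex^1"
        using X(6) that by blast
    qed auto
    then have "u z \<le> ereal (1 + lemniscate_green (X 1) (\<kappa> 1) z)"
      by (simp add: supporting_fun_unit_interval lemniscate_green_nonneg)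
    moreover have "lemniscate_green (X 1) (\<kappa> 1) z \<le> log_plus (cmod z) + (ln (1 + R) + \<bar>C\<bar>)"
    proof (rule lemniscate_green_le)
      show "cmod x \<le> R" if "x \<in> X 1" for x using R(2) X(1) that by blast
      obtain y where y: "y \<in> K" "exp (- C * real (card (X 1))) < cmod (root_prod (X 1) y)"
        using C[OF X(2,3,1)] by blast
      have "\<kappa> 1 * exp (- C * real (card (X 1))) \<le> \<kappa> 1 * cmod (root_prod (X 1) y)" using y(2) X(4) by (simp add: less_imp_le)
      also have "\<dots> \<le> 1" by (rule X(5)[OF y(1)])
      finally have "\<kappa> 1 \<le> exp (C * real (card (X 1)))" by (simp add: exp_minus field_simps)
      also have "\<dots> \<le> exp (\<bar>C\<bar> * real (card (X 1)))" by (simp add: mult_right_mono)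
      finally show "\<kappa> 1 \<le> exp (\<bar>C\<bar> * real (card (X 1)))" .
    qed (use X R in auto)
    ultimately show ?thesis
      by (auto elim!: order.trans)
  qed
  then show ?thesis using that by blast
qed

lemma extremal_fun1_real:
  assumes "compact K" "\<not> polar K"
  shows "\<exists>v\<ge>0. extremal_fun1 K z = ereal v"
proof -
  obtain B where B: "\<And>u z. u \<in> lelong_class1 \<Longrightarrow> (\<And>w. w \<in> K \<Longrightarrow> u w \<le> 0) \<Longrightarrow> u z \<le> ereal (log_plus (cmod z) + B)"
    using lelong_class1_bound[OF assms] by blast
  have "extremal_fun1 K z \<le> ereal (log_plus (cmod z) + B)"
    unfolding extremal_fun1_def using B by (intro SUP_least) auto
  moreover have "(\<lambda>z. ereal 0) \<in> lelong_class1"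
    using cont_subharmonic_const[of 0]
    by (auto simp: lelong_class1_def cont_subharmonic_def intro!: exI[of _ 0])
  then have "ereal 0 \<le> extremal_fun1 K z"
    unfolding extremal_fun1_def by (intro SUP_upper2[of "\<lambda>z. ereal 0"]) auto
  ultimately show ?thesis by (cases "extremal_fun1 K z") auto
qed

lemma extremal_fun1_upper:
  assumes "u \<in> lelong_class1" "\<And>w. w \<in> K \<Longrightarrow> u w \<le> 0"
  shows "u z \<le> extremal_fun1 K z"
  unfolding extremal_fun1_def using assms by (intro SUP_upper) auto

section \<open>The lower hull\<close>

definition lower_closure :: "(real^'n) set \<Rightarrow> (real^'n) set" where
  "lower_closure S = {t. t \<in> nonneg_orthant \<and> (\<exists>s\<in>S. \<forall>i. t $ i \<le> s $ i)}"

text \<open>Points below \<open>s\<close> are the products, entry by entry, of \<open>s\<close> with points of the unit cube.\<close>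
lemma compact_lower_closure:
  fixes S :: "(real^'n::finite) set"
  assumes "compact S" "S \<subseteq> nonneg_orthant"
  shows "compact (lower_closure S)"
proof -
  define f :: "(real^'n) \<times> (real^'n) \<Rightarrow> real^'n" where "f p = (\<chi> i. snd p $ i * fst p $ i)" for p
  have "lower_closure S = f ` (S \<times> cbox 0 1)"
  proof
    show "f ` (S \<times> cbox 0 1) \<subseteq> lower_closure S"
    proof
      fix t assume "t \<in> f ` (S \<times> cbox 0 1)"
      then obtain s l where sl: "s \<in> S" "l \<in> cbox 0 1" "t = f (s, l)" by auto
      have "0 \<le> s $ i" "0 \<le> l $ i" "l $ i \<le> 1" for i
        using sl assms(2) by (auto simp: nonneg_orthant_def mem_box_cart)
      then have "0 \<le> t $ i \<and> t $ i \<le> s $ i" for i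
        using sl(3) by (simp add: f_def mult_left_le_one_le)
      then show "t \<in> lower_closure S" using sl(1) by (auto simp: lower_closure_def nonneg_orthant_def)
    qed
    show "lower_closure S \<subseteq> f ` (S \<times> cbox 0 1)"
    proof
      fix t assume "t \<in> lower_closure S"
      then obtain s where s: "s \<in> S" "\<And>i. t $ i \<le> s $ i" "\<And>i. 0 \<le> t $ i"
        by (auto simp: lower_closure_def nonneg_orthant_def)
      define l :: "real^'n" where "l = (\<chi> i. t $ i / s $ i)"
      have "0 \<le> l $ i \<and> l $ i \<le> 1 \<and> l $ i * s $ i = t $ i" for i
        using s(2)[of i] s(3)[of i] by (cases "s $ i = 0") (auto simp: l_def divide_le_eq)
      then have "l \<in> cbox 0 1" "t = f (s, l)" by (auto simp: mem_box_cart f_def vec_eq_iff)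
      then show "t \<in> f ` (S \<times> cbox 0 1)" using s(1) by blast
    qed
  qed
  moreover have "continuous_on (S \<times> cbox 0 1) f"
    unfolding f_def by (intro continuous_intros)
  ultimately show ?thesis
    using assms(1) by (simp add: compact_continuous_image compact_Times)
qed

lemma lower_set_lower_closure:
  fixes S :: "(real^'n::finite) set"
  assumes "compact S" "convex S" "S \<subseteq> nonneg_orthant" "0 \<in> S"
  shows "lower_set (lower_closure S)"
  unfolding lower_set_def
proof (intro conjI ballI)
  show "compact (lower_closure S)" by (rule compact_lower_closure[OF assms(1,3)])
  show "lower_closure S \<subseteq> nonneg_orthant" by (auto simp: lower_closure_def)
  show "0 \<in> lower_closure S" using assms(4) by (auto simp: lower_closure_def nonneg_orthant_def intro!: bexI[of _ 0])
  show "convex (lower_closure S)"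
  proof (rule convexI)
    fix t t' :: "real^'n" and a b :: real
    assume t: "t \<in> lower_closure S" "t' \<in> lower_closure S" and ab: "0 \<le> a" "0 \<le> b" "a + b = 1"
    then obtain s s' where s: "s \<in> S" "\<And>i. t $ i \<le> s $ i" "s' \<in> S" "\<And>i. t' $ i \<le> s' $ i"
      by (auto simp: lower_closure_def)
    have "a *\<^sub>R s + b *\<^sub>R s' \<in> S" using convexD[OF assms(2) s(1,3) ab] .
    moreover have "(a *\<^sub>R t + b *\<^sub>R t') $ i \<le> (a *\<^sub>R s + b *\<^sub>R s') $ i" for i
      using s(2,4)[of i] ab by (simp add: add_mono mult_left_mono)
    moreover have "a *\<^sub>R t + b *\<^sub>R t' \<in> nonneg_orthant"
      using t ab by (auto simp: lower_closure_def nonneg_orthant_def)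
    ultimately show "a *\<^sub>R t + b *\<^sub>R t' \<in> lower_closure S" unfolding lower_closure_def by blast
  qed
  fix t assume t: "t \<in> lower_closure S"
  show "cbox 0 t \<subseteq> lower_closure S"
  proof
    fix x assume "x \<in> cbox 0 t"
    then have x: "0 \<le> x $ i" "x $ i \<le> t $ i" for i by (auto simp: mem_box_cart)
    obtain s where "s \<in> S" "\<And>i. t $ i \<le> s $ i" using t by (auto simp: lower_closure_def)
    then show "x \<in> lower_closure S"
      using x order.trans unfolding lower_closure_def nonneg_orthant_def by blast
  qed
qed

lemma lower_hull_eq:
  fixes S :: "(real^'n::finite) set"
  assumes "compact S" "convex S" "S \<subseteq> nonneg_orthant" "0 \<in> S"
  shows "lower_set hull S = lower_closure S"
proof (rule hull_unique)
  show "S \<subseteq> lower_closure S" using assms(3) by (auto simp: lower_closure_def)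
  show "lower_set (lower_closure S)" by (rule lower_set_lower_closure[OF assms])
  fix T assume T: "S \<subseteq> T" "lower_set T"
  show "lower_closure S \<subseteq> T"
  proof
    fix t assume "t \<in> lower_closure S"
    then obtain s where "s \<in> S" "t \<in> cbox 0 s"
      by (auto simp: lower_closure_def nonneg_orthant_def mem_box_cart)
    then show "t \<in> T" using T unfolding lower_set_def by blast
  qed
qed

lemma supporting_fun_lower_closure:
  fixes S :: "(real^'n::finite) set" and \<xi> :: "real^'n"
  assumes "compact S" "S \<subseteq> nonneg_orthant" "S \<noteq> {}" and \<xi>: "\<And>i. 0 \<le> \<xi> $ i"
  shows "supporting_fun (lower_closure S) \<xi> = supporting_fun S \<xi>"
proof (rule antisym)
  have sub: "S \<subseteq> lower_closure S" using assms(2) by (auto simp: lower_closure_def)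
  have bS: "bounded S" "bounded (lower_closure S)"
    using assms compact_lower_closure compact_imp_bounded by blast+
  show "supporting_fun (lower_closure S) \<xi> \<le> supporting_fun S \<xi>"
  proof (rule supporting_fun_least)
    show "lower_closure S \<noteq> {}" using sub assms(3) by blast
    fix t assume "t \<in> lower_closure S"
    then obtain s where s: "s \<in> S" "\<And>i. t $ i \<le> s $ i" by (auto simp: lower_closure_def)
    then have "t \<bullet> \<xi> \<le> s \<bullet> \<xi>" using \<xi> by (auto simp: inner_vec_def intro!: sum_mono mult_right_mono)
    also have "\<dots> \<le> supporting_fun S \<xi>" by (rule supporting_fun_upper[OF bS(1) s(1)])
    finally show "t \<bullet> \<xi> \<le> supporting_fun S \<xi>" .
  qed
  show "supporting_fun S \<xi> \<le> supporting_fun (lower_closure S) \<xi>"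
    using assms(3) sub by (intro supporting_fun_least supporting_fun_upper bS) auto
qed

section \<open>The logarithmic supporting function of a lower set\<close>

text \<open>In a lower set, the entries of \<open>x\<close> that meet a negative entry of \<open>\<xi>\<close> can be replaced by 0.\<close>
lemma supporting_fun_positive_part:
  fixes T :: "(real^'n::finite) set" and \<xi> :: "real^'n"
  assumes T: "lower_set T"
  shows "supporting_fun T \<xi> = supporting_fun T (\<chi> i. max 0 (\<xi> $ i))"
proof (rule antisym)
  have b: "bounded T" "T \<noteq> {}" "T \<subseteq> nonneg_orthant"
    using T compact_imp_bounded by (auto simp: lower_set_def)
  show "supporting_fun T \<xi> \<le> supporting_fun T (\<chi> i. max 0 (\<xi> $ i))"
    by (rule supporting_fun_mono[OF b]) simp
  show "supporting_fun T (\<chi> i. max 0 (\<xi> $ i)) \<le> supporting_fun T \<xi>"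
  proof (rule supporting_fun_least[OF b(2)])
    fix x assume x: "x \<in> T"
    define y :: "real^'n" where "y = (\<chi> i. if 0 \<le> \<xi> $ i then x $ i else 0)"
    have "0 \<le> x $ i" for i using x b(3) by (auto simp: nonneg_orthant_def)
    then have "y \<in> cbox 0 x" by (auto simp: mem_box_cart y_def)
    then have "y \<in> T" using x T by (auto simp: lower_set_def)
    then have "y \<bullet> \<xi> \<le> supporting_fun T \<xi>" by (rule supporting_fun_upper[OF b(1)])
    moreover have "x \<bullet> (\<chi> i. max 0 (\<xi> $ i)) = y \<bullet> \<xi>"
      unfolding inner_vec_def by (intro sum.cong) (auto simp: y_def max_def)
    ultimately show "x \<bullet> (\<chi> i. max 0 (\<xi> $ i)) \<le> supporting_fun T \<xi>" by simp
  qed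
qed

lemma continuous_on_supporting_fun:
  fixes T :: "(real^'n::finite) set"
  assumes "bounded T" "T \<noteq> {}"
  shows "continuous_on A (supporting_fun T)"
proof -
  obtain B where B: "0 < B" "\<And>x. x \<in> T \<Longrightarrow> norm x \<le> B" using assms(1) bounded_pos by metis
  have lip: "supporting_fun T \<xi> \<le> supporting_fun T \<eta> + B * norm (\<xi> - \<eta>)" for \<xi> \<eta>
  proof (rule supporting_fun_least[OF assms(2)])
    fix x assume x: "x \<in> T"
    have "x \<bullet> \<xi> = x \<bullet> \<eta> + x \<bullet> (\<xi> - \<eta>)" by (simp add: inner_diff_right)
    also have "\<dots> \<le> supporting_fun T \<eta> + norm x * norm (\<xi> - \<eta>)"
      using supporting_fun_upper[OF assms(1) x] norm_cauchy_schwarz by (intro add_mono) auto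
    also have "\<dots> \<le> supporting_fun T \<eta> + B * norm (\<xi> - \<eta>)"
      using B(2)[OF x] by (simp add: mult_right_mono)
    finally show "x \<bullet> \<xi> \<le> supporting_fun T \<eta> + B * norm (\<xi> - \<eta>)" .
  qed
  have "B-lipschitz_on A (supporting_fun T)"
  proof (rule lipschitz_onI)
    fix \<xi> \<eta> :: "real^'n"
    show "dist (supporting_fun T \<xi>) (supporting_fun T \<eta>) \<le> B * dist \<xi> \<eta>"
      using lip[of \<xi> \<eta>] lip[of \<eta> \<xi>] by (simp add: dist_norm norm_minus_commute abs_le_iff)
  qed (use B in simp)
  then show ?thesis by (rule lipschitz_on_continuous_on)
qed

lemma punctured_space_islimpt:
  fixes z :: "complex^'n::finite"
  assumes "z \<notin> punctured_space"
  shows "z islimpt punctured_space"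
  unfolding islimpt_approachable
proof (intro allI impI)
  fix e :: real assume "e > 0"
  define d where "d = e / (2 * real CARD('n))"
  have d: "0 < d" using \<open>e > 0\<close> by (simp add: d_def)
  define w :: "complex^'n" where "w = (\<chi> i. if z $ i = 0 then of_real d else z $ i)"
  have "w \<in> punctured_space" using d by (auto simp: w_def punctured_space_def)
  moreover have "dist w z < e"
  proof -
    have "norm (w - z) \<le> (\<Sum>i\<in>UNIV. cmod ((w - z) $ i))" by (rule norm_cvec_le)
    also have "\<dots> \<le> (\<Sum>i\<in>(UNIV :: 'n set). d)" using d by (intro sum_mono) (auto simp: w_def)
    also have "\<dots> = e / 2" by (simp add: d_def)
    finally show ?thesis using \<open>e > 0\<close> by (simp add: dist_norm)
  qed
  ultimately show "\<exists>x'\<in>punctured_space. x' \<noteq> z \<and> dist x' z < e" using assms by metis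
qed

text \<open>On the coordinate hyperplanes the limit superior is a limit because the positive part of the
  logarithm extends continuously by 0.\<close>
lemma log_supporting_fun_lower_set:
  fixes T :: "(real^'n::finite) set" and z :: "complex^'n"
  assumes T: "lower_set T"
  shows "log_supporting_fun T z = ereal (supporting_fun T (\<chi> i. log_plus (cmod (z $ i))))"
proof -
  define h where "h w = ereal (supporting_fun T (\<chi> i. ln (cmod (w $ i))))" for w :: "complex^'n"
  define G where "G w = supporting_fun T (\<chi> i. log_plus (cmod (w $ i)))" for w :: "complex^'n"
  have b: "bounded T" "T \<noteq> {}" using T compact_imp_bounded by (auto simp: lower_set_def)
  have hG: "h w = ereal (G w)" for w
    unfolding h_def G_def by (subst supporting_fun_positive_part[OF T]) (simp add: log_plus_eq_max)
  have "continuous_on UNIV G"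
    unfolding G_def
    by (rule continuous_on_compose2[OF continuous_on_supporting_fun[OF b, of UNIV]])
       (auto intro!: continuous_intros)
  then have "(G \<longlongrightarrow> G z) (at z within punctured_space)"
    by (meson continuous_on_def iso_tuple_UNIV_I tendsto_within_subset subset_UNIV)
  then have lim: "(h \<longlongrightarrow> ereal (G z)) (at z within punctured_space)"
    unfolding hG[abs_def] by simp
  show ?thesis
  proof (cases "z \<in> punctured_space")
    case True
    then show ?thesis using hG[of z] by (simp add: log_supporting_fun_def Let_def h_def G_def)
  next
    case False
    then have "\<not> trivial_limit (at z within punctured_space)"
      using punctured_space_islimpt by (simp add: trivial_limit_within)
    then have "Limsup (at z within punctured_space) h = ereal (G z)" using lim by (rule lim_imp_Limsup)
    then show ?thesis using False by (simp add: log_supporting_fun_def Let_def h_def[abs_def] G_def)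
  qed
qed

section \<open>Sums of functions of one variable\<close>

lemma psh_cmult_nonneg:
  fixes u :: "complex^'n \<Rightarrow> ereal"
  assumes u: "plurisubharmonic u" "\<And>z. 0 \<le> u z" and "0 \<le> s"
  shows "plurisubharmonic (\<lambda>z. ereal s * u z)"
  unfolding plurisubharmonic_def
proof (intro conjI allI)
  show "upper_semicontinuous (\<lambda>z. ereal s * u z)"
  proof (cases "s = 0")
    case False
    then have "{z. ereal s * u z < c} = {z. u z < c / ereal s}" for c
      using \<open>0 \<le> s\<close> by (auto simp: ereal_less_divide_pos)
    then show ?thesis using u(1) by (simp add: upper_semicontinuous_def plurisubharmonic_def)
  qed (auto simp: upper_semicontinuous_def simp flip: zero_ereal_def)
  show "subharmonic (\<lambda>\<zeta>. ereal s * u (a + \<zeta> *s b))" for a b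
    using u \<open>0 \<le> s\<close> by (intro subharmonic_cmult_nonneg) (auto simp: plurisubharmonic_def)
  show "ereal s * u z < \<infinity>" for z
  proof -
    have "u z < \<infinity>" using u(1) by (simp add: plurisubharmonic_def)
    then show ?thesis using u(2)[of z] by (cases "u z") auto
  qed
qed

lemma psh_sum_nonneg:
  fixes u :: "'i \<Rightarrow> complex^'n \<Rightarrow> ereal"
  assumes "finite I" and "\<And>i. i \<in> I \<Longrightarrow> plurisubharmonic (u i)" and "\<And>i z. i \<in> I \<Longrightarrow> 0 \<le> u i z"
  shows "plurisubharmonic (\<lambda>z. \<Sum>i\<in>I. u i z)"
  unfolding plurisubharmonic_def
proof (intro conjI allI)
  have fin: "(\<Sum>i\<in>J. u i z) < \<infinity>" if "J \<subseteq> I" for J z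
  proof -
    have "u i z \<noteq> \<infinity>" if "i \<in> J" for i
      using assms(2)[of i] that \<open>J \<subseteq> I\<close> by (auto simp: plurisubharmonic_def less_top[symmetric])
    then show ?thesis using sum_Pinfty[of "\<lambda>i. u i z" J] by (auto simp: less_top[symmetric])
  qed
  then show "(\<Sum>i\<in>I. u i z) < \<infinity>" for z by blast
  show "upper_semicontinuous (\<lambda>z. \<Sum>i\<in>I. u i z)"
    using \<open>finite I\<close> assms(2) fin
  proof (induction I rule: finite_induct)
    case (insert i J)
    have "upper_semicontinuous (\<lambda>z. u i z + (\<Sum>i\<in>J. u i z))"
    proof (rule usc_add)
      show "upper_semicontinuous (u i)" "\<And>z. u i z < \<infinity>" using insert.prems(1)[of i] by (auto simp: plurisubharmonic_def)
      show "upper_semicontinuous (\<lambda>z. \<Sum>i\<in>J. u i z)" 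
      proof (rule insert.IH)
        show "plurisubharmonic (u j)" if "j \<in> J" for j using insert.prems(1) that by blast
        show "(\<Sum>i\<in>J'. u i z) < \<infinity>" if "J' \<subseteq> J" for J' z using that by (intro insert.prems(2)) blast
      qed
      show "(\<Sum>i\<in>J. u i z) < \<infinity>" for z by (rule insert.prems(2)) auto
    qed
    then show ?case using insert by simp
  qed (auto simp: upper_semicontinuous_def)
  show "subharmonic (\<lambda>\<zeta>. \<Sum>i\<in>I. u i (a + \<zeta> *s b))" for a b
    using assms by (intro subharmonic_sum_nonneg) (auto simp: plurisubharmonic_def)
qed

section \<open>The product formula\<close>

text \<open>The lemniscate Green functions are themselves competitors for the one-variable extremal functions, so
  the bound by lemniscates is a bound by the latter.\<close>
lemma extremal_fun_le:
  fixes K :: "'n::finite \<Rightarrow> complex set" and T :: "(real^'n) set" and z :: "complex^'n"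
  assumes K: "\<And>i. compact (K i)" "\<And>i. \<not> polar (K i)" and T: "lower_set T"
  shows "extremal_fun T {w. \<forall>i. w $ i \<in> K i} z \<le>
    ereal (supporting_fun T (\<chi> i. real_of_ereal (extremal_fun1 (K i) (z $ i))))"
  unfolding extremal_fun_def
proof (rule SUP_least)
  define V where "V i = real_of_ereal (extremal_fun1 (K i) (z $ i))" for i
  have V: "extremal_fun1 (K i) (z $ i) = ereal (V i)" for i
    using extremal_fun1_real[OF K, of i "z $ i"] by (auto simp: V_def)
  have b: "bounded T" "T \<noteq> {}" "T \<subseteq> nonneg_orthant"
    using T compact_imp_bounded by (auto simp: lower_set_def)
  fix u assume "u \<in> {u \<in> lelong_class T. \<forall>w\<in>{w. \<forall>i. w $ i \<in> K i}. u w \<le> 0}"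
  then have u: "plurisubharmonic u" and uK: "\<And>w. (\<And>i. w $ i \<in> K i) \<Longrightarrow> u w \<le> 0"
    and "\<exists>c::real. \<forall>z. u z \<le> log_supporting_fun T z + ereal c"
    by (auto simp: lelong_class_def)
  then obtain c where c: "\<And>z. u z \<le> ereal (supporting_fun T (\<chi> i. log_plus (cmod (z $ i))) + c)"
    by (auto simp: log_supporting_fun_lower_set[OF T])
  have "u z \<le> ereal (supporting_fun T (\<chi> i. V i)) + ereal \<epsilon>" if eps: "0 < \<epsilon>" for \<epsilon>
  proof -
    obtain X \<kappa> where X: "\<And>i. X i \<subseteq> K i" "\<And>i. finite (X i)" "\<And>i. X i \<noteq> {}" "\<And>i. 0 < \<kappa> i"
      "\<And>i z. z \<in> K i \<Longrightarrow> \<kappa> i * cmod (root_prod (X i) z) \<le> 1"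
      "\<forall>z. (\<forall>i. \<kappa> i * cmod (root_prod (X i) (z $ i)) \<le> 1) \<longrightarrow> u z < ereal \<epsilon>"
    proof (rule exists_lemniscates[OF u, where K = K and \<epsilon> = \<epsilon>])
      show "u w \<le> 0" if "\<And>i. w $ i \<in> K i" for w
        by (rule uK[OF that])
    qed (assumption | rule that K(1) non_polar_infinite[OF K(2)] eps)+
    have "u z \<le> ereal (\<epsilon> + supporting_fun T (\<chi> i. lemniscate_green (X i) (\<kappa> i) (z $ i)))"
      by (rule psh_bound_by_lemniscates[OF u b c X(2,3,4)]) (use X(6) eps in auto)
    also have "supporting_fun T (\<chi> i. lemniscate_green (X i) (\<kappa> i) (z $ i)) \<le> supporting_fun T (\<chi> i. V i)"
    proof (rule supporting_fun_mono[OF b])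
      fix i
      have "lemniscate_green (X i) (\<kappa> i) w = 0" if "w \<in> K i" for w
        using X(5)[OF that] by (simp add: lemniscate_green_def log_plus_def)
      then have "ereal (lemniscate_green (X i) (\<kappa> i) (z $ i)) \<le> extremal_fun1 (K i) (z $ i)"
        by (intro extremal_fun1_upper[OF lemniscate_green_lelong[OF X(2,3,4)]]) simp
      then show "(\<chi> i. lemniscate_green (X i) (\<kappa> i) (z $ i)) $ i \<le> (\<chi> i. V i) $ i"
        unfolding V by simp
    qed
    finally show ?thesis by (simp add: add.commute)
  qed
  then have "u z \<le> ereal (supporting_fun T (\<chi> i. V i))" by (rule ereal_le_epsilon2)
  then show "u z \<le> ereal (supporting_fun T (\<chi> i. real_of_ereal (extremal_fun1 (K i) (z $ i))))"
    by (simp add: V_def)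
qed

text \<open>For each \<open>s\<close> in \<open>T\<close>, the competitors \<open>v i\<close> that are optimal up to \<open>d\<close> at \<open>z i\<close> are combined with weights
  \<open>s i\<close>. Positive parts still vanish on \<open>K i\<close>, and circle means of nonnegative functions are additive.\<close>
lemma extremal_fun_ge:
  fixes K :: "'n::finite \<Rightarrow> complex set" and T :: "(real^'n) set" and z :: "complex^'n"
  assumes K: "\<And>i. compact (K i)" "\<And>i. \<not> polar (K i)" and T: "lower_set T"
  shows "ereal (supporting_fun T (\<chi> i. real_of_ereal (extremal_fun1 (K i) (z $ i)))) \<le>
    extremal_fun T {w. \<forall>i. w $ i \<in> K i} z"
proof -
  define V where "V i = real_of_ereal (extremal_fun1 (K i) (z $ i))" for i
  have V: "extremal_fun1 (K i) (z $ i) = ereal (V i)" for i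
    using extremal_fun1_real[OF K, of i "z $ i"] by (auto simp: V_def)
  define E where "E = extremal_fun T {w. \<forall>i. w $ i \<in> K i} z"
  have b: "bounded T" "T \<noteq> {}" "T \<subseteq> nonneg_orthant" "0 \<in> T"
    using T compact_imp_bounded by (auto simp: lower_set_def)
  have main: "ereal (s \<bullet> (\<chi> i. V i)) \<le> E" if s: "s \<in> T" for s
  proof (rule ereal_le_epsilon2)
    fix e :: real assume "0 < e"
    have s0: "0 \<le> s $ i" for i using s b(3) by (auto simp: nonneg_orthant_def)
    define S1 where "S1 = (\<Sum>i\<in>UNIV. s $ i)"
    have S1: "0 \<le> S1" unfolding S1_def by (intro sum_nonneg s0)
    define d where "d = e / (S1 + 1)"
    have d: "0 < d" "S1 * d \<le> e" using \<open>0 < e\<close> S1 by (auto simp: d_def field_simps)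
    have "\<exists>v. v \<in> lelong_class1 \<and> (\<forall>w\<in>K i. v w \<le> 0) \<and> ereal (V i - d) < v (z $ i)" for i
    proof -
      have "ereal (V i - d) < (SUP u \<in> {u \<in> lelong_class1. \<forall>w\<in>K i. u w \<le> 0}. u (z $ i))"
        using V[of i] d(1) by (simp add: extremal_fun1_def)
      then show ?thesis unfolding less_SUP_iff by blast
    qed
    then obtain v where v: "\<And>i. v i \<in> lelong_class1" "\<And>i w. w \<in> K i \<Longrightarrow> v i w \<le> 0" "\<And>i. ereal (V i - d) < v i (z $ i)"
      by metis
    have vs: "subharmonic (v i)" for i using v(1)[of i] by (simp add: lelong_class1_def)
    have "\<forall>i. \<exists>c::real. \<forall>\<zeta>. v i \<zeta> \<le> ereal (log_plus (cmod \<zeta>) + c)"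
      using v(1) unfolding lelong_class1_def max0_ln_eq by blast
    then obtain c where c: "\<And>i \<zeta>. v i \<zeta> \<le> ereal (log_plus (cmod \<zeta>) + c i)" by metis
    define u where "u w = (\<Sum>i\<in>UNIV. ereal (s $ i) * max 0 (v i (w $ i)))" for w :: "complex^'n"
    have psh: "plurisubharmonic u"
      unfolding u_def
      by (intro psh_sum_nonneg psh_cmult_nonneg psh_coordinate[of "\<lambda>\<zeta>. max 0 (v i \<zeta>)" for i] subharmonic_max0 vs s0)
         (auto intro!: ereal_0_le_mult simp: s0)
    have "u w \<le> log_supporting_fun T w + ereal (\<Sum>i\<in>UNIV. s $ i * \<bar>c i\<bar>)" for w
    proof -
      have "u w \<le> (\<Sum>i\<in>UNIV. ereal (s $ i * (log_plus (cmod (w $ i)) + \<bar>c i\<bar>)))"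
        unfolding u_def
      proof (rule sum_mono)
        fix i
        have "v i (w $ i) \<le> ereal (log_plus (cmod (w $ i)) + \<bar>c i\<bar>)"
          using c[of i "w $ i"] by (rule order.trans) simp
        then have "max 0 (v i (w $ i)) \<le> ereal (log_plus (cmod (w $ i)) + \<bar>c i\<bar>)"
          by (simp add: zero_ereal_def)
        then have "ereal (s $ i) * max 0 (v i (w $ i)) \<le> ereal (s $ i) * ereal (log_plus (cmod (w $ i)) + \<bar>c i\<bar>)"
          using s0[of i] by (intro ereal_mult_left_mono) auto
        then show "ereal (s $ i) * max 0 (v i (w $ i)) \<le> ereal (s $ i * (log_plus (cmod (w $ i)) + \<bar>c i\<bar>))" by simp
      qed
      also have "\<dots> = ereal (s \<bullet> (\<chi> i. log_plus (cmod (w $ i))) + (\<Sum>i\<in>UNIV. s $ i * \<bar>c i\<bar>))"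
        by (simp add: inner_vec_def distrib_left sum.distrib)
      also have "\<dots> \<le> ereal (supporting_fun T (\<chi> i. log_plus (cmod (w $ i))) + (\<Sum>i\<in>UNIV. s $ i * \<bar>c i\<bar>))"
        using supporting_fun_upper[OF b(1) s] by simp
      finally show ?thesis by (simp add: log_supporting_fun_lower_set[OF T])
    qed
    then have "u \<in> lelong_class T" using psh by (auto simp: lelong_class_def)
    moreover have "u w \<le> 0" if "\<forall>i. w $ i \<in> K i" for w
      unfolding u_def using v(2) that by (intro sum_nonpos) (simp add: max_absorb1)
    ultimately have "u z \<le> E"
      unfolding E_def extremal_fun_def by (intro SUP_upper) auto
    moreover have "ereal (s \<bullet> (\<chi> i. V i) - S1 * d) \<le> u z"
    proof -
      have "ereal (s \<bullet> (\<chi> i. V i) - S1 * d) = (\<Sum>i\<in>UNIV. ereal (s $ i * (V i - d)))"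
        by (simp add: inner_vec_def S1_def right_diff_distrib sum_subtractf sum_distrib_right)
      also have "\<dots> \<le> u z"
        unfolding u_def
      proof (rule sum_mono)
        fix i
        have "ereal (V i - d) \<le> max 0 (v i (z $ i))" using v(3)[of i] by (simp add: le_max_iff_disj less_imp_le)
        then have "ereal (s $ i) * ereal (V i - d) \<le> ereal (s $ i) * max 0 (v i (z $ i))"
          using s0[of i] by (intro ereal_mult_left_mono) auto
        then show "ereal (s $ i * (V i - d)) \<le> ereal (s $ i) * max 0 (v i (z $ i))" by simp
      qed
      finally show ?thesis .
    qed
    ultimately have "ereal (s \<bullet> (\<chi> i. V i) - S1 * d) \<le> E" by (rule order.trans[rotated])
    then show "ereal (s \<bullet> (\<chi> i. V i)) \<le> E + ereal e"
      using d(2) by (cases E) auto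
  qed
  have "ereal (supporting_fun T (\<chi> i. V i)) \<le> E"
  proof (cases E)
    case (real x)
    then show ?thesis using main b(2) by (auto intro: supporting_fun_least)
  next
    case MInf
    then show ?thesis using main[OF b(4)] by simp
  qed simp
  then show ?thesis by (simp add: E_def V_def)
qed

theorem corollary1p3:
  fixes K :: "'n::finite \<Rightarrow> complex set"
    and S :: "(real^'n) set"
    and z :: "complex^'n"
  assumes "\<And>i. compact (K i)"
    and "\<And>i. \<not> polar (K i)"
    and "compact S" and "convex S" and "S \<subseteq> nonneg_orthant" and "0 \<in> S"
  shows "extremal_fun (lower_set hull S) {w. \<forall>i. w $ i \<in> K i} z =
         ereal (supporting_fun S (\<chi> i. real_of_ereal (extremal_fun1 (K i) (z $ i))))"
proof -
  have T: "lower_set (lower_closure S)" by (rule lower_set_lower_closure[OF assms(3-6)])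
  have nonneg: "0 \<le> real_of_ereal (extremal_fun1 (K i) (z $ i))" for i
    using extremal_fun1_real[OF assms(1,2), of i "z $ i"] by auto
  have "S \<noteq> {}" using assms(6) by auto
  have "extremal_fun (lower_closure S) {w. \<forall>i. w $ i \<in> K i} z =
      ereal (supporting_fun (lower_closure S) (\<chi> i. real_of_ereal (extremal_fun1 (K i) (z $ i))))"
    by (intro antisym extremal_fun_le extremal_fun_ge assms(1,2) T)
  also have "supporting_fun (lower_closure S) (\<chi> i. real_of_ereal (extremal_fun1 (K i) (z $ i))) =
      supporting_fun S (\<chi> i. real_of_ereal (extremal_fun1 (K i) (z $ i)))"
    using nonneg by (intro supporting_fun_lower_closure assms(3,5) \<open>S \<noteq> {}\<close>) simp
  finally show ?thesis unfolding lower_hull_eq[OF assms(3-6)] .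
qed

end
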